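(* Let $D\subset\Omega$ be a given open set and let $p\in\,]1,+\infty]$. Then: (i) for the energy $\mathbb{E}_1$, the maximization problem $$\max\big\{\mathcal{G}^\infty_{f,D}:\ f\in H^{-2}_*(\Omega)\ \text{with}\ \|f\|_{H^{-2}_*}=1\big\}$$ admits a solution $f\in H^{-2}_*(\Omega)$; (ii) for both the energies $\mathbb{E}_1$ and $\mathbb{E}_2$, the maximization problem $$\max\big\{\mathcal{G}^\infty_{f,D}:\ f\in L^p(\Omega)\ \text{with}\ \|f\|_{L^p}=1\big\}$$ admits a solution $f\in L^p(\Omega)$.
   Context: Let $\ell>0$, $\Omega=\,]0,\pi[\,\times\,]-\ell,\ell[\,\subset\mathbb{R}^2$, and let $0<\sigma<1$ and $d>0$ be fixed constants. Let $H^2_*(\Omega)=\{v\in H^2(\Omega): v=0 \text{ on } \{0,\pi\}\times\,]-\ell,\ell[\,\}$ (recall $H^2(\Omega)\subset C^0(\overline\Omega)$). For an open $D\subset\Omega$ set $$(u,v)_D=\int_D\left[\Delta u\,\Delta v+(1-\sigma)(2u_{xy}v_{xy}-u_{xx}v_{yy}-u_{yy}v_{xx})\right]dxdy,\qquad (u,v)_{H^2_*}=(u,v)_\Omega .$$ With $(\cdot,\cdot)_{H^2_*}$ and the norm $\|u\|_{H^2_*}^2=(u,u)_{H^2_*}$, $H^2_*(\Omega)$ is a Hilbert space, and this norm is equivalent to the $H^2$ norm. $H^{-2}_*(\Omega)$ is its dual, with duality $\langle\cdot,\cdot\rangle$ and norm $\|f\|_{H^{-2}_*}=\sup_{\|v\|_{H^2_*}=1}\langle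 f,v\rangle$. Given a force $f$ and an open set $D\subset\Omega$, $u_{f,D}\in H^2_*(\Omega)$ denotes the unique minimizer on $H^2_*(\Omega)$ of one of the following energies ($\chi_D$ is the characteristic function of $D$): - $\mathbb{E}_1(u)=\int_\Omega (1+d\chi_D)\left(\frac{(\Delta u)^2}{2}+(1-\sigma)(u_{xy}^2-u_{xx}u_{yy})\right)dxdy-\langle f,u\rangle$ for $f\in H^{-2}_*(\Omega)$ (with $\langle f,u\rangle=\int_\Omega fu$ if $f\in L^1(\Omega)$); equivalently $(u_{f,D},v)_{H^2_*}+d\,(u_{f,D},v)_D=\langle f,v\rangle$ for all $v\in H^2_*(\Omega)$; - $\mathbb{E}_2(u)=\int_\Omega\left[\frac{(\Delta u)^2}{2}+(1-\sigma)(u_{xy}^2-u_{xx}u_{yy})-\frac{fu}{1+d\chi_D}\right]dxdy$ for $f\in L^1(\Omega)$; equivalently $(u_{f,D},v)_{H^2_*}=\int_\Omega\frac{fv}{1+d\chi_D}\,dxdy$ for all $v\in H^2_*(\Omega)$. The gap function and the maximal gap are $$\mathcal{G}_{f,D}(x)=u_{f,D}(x,\ell)-u_{f,D}(x,-\ell),\qquad \mathcal{G}^\infty_{f,D}=\max_{x\in[0,\pi]}|\mathcal{G}_{f,D}(x)|.$$ *)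

theory Defs
  imports "HOL-Analysis.Analysis" "HOL-Probability.Essential_Supremum"
begin

text \<open>
  Elements of \<open>L\<^sup>p\<close> are represented by functions rather than by classes modulo almost
  everywhere equality. The exponent is an extended real, so that \<open>p = \<infinity>\<close> is included.
\<close>

definition Lp_space :: "'a measure \<Rightarrow> ereal \<Rightarrow> ('a \<Rightarrow> real) set" where
  "Lp_space M p = {f \<in> borel_measurable M.
     if p = \<infinity> then esssup M (\<lambda>z. ereal \<bar>f z\<bar>) < \<infinity>
     else integrable M (\<lambda>z. \<bar>f z\<bar> powr real_of_ereal p)}"

definition Lp_norm :: "'a measure \<Rightarrow> ereal \<Rightarrow> ('a \<Rightarrow> real) \<Rightarrow> real" where
  "Lp_norm M p f =
     (if p = \<infinity> then real_of_ereal (esssup M (\<lambda>z. ereal \<bar>f z\<bar>))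
      else (LINT z|M. \<bar>f z\<bar> powr real_of_ereal p) powr (1 / real_of_ereal p))"

primrec Ck :: "nat \<Rightarrow> ('a::euclidean_space \<Rightarrow> real) \<Rightarrow> bool" where
  "Ck 0 \<phi> \<longleftrightarrow> continuous_on UNIV \<phi>"
| "Ck (Suc k) \<phi> \<longleftrightarrow> \<phi> differentiable_on UNIV \<and>
     (\<forall>b\<in>Basis. Ck k (\<lambda>z. frechet_derivative \<phi> (at z) b))"

definition test_functions :: "'a::euclidean_space set \<Rightarrow> ('a \<Rightarrow> real) set" where
  "test_functions S = {\<phi>. (\<forall>k. Ck k \<phi>) \<and>
     compact (closure {z. \<phi> z \<noteq> 0}) \<and> closure {z. \<phi> z \<noteq> 0} \<subseteq> S}"

text \<open>A list of directions serves as a multi-index: \<open>[a, b]\<close> stands for \<open>\<partial>\<^sub>a \<partial>\<^sub>b\<close>.\<close>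

definition pderivs :: "'a::euclidean_space list \<Rightarrow> ('a \<Rightarrow> real) \<Rightarrow> 'a \<Rightarrow> real" where
  "pderivs bs \<phi> = foldr (\<lambda>b \<psi> z. frechet_derivative \<psi> (at z) b) bs \<phi>"

definition has_weak_deriv ::
  "'a::euclidean_space set \<Rightarrow> 'a list \<Rightarrow> ('a \<Rightarrow> real) \<Rightarrow> ('a \<Rightarrow> real) \<Rightarrow> bool" where
  "has_weak_deriv S bs u g \<longleftrightarrow>
     u \<in> Lp_space (lebesgue_on S) 2 \<and> g \<in> Lp_space (lebesgue_on S) 2 \<and>
     (\<forall>\<phi>\<in>test_functions S.
        (LINT z|lebesgue_on S. u z * pderivs bs \<phi> z)
          = (- 1) ^ length bs * (LINT z|lebesgue_on S. g z * \<phi> z))"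

text \<open>The weak derivative is determined up to a null set only; it is used under integrals only.\<close>

definition weak_deriv ::
  "'a::euclidean_space set \<Rightarrow> 'a list \<Rightarrow> ('a \<Rightarrow> real) \<Rightarrow> 'a \<Rightarrow> real" where
  "weak_deriv S bs u = (SOME g. has_weak_deriv S bs u g)"

definition H2 :: "'a::euclidean_space set \<Rightarrow> ('a \<Rightarrow> real) set" where
  "H2 S = {u \<in> Lp_space (lebesgue_on S) 2.
     \<forall>bs. set bs \<subseteq> Basis \<and> length bs \<le> 2 \<longrightarrow> (\<exists>g. has_weak_deriv S bs u g)}"

definition Omega :: "real \<Rightarrow> (real \<times> real) set" where
  "Omega l = {0<..<pi} \<times> {-l<..<l}"

text \<open>
  By the embedding of \<open>H\<^sup>2\<close> into the continuous functions on the closed rectangle, every class has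
  exactly one representative that is continuous on the closure and zero outside it. Choosing these
  representatives makes boundary values meaningful and elements of the space unique as functions.
\<close>

definition H2star :: "real \<Rightarrow> (real \<times> real \<Rightarrow> real) set" where
  "H2star l = {v \<in> H2 (Omega l).
     continuous_on (closure (Omega l)) v \<and>
     (\<forall>z. z \<notin> closure (Omega l) \<longrightarrow> v z = 0) \<and>
     (\<forall>z\<in>{0, pi} \<times> {-l<..<l}. v z = 0)}"

definition uxx :: "real \<Rightarrow> (real \<times> real \<Rightarrow> real) \<Rightarrow> real \<times> real \<Rightarrow> real" where
  "uxx l u = weak_deriv (Omega l) [(1, 0), (1, 0)] u"

definition uxy :: "real \<Rightarrow> (real \<times> real \<Rightarrow> real) \<Rightarrow> real \<times> real \<Rightarrow> real" where
  "uxy l u = weak_deriv (Omega l) [(1, 0), (0, 1)] u"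

definition uyy :: "real \<Rightarrow> (real \<times> real \<Rightarrow> real) \<Rightarrow> real \<times> real \<Rightarrow> real" where
  "uyy l u = weak_deriv (Omega l) [(0, 1), (0, 1)] u"

definition laplace :: "real \<Rightarrow> (real \<times> real \<Rightarrow> real) \<Rightarrow> real \<times> real \<Rightarrow> real" where
  "laplace l u z = uxx l u z + uyy l u z"

definition plate_form ::
  "real \<Rightarrow> real \<Rightarrow> (real \<times> real) set \<Rightarrow> (real \<times> real \<Rightarrow> real) \<Rightarrow> (real \<times> real \<Rightarrow> real) \<Rightarrow> real" where
  "plate_form l \<sigma> D u v = (LINT z|lebesgue_on D.
     laplace l u z * laplace l v z
     + (1 - \<sigma>) * (2 * uxy l u z * uxy l v z - uxx l u z * uyy l v z - uyy l u z * uxx l v z))"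

definition H2star_norm :: "real \<Rightarrow> real \<Rightarrow> (real \<times> real \<Rightarrow> real) \<Rightarrow> real" where
  "H2star_norm l \<sigma> u = sqrt (plate_form l \<sigma> (Omega l) u u)"

text \<open>
  Bounded linear functionals on \<^term>\<open>H2star l\<close>. They are total functions on the ambient function
  type, but only their values on \<^term>\<open>H2star l\<close> are ever used.
\<close>

definition Hm2star :: "real \<Rightarrow> real \<Rightarrow> ((real \<times> real \<Rightarrow> real) \<Rightarrow> real) set" where
  "Hm2star l \<sigma> = {F.
     (\<forall>u\<in>H2star l. \<forall>v\<in>H2star l. F (\<lambda>z. u z + v z) = F u + F v) \<and>
     (\<forall>c. \<forall>v\<in>H2star l. F (\<lambda>z. c * v z) = c * F v) \<and>
     (\<exists>C. \<forall>v\<in>H2star l. \<bar>F v\<bar> \<le> C * H2star_norm l \<sigma> v)}"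

definition Hm2star_norm :: "real \<Rightarrow> real \<Rightarrow> ((real \<times> real \<Rightarrow> real) \<Rightarrow> real) \<Rightarrow> real" where
  "Hm2star_norm l \<sigma> F = (SUP v\<in>{v \<in> H2star l. H2star_norm l \<sigma> v = 1}. F v)"

definition force_functional ::
  "real \<Rightarrow> (real \<times> real \<Rightarrow> real) \<Rightarrow> (real \<times> real \<Rightarrow> real) \<Rightarrow> real" where
  "force_functional l f u = (LINT z|lebesgue_on (Omega l). f z * u z)"

definition energy1 ::
  "real \<Rightarrow> real \<Rightarrow> real \<Rightarrow> (real \<times> real) set \<Rightarrow> ((real \<times> real \<Rightarrow> real) \<Rightarrow> real)
    \<Rightarrow> (real \<times> real \<Rightarrow> real) \<Rightarrow> real" where
  "energy1 l \<sigma> d D F u =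
     (LINT z|lebesgue_on (Omega l). (1 + d * indicat_real D z) *
        ((laplace l u z)\<^sup>2 / 2 + (1 - \<sigma>) * ((uxy l u z)\<^sup>2 - uxx l u z * uyy l u z)))
     - F u"

definition energy2 ::
  "real \<Rightarrow> real \<Rightarrow> real \<Rightarrow> (real \<times> real) set \<Rightarrow> (real \<times> real \<Rightarrow> real)
    \<Rightarrow> (real \<times> real \<Rightarrow> real) \<Rightarrow> real" where
  "energy2 l \<sigma> d D f u =
     (LINT z|lebesgue_on (Omega l).
        (laplace l u z)\<^sup>2 / 2 + (1 - \<sigma>) * ((uxy l u z)\<^sup>2 - uxx l u z * uyy l u z)
        - f z * u z / (1 + d * indicat_real D z))"

definition minimizer1 ::
  "real \<Rightarrow> real \<Rightarrow> real \<Rightarrow> (real \<times> real) set \<Rightarrow> ((real \<times> real \<Rightarrow> real) \<Rightarrow> real)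
    \<Rightarrow> real \<times> real \<Rightarrow> real" where
  "minimizer1 l \<sigma> d D F = (THE u. is_arg_min (energy1 l \<sigma> d D F) (\<lambda>v. v \<in> H2star l) u)"

definition minimizer2 ::
  "real \<Rightarrow> real \<Rightarrow> real \<Rightarrow> (real \<times> real) set \<Rightarrow> (real \<times> real \<Rightarrow> real)
    \<Rightarrow> real \<times> real \<Rightarrow> real" where
  "minimizer2 l \<sigma> d D f = (THE u. is_arg_min (energy2 l \<sigma> d D f) (\<lambda>v. v \<in> H2star l) u)"

definition gap :: "real \<Rightarrow> (real \<times> real \<Rightarrow> real) \<Rightarrow> real \<Rightarrow> real" where
  "gap l u x = u (x, l) - u (x, -l)"

text \<open>The supremum is a maximum, since the gap of an element of \<^term>\<open>H2star l\<close> is continuous.\<close>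

definition max_gap :: "real \<Rightarrow> (real \<times> real \<Rightarrow> real) \<Rightarrow> real" where
  "max_gap l u = (SUP x\<in>{0..pi}. \<bar>gap l u x\<bar>)"

end

(*
A function u in H^2_* vanishes on the short edges, so for y1, y2 in [-l, l] the difference
u(x,y2) - u(x,y1) is the integral of u_xy over ]0,x[ x ]y1,y2[. Hence the gap at x is a bounded functional
of u_xy, Hoelder-1/2 in x, uniformly on bounded sets. Together with u = - G u_xx, where G is the
one-dimensional Dirichlet Green operator in x, this bounds sup |u|, u_x and u_y by the second derivatives,
which makes H^2_* complete for the plate form and yields the minimizers by Riesz representation.

By symmetry of the form, the gap at x of the minimizer for f is <f, w_x>, where w_x represents the gap
functional at x (for the second energy f is replaced by f/(1+d chi_D)). For fixed x it is maximized over the unit sphere of H^{-2}_* or L^p (p > 1) by an explicit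
extremal of the duality with w_x. The maximal value is continuous in x, so it is attained at some x0, and the
extremal force for x0 solves the problem.
*)

theory Submission
  imports Defs
begin

subsection \<open>Smooth functions of one variable\<close>

text \<open>Weak derivatives are known only through integrals against smooth test functions, whereas
  the gap needs values on the edges y = -l and y = l. No smoothing of u is carried out; the
  smoothing sits on the test functions. Each formula for u comes from testing with a product of
  one-variable functions whose derivatives approximate point masses, pushed slightly into the open
  interval; continuity of u on the closed rectangle gives the limit. The identity for u_xx is
  obtained only for averages in y, so the sup bound has to combine it with differences in y. The
  first derivatives matter because membership in H^2 demands weak derivatives of every order up to
  two, u_yx included, and all of them must converge along a Cauchy sequence. Chosen weak derivatives
  are linear only almost everywhere, but elements of the space are determined pointwise, so a
  minimizer is unique as a function. Both energies share one pattern, a form with weight w minus a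
  linear functional: the weight is 1 + d chi_D for the first energy and 1 for the second.\<close>

primrec Cn :: "nat \<Rightarrow> (real \<Rightarrow> real) \<Rightarrow> bool" where
  "Cn 0 f \<longleftrightarrow> continuous_on UNIV f"
| "Cn (Suc k) f \<longleftrightarrow> (\<exists>f'. (\<forall>x. (f has_real_derivative f' x) (at x)) \<and> Cn k f')"

lemma Cn_SucI: "(\<And>x. (f has_real_derivative f' x) (at x)) \<Longrightarrow> Cn k f' \<Longrightarrow> Cn (Suc k) f"
  by auto

lemma Cn_continuous: "Cn k f \<Longrightarrow> continuous_on UNIV f"
  by (cases k) (auto intro!: continuous_at_imp_continuous_on intro: DERIV_isCont)

lemma Cn_Suc_D: "Cn (Suc k) f \<Longrightarrow> Cn k f"
proof (induction k arbitrary: f)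
  case 0 then show ?case using Cn_continuous by fastforce
next
  case (Suc k)
  then obtain f' where "\<forall>x. (f has_real_derivative f' x) (at x)" "Cn (Suc k) f'" by auto
  with Suc.IH show ?case by (auto intro: Cn_SucI)
qed

lemma Cn_const: "Cn k (\<lambda>x. c)"
proof (induction k arbitrary: c)
  case (Suc k) then show ?case by (intro Cn_SucI[where f' = "\<lambda>x. 0"]) auto
qed auto

lemma Cn_add: "Cn k f \<Longrightarrow> Cn k g \<Longrightarrow> Cn k (\<lambda>x. f x + g x)"
proof (induction k arbitrary: f g)
  case 0 then show ?case by (auto intro: continuous_on_add)
next
  case (Suc k)
  then obtain f' g' where "\<And>x. (f has_real_derivative f' x) (at x)" "Cn k f'"
     "\<And>x. (g has_real_derivative g' x) (at x)" "Cn k g'" by auto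
  with Suc.IH show ?case
    by (intro Cn_SucI[where f' = "\<lambda>x. f' x + g' x"]) (auto intro: DERIV_add)
qed

lemma Cn_mult: "Cn k f \<Longrightarrow> Cn k g \<Longrightarrow> Cn k (\<lambda>x. f x * g x)"
proof (induction k arbitrary: f g)
  case 0 then show ?case by (auto intro: continuous_on_mult)
next
  case (Suc k)
  have fg: "Cn k f" "Cn k g" using Suc.prems Cn_Suc_D by blast+
  obtain f' g' where *: "\<And>x. (f has_real_derivative f' x) (at x)" "Cn k f'"
     "\<And>x. (g has_real_derivative g' x) (at x)" "Cn k g'" using Suc.prems by auto
  have "Cn k (\<lambda>x. f' x * g x + g' x * f x)"
    by (intro Cn_add Suc.IH * fg)
  then show ?case using *
    by (intro Cn_SucI[where f' = "\<lambda>x. f' x * g x + g' x * f x"]) (auto intro: DERIV_mult)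
qed

lemma Cn_affine: "Cn k f \<Longrightarrow> Cn k (\<lambda>x. f (a * x + b))"
proof (induction k arbitrary: f)
  case 0 then show ?case
    by (auto intro!: continuous_intros intro: continuous_on_compose2[of UNIV f])
next
  case (Suc k)
  then obtain f' where *: "\<And>x. (f has_real_derivative f' x) (at x)" "Cn k f'" by auto
  have "((\<lambda>x. f (a * x + b)) has_real_derivative a * f' (a * x + b)) (at x)" for x
    by (rule DERIV_cong[OF DERIV_chain'[OF _ *(1)]]) (auto intro!: derivative_eq_intros)
  then show ?case
    by (rule Cn_SucI) (intro Cn_mult Cn_const Suc.IH *)
qed

definition smooth :: "(real \<Rightarrow> real) \<Rightarrow> bool" where
  "smooth f \<longleftrightarrow> (\<forall>k. Cn k f)"

lemma smooth_continuous: "smooth f \<Longrightarrow> continuous_on UNIV f"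
  by (auto simp: smooth_def intro: Cn_continuous)

lemma smooth_deriv:
  assumes "smooth f" and d: "\<And>x. (f has_real_derivative f' x) (at x)"
  shows "smooth f'"
  unfolding smooth_def
proof
  fix k
  have "Cn (Suc k) f" using assms by (simp add: smooth_def)
  then obtain g where g: "\<And>x. (f has_real_derivative g x) (at x)" "Cn k g" by auto
  have "f' = g" using DERIV_unique[OF d g(1)] by blast
  with g show "Cn k f'" by simp
qed

lemma smooth_obtain_deriv:
  assumes "smooth f"
  obtains f' where "\<And>x. (f has_real_derivative f' x) (at x)" "smooth f'"
proof -
  have "Cn (Suc 0) f" using assms unfolding smooth_def by blast
  then obtain f' where "\<And>x. (f has_real_derivative f' x) (at x)" by auto
  with that smooth_deriv[OF assms] show ?thesis by blast
qed

lemma smooth_antideriv: "smooth f' \<Longrightarrow> (\<And>x. (f has_real_derivative f' x) (at x)) \<Longrightarrow> smooth f"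
  unfolding smooth_def
proof
  fix k assume "\<forall>k. Cn k f'" "\<And>x. (f has_real_derivative f' x) (at x)"
  then have "Cn (Suc k) f" by (auto)
  then show "Cn k f" by (rule Cn_Suc_D)
qed

lemma smooth_const: "smooth (\<lambda>x. c)"
  and smooth_add: "smooth f \<Longrightarrow> smooth g \<Longrightarrow> smooth (\<lambda>x. f x + g x)"
  and smooth_mult: "smooth f \<Longrightarrow> smooth g \<Longrightarrow> smooth (\<lambda>x. f x * g x)"
  and smooth_affine: "smooth f \<Longrightarrow> smooth (\<lambda>x. f (a * x + b))"
  by (auto simp: smooth_def Cn_const Cn_add Cn_mult Cn_affine)

lemma smooth_cmult: "smooth f \<Longrightarrow> smooth (\<lambda>x. c * f x)"
  by (intro smooth_mult smooth_const)

lemma smooth_diff: "smooth f \<Longrightarrow> smooth g \<Longrightarrow> smooth (\<lambda>x. f x - g x)"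
  using smooth_add[of f "\<lambda>x. (-1) * g x"] smooth_cmult[of g "-1"] by simp

lemma smooth_scale: "smooth f \<Longrightarrow> smooth (\<lambda>x. f ((x - a) / e))"
  using smooth_affine[of f "1/e" "- a/e"] by (simp add: diff_divide_distrib)

text \<open>The classical function exp(-1/x), flat at 0, times a polynomial in 1/x. With the
  polynomial as a parameter the family is closed under differentiation, so smoothness is an
  induction over the order with \<open>p\<close> arbitrary.\<close>

definition flat :: "real poly \<Rightarrow> real \<Rightarrow> real" where
  "flat p x = (if 0 < x then poly p (1 / x) * exp (- (1 / x)) else 0)"

lemma poly_exp_tendsto_0: "((\<lambda>t. poly p t * exp (- t)) \<longlongrightarrow> (0::real)) at_top"
proof -
  have "((\<lambda>t. \<Sum>i\<le>degree p. coeff p i * (t ^ i / exp t)) \<longlongrightarrow> (\<Sum>i\<le>degree p. coeff p i * 0)) at_top"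
    by (intro tendsto_intros tendsto_power_div_exp_0)
  moreover have "(\<lambda>t. \<Sum>i\<le>degree p. coeff p i * (t ^ i / exp t)) = (\<lambda>t. poly p t * exp (- t))"
    by (simp add: poly_altdef sum_distrib_right exp_minus divide_inverse mult.assoc)
  ultimately show ?thesis by simp
qed

lemma flat_DERIV: "(flat p has_real_derivative flat ((p - pderiv p) * [:0, 0, 1:]) x) (at x)"
proof -
  consider "x < 0" | "x > 0" | "x = 0" by linarith
  then show ?thesis
  proof cases
    case 1
    have "((\<lambda>x. 0) has_real_derivative 0) (at x)" by simp
    moreover have "\<forall>\<^sub>F y in nhds x. 0 = flat p y"
      using eventually_nhds_in_open[of "{..<0}" x] 1
      by (auto simp: flat_def elim!: eventually_mono)
    ultimately show ?thesis using 1 DERIV_cong_ev[of x x "\<lambda>x. 0" "flat p" 0 0] by (simp add: flat_def)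
  next
    case 2
    have "((\<lambda>x. poly p (1 / x) * exp (- (1 / x))) has_real_derivative
        flat ((p - pderiv p) * [:0, 0, 1:]) x) (at x)"
      using 2 by (auto intro!: derivative_eq_intros DERIV_chain'[OF _ poly_DERIV] simp: flat_def)
        (simp add: field_simps power2_eq_square)
    moreover have "\<forall>\<^sub>F y in nhds x. poly p (1 / y) * exp (- (1 / y)) = flat p y"
      using eventually_nhds_in_open[of "{0<..}" x] 2
      by (auto simp: flat_def elim!: eventually_mono)
    ultimately show ?thesis by (subst (asm) DERIV_cong_ev[OF refl _ refl])
  next
    case 3
    have "((\<lambda>h. flat p h / h) \<longlongrightarrow> 0) (at_right 0)"
    proof -
      \<comment> \<open>With t = 1/h, dividing by h is multiplying the polynomial by t, that is
        \<open>pCons 0\<close>; the exponential still wins.\<close>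
      have "((\<lambda>h. poly (pCons 0 p) (inverse h) * exp (- (inverse h))) \<longlongrightarrow> 0) (at_right 0)"
        by (rule filterlim_compose[OF poly_exp_tendsto_0 filterlim_inverse_at_top_right])
      then show ?thesis
        by (rule Lim_transform_eventually)
          (auto simp: flat_def eventually_at_filter field_simps)
    qed
    moreover have "((\<lambda>h. flat p h / h) \<longlongrightarrow> 0) (at_left 0)"
      by (rule tendsto_eventually) (auto simp: flat_def eventually_at_filter)
    ultimately have "((\<lambda>h. flat p h / h) \<longlongrightarrow> 0) (at 0)"
      by (simp add: filterlim_split_at)
    then show ?thesis using 3 by (simp add: DERIV_def flat_def)
  qed
qed

lemma flat_smooth: "smooth (flat p)"
proof -
  have "Cn k (flat p)" for k
  proof (induction k arbitrary: p)
    case 0 then show ?case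
      by (auto intro!: continuous_at_imp_continuous_on intro: DERIV_isCont flat_DERIV)
  next
    case (Suc k) then show ?case by (blast intro: Cn_SucI flat_DERIV)
  qed
  then show ?thesis by (simp add: smooth_def)
qed

section \<open>Bump functions and their primitives\<close>

lemma antiderivative_UNIV:
  fixes f :: "real \<Rightarrow> real"
  assumes "continuous_on UNIV f"
  obtains F where "\<And>x. (F has_real_derivative f x) (at x)" "F 0 = 0"
proof -
  obtain F where F: "\<And>x::real. (F has_vector_derivative f x) (at x)"
    using einterval_antiderivative[of "-\<infinity>" \<infinity> f] assms by (auto simp: continuous_on_eq_continuous_at)
  then have "((\<lambda>x. F x - F 0) has_real_derivative f x) (at x)" for x
    using F[of x] by (auto simp: has_real_derivative_iff_has_vector_derivative intro!: derivative_eq_intros)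
  with that show ?thesis by (metis diff_self)
qed

lemma DERIV_zero_const:
  fixes f :: "real \<Rightarrow> real"
  assumes "\<And>x. a \<le> x \<Longrightarrow> x \<le> b \<Longrightarrow> (f has_real_derivative 0) (at x)" "a \<le> b"
  shows "f a = f b"
proof (cases "a = b")
  case False
  with assms(2) have "a < b" by simp
  moreover have "continuous_on {a..b} f"
    using assms(1) by (intro continuous_at_imp_continuous_on) (metis DERIV_isCont atLeastAtMost_iff)
  ultimately show ?thesis using DERIV_isconst_end[of a b f] assms(1) by simp
qed simp

text \<open>After rescaling, \<open>S\<close> and \<open>R\<close> approximate the Heaviside function and the positive part.\<close>

definition mollifier :: "(real \<Rightarrow> real) \<times> (real \<Rightarrow> real) \<times> (real \<Rightarrow> real) \<Rightarrow> bool" where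
  "mollifier = (\<lambda>(r, S, R). smooth r \<and> (\<forall>x. 0 \<le> r x) \<and> (\<forall>x. x \<notin> {0..1} \<longrightarrow> r x = 0) \<and>
    (\<forall>x. (S has_real_derivative r x) (at x)) \<and> (\<forall>x\<le>0. S x = 0) \<and> (\<forall>x\<ge>1. S x = 1) \<and>
    (\<forall>x. (R has_real_derivative S x) (at x)) \<and> (\<forall>x\<le>0. R x = 0) \<and> (\<forall>x\<ge>1. R x = R 1 + (x - 1)))"

text \<open>The product of two flat functions is a bump on the unit interval. Dividing by its total
  mass makes the first primitive end at 1; the second primitive is then affine of slope 1 beyond
  1.\<close>

lemma mollifier_exists: "\<exists>t. mollifier t"
proof -
  define r0 where "r0 x = flat 1 x * flat 1 (1 - x)" for x
  have sm0: "smooth r0"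
    unfolding r0_def using smooth_mult[OF flat_smooth smooth_affine[OF flat_smooth, of 1 "-1" 1]] by simp
  have nn0: "0 \<le> r0 x" and z0: "x \<notin> {0<..<1} \<Longrightarrow> r0 x = 0" and pos0: "x \<in> {0<..<1} \<Longrightarrow> r0 x > 0" for x
    by (auto simp: r0_def flat_def)
  obtain S0 where S0: "\<And>x. (S0 has_real_derivative r0 x) (at x)" "S0 0 = 0"
    using antiderivative_UNIV smooth_continuous sm0 by blast
  have S0l: "S0 x = 0" if "x \<le> 0" for x
  proof -
    have "(S0 has_real_derivative 0) (at y)" if "y \<le> 0" for y using S0(1)[of y] z0[of y] that by auto
    then show ?thesis using DERIV_zero_const[of x 0 S0] that S0(2) by auto
  qed
  have S0r: "S0 x = S0 1" if "x \<ge> 1" for x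
  proof -
    have "(S0 has_real_derivative 0) (at y)" if "y \<ge> 1" for y using S0(1)[of y] z0[of y] that by auto
    then show ?thesis using DERIV_zero_const[of 1 x S0] that by auto
  qed
  \<comment> \<open>The mean value theorem shows that the mass is positive: the increment of
    \<open>S0\<close> is a value of the bump at an interior point.\<close>
  have "\<exists>z. 0 < z \<and> z < 1 \<and> S0 1 - S0 0 = (1 - 0) * r0 z"
    by (rule MVT2) (auto intro: S0)
  then obtain z where "0 < z" "z < 1" "S0 1 - S0 0 = r0 z" by auto
  then have c: "S0 1 > 0" using S0 pos0 by auto
  define r where "r x = (1 / S0 1) * r0 x" for x
  define S where "S x = (1 / S0 1) * S0 x" for x
  have smr: "smooth r" unfolding r_def by (intro smooth_cmult sm0)
  have S: "(S has_real_derivative r x) (at x)" for x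
    unfolding S_def r_def by (intro DERIV_cmult S0)
  have smS: "smooth S" using smooth_antideriv smr S by blast
  obtain R where R: "\<And>x. (R has_real_derivative S x) (at x)" "R 0 = 0"
    using antiderivative_UNIV smooth_continuous smS by blast
  have Sl: "S x = 0" if "x \<le> 0" for x using S0l that by (simp add: S_def)
  have Sr: "S x = 1" if "x \<ge> 1" for x using S0r[OF that] c by (simp add: S_def)
  have Rl: "R x = 0" if "x \<le> 0" for x
  proof -
    have "(R has_real_derivative 0) (at y)" if "y \<le> 0" for y using R(1)[of y] Sl[of y] that by auto
    then show ?thesis using DERIV_zero_const[of x 0 R] that R(2) by auto
  qed
  have Rr: "R x = R 1 + (x - 1)" if "x \<ge> 1" for x
  proof -
    have "((\<lambda>y. R y - y) has_real_derivative 0) (at y)" if "1 \<le> y" for y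
      using that by (auto intro!: derivative_eq_intros R simp: Sr)
    from DERIV_zero_const[of 1 x, OF this that] show ?thesis by simp
  qed
  show ?thesis
  unfolding mollifier_def
  proof (intro exI[of _ "(r, S, R)"], unfold prod.case, intro conjI allI impI)
    show "0 \<le> r x" for x using nn0 c by (simp add: r_def)
    show "r x = 0" if "x \<notin> {0..1}" for x using z0[of x] that by (auto simp: r_def)
  qed (use smr S Sl Sr R Rl Rr in blast)+
qed

definition "moll = fst (SOME t. mollifier t)"
definition "step = fst (snd (SOME t. mollifier t))"
definition "ramp = snd (snd (SOME t. mollifier t))"

lemma
  shows smooth_moll: "smooth moll" and moll_nonneg: "0 \<le> moll x"
    and moll_zero: "x \<notin> {0..1} \<Longrightarrow> moll x = 0"
    and step_DERIV: "(step has_real_derivative moll x) (at x)"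
    and step_left: "x \<le> 0 \<Longrightarrow> step x = 0" and step_right: "x \<ge> 1 \<Longrightarrow> step x = 1"
    and ramp_DERIV: "(ramp has_real_derivative step x) (at x)"
    and ramp_left: "x \<le> 0 \<Longrightarrow> ramp x = 0" and ramp_right: "x \<ge> 1 \<Longrightarrow> ramp x = ramp 1 + (x - 1)"
proof -
  have "mollifier (moll, step, ramp)"
    using someI_ex[OF mollifier_exists] by (simp add: moll_def step_def ramp_def)
  then show "smooth moll" "0 \<le> moll x" "x \<notin> {0..1} \<Longrightarrow> moll x = 0"
    "(step has_real_derivative moll x) (at x)"
    "x \<le> 0 \<Longrightarrow> step x = 0" "x \<ge> 1 \<Longrightarrow> step x = 1"
    "(ramp has_real_derivative step x) (at x)"
    "x \<le> 0 \<Longrightarrow> ramp x = 0" "x \<ge> 1 \<Longrightarrow> ramp x = ramp 1 + (x - 1)"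
    unfolding mollifier_def by blast+
qed

lemma smooth_step: "smooth step" and smooth_ramp: "smooth ramp"
  using smooth_antideriv smooth_moll step_DERIV ramp_DERIV by blast+

lemma step_bounds: "0 \<le> step x" "step x \<le> 1"
proof -
  have mono: "step a \<le> step b" if "a \<le> b" for a b
    by (rule DERIV_nonneg_imp_nondecreasing[OF that]) (use step_DERIV moll_nonneg in blast)
  show "0 \<le> step x" using mono[of 0 x] step_left[of 0] step_left[of x] by (cases "x \<le> 0") auto
  show "step x \<le> 1" using mono[of x 1] step_right[of 1] step_right[of x] by (cases "x \<le> 1") auto
qed

text \<open>Since the slope \<open>step\<close> stays between 0 and 1, \<open>ramp\<close> lies
  between 0 and x on the positive axis. Beyond 1 the deviation from x is the constant
  \<open>ramp 1 - 1\<close>.\<close>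

lemma ramp_approx: "\<bar>ramp x - max 0 x\<bar> \<le> 1"
proof -
  have a: "0 \<le> ramp x \<and> ramp x \<le> x" if "x \<ge> 0" for x
  proof
    have "ramp 0 \<le> ramp x"
      by (rule DERIV_nonneg_imp_nondecreasing[OF that]) (use ramp_DERIV step_bounds in blast)
    then show "0 \<le> ramp x" by (simp add: ramp_left)
    have "((\<lambda>y. y - ramp y) has_real_derivative 1 - step y) (at y)" for y
      by (auto intro!: derivative_eq_intros ramp_DERIV)
    then have "0 - ramp 0 \<le> x - ramp x"
      by (intro DERIV_nonneg_imp_nondecreasing[OF that]) (metis step_bounds(2) diff_ge_0_iff_ge)
    then show "ramp x \<le> x" by (simp add: ramp_left)
  qed
  consider "x \<le> 0" | "0 \<le> x" "x \<le> 1" | "x \<ge> 1" by linarith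
  then show ?thesis
  proof cases
    case 1 then show ?thesis using ramp_left by auto
  next
    case 2 then show ?thesis using a[of x] by auto
  next
    case 3 then show ?thesis using a[of 1] ramp_right[of x] by auto
  qed
qed

text \<open>One-dimensional test functions on the open interval. The explicit compact interval
  \<open>{c..d}\<close> makes the support of a product lie in a compact rectangle.\<close>

definition tests :: "real \<Rightarrow> real \<Rightarrow> (real \<Rightarrow> real) set" where
  "tests a b = {f. smooth f \<and> (\<exists>c d. a < c \<and> d < b \<and> (\<forall>x. x \<notin> {c..d} \<longrightarrow> f x = 0))}"

lemma testsI: "smooth f \<Longrightarrow> a < c \<Longrightarrow> d < b \<Longrightarrow> (\<And>x. x \<notin> {c..d} \<Longrightarrow> f x = 0) \<Longrightarrow> f \<in> tests a b"
  by (auto simp: tests_def)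

lemma tests_smooth: "f \<in> tests a b \<Longrightarrow> smooth f"
  by (simp add: tests_def)

lemma tests_zero: "f \<in> tests a b \<Longrightarrow> x \<notin> {a<..<b} \<Longrightarrow> f x = 0"
  by (force simp: tests_def)

lemma tests_continuous: "f \<in> tests a b \<Longrightarrow> continuous_on S f"
  using smooth_continuous tests_smooth continuous_on_subset by blast

lemma tests_borel: "f \<in> tests a b \<Longrightarrow> f \<in> borel_measurable borel"
  by (intro borel_measurable_continuous_onI tests_continuous)

lemma tests_bounded:
  assumes "f \<in> tests a b" obtains C where "\<And>x. \<bar>f x\<bar> \<le> C" "C > 0"
proof -
  obtain C where C: "\<And>x. x \<in> {a..b} \<Longrightarrow> \<bar>f x\<bar> \<le> C"
    using compact_imp_bounded[OF compact_continuous_image[OF tests_continuous[OF assms] compact_Icc[of a b]]]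
    unfolding bounded_iff by (metis imageI real_norm_def)
  have "\<bar>f x\<bar> \<le> \<bar>C\<bar> + 1" for x
    using C[of x] tests_zero[OF assms, of x] by (cases "x \<in> {a..b}") auto
  then show ?thesis by (intro that[of "\<bar>C\<bar> + 1"]) auto
qed

lemma DERIV_zero_outside:
  assumes "\<And>x. x \<notin> {c..d} \<Longrightarrow> f x = (0::real)" "\<And>x. (f has_real_derivative f' x) (at x)" "x \<notin> {c..d}"
  shows "f' x = 0"
proof -
  have "\<forall>\<^sub>F y in nhds x. f y = 0"
  proof (rule eventually_mono)
    show "\<forall>\<^sub>F y in nhds x. y \<in> - {c..d}"
      using assms(3) by (intro eventually_nhds_in_open) (auto intro: open_Compl)
  qed (use assms(1) in auto)
  then have "((\<lambda>_. 0) has_real_derivative f' x) (at x)"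
    using assms(2)[of x] DERIV_cong_ev[of x x f "\<lambda>_. 0" "f' x" "f' x"] by simp
  then show ?thesis using DERIV_unique DERIV_const by blast
qed

lemma tests_deriv:
  assumes "f \<in> tests a b" "\<And>x. (f has_real_derivative f' x) (at x)"
  shows "f' \<in> tests a b"
proof -
  obtain c d where cd: "a < c" "d < b" "\<And>x. x \<notin> {c..d} \<Longrightarrow> f x = 0"
    using assms(1) by (auto simp: tests_def)
  show ?thesis
    by (rule testsI[OF smooth_deriv[OF tests_smooth[OF assms(1)] assms(2)] cd(1,2)])
      (rule DERIV_zero_outside[OF cd(3) assms(2)])
qed

lemma tests_obtain_deriv:
  assumes "f \<in> tests a b"
  obtains f' where "\<And>x. (f has_real_derivative f' x) (at x)" "f' \<in> tests a b"
  using smooth_obtain_deriv[OF tests_smooth[OF assms]] tests_deriv[OF assms] by metis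

subsection \<open>Tensor products of test functions\<close>

text \<open>Products are the only test functions from which information on u is extracted: their
  partial derivatives are again products, and by \<open>tens_zero_imp_AE_zero\<close> they separate
  integrable functions on the rectangle.\<close>

definition tens :: "(real \<Rightarrow> real) \<Rightarrow> (real \<Rightarrow> real) \<Rightarrow> real \<times> real \<Rightarrow> real" where
  "tens f g z = f (fst z) * g (snd z)"

lemma Basis_real_prod: "(Basis :: (real \<times> real) set) = {(1, 0), (0, 1)}"
  by (auto simp: Basis_prod_def)

lemma tens_has_derivative:
  assumes f: "\<And>x. (f has_real_derivative f' x) (at x)" and g: "\<And>x. (g has_real_derivative g' x) (at x)"
  shows "(tens f g has_derivative (\<lambda>h. tens f' g z * fst h + tens f g' z * snd h)) (at z)"
proof -
  have 1: "((\<lambda>z. f (fst z)) has_derivative (\<lambda>h. f' (fst z) * fst h)) (at z)"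
    by (rule has_derivative_compose[OF has_derivative_fst[OF has_derivative_ident] f[unfolded has_field_derivative_def]])
  have 2: "((\<lambda>z. g (snd z)) has_derivative (\<lambda>h. g' (snd z) * snd h)) (at z)"
    by (rule has_derivative_compose[OF has_derivative_snd[OF has_derivative_ident] g[unfolded has_field_derivative_def]])
  show ?thesis
    unfolding tens_def by (rule has_derivative_eq_rhs[OF has_derivative_mult[OF 1 2]]) (auto simp: algebra_simps)
qed

lemma frechet_tens:
  assumes f: "\<And>x. (f has_real_derivative f' x) (at x)" and g: "\<And>x. (g has_real_derivative g' x) (at x)"
  shows frechet_tens_x: "(\<lambda>z. frechet_derivative (tens f g) (at z) (1, 0)) = tens f' g"
    and frechet_tens_y: "(\<lambda>z. frechet_derivative (tens f g) (at z) (0, 1)) = tens f g'"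
  using frechet_derivative_at[OF tens_has_derivative[OF assms], symmetric] by auto

lemma continuous_on_tens:
  assumes "continuous_on UNIV f" "continuous_on UNIV g"
  shows "continuous_on S (tens f g)"
  unfolding tens_def
  by (intro continuous_on_mult continuous_on_compose2[OF assms(1) _ subset_UNIV]
      continuous_on_compose2[OF assms(2) _ subset_UNIV] continuous_on_fst continuous_on_snd continuous_on_id)

lemma tens_Ck: "smooth f \<Longrightarrow> smooth g \<Longrightarrow> Ck k (tens f g)"
proof (induction k arbitrary: f g)
  case 0
  have "continuous_on UNIV f" "continuous_on UNIV g" using 0 smooth_continuous by auto
  then show ?case by (simp add: continuous_on_tens)
next
  case (Suc k)
  obtain f' where f': "\<And>x. (f has_real_derivative f' x) (at x)" "smooth f'"
    using Suc.prems smooth_obtain_deriv by blast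
  obtain g' where g': "\<And>x. (g has_real_derivative g' x) (at x)" "smooth g'"
    using Suc.prems smooth_obtain_deriv by blast
  show ?case
    unfolding Ck.simps Basis_real_prod
    using tens_has_derivative[OF f'(1) g'(1)] Suc f'(2) g'(2)
    by (auto simp: frechet_tens[OF f'(1) g'(1)] differentiable_on_def differentiable_def)
qed

lemma tens_test:
  assumes "f \<in> tests 0 pi" "g \<in> tests (-l) l"
  shows "tens f g \<in> test_functions (Omega l)"
proof -
  obtain c d where cd: "0 < c" "d < pi" "\<And>x. x \<notin> {c..d} \<Longrightarrow> f x = 0"
    using assms(1) by (auto simp: tests_def)
  obtain c' d' where cd': "-l < c'" "d' < l" "\<And>x. x \<notin> {c'..d'} \<Longrightarrow> g x = 0"
    using assms(2) by (auto simp: tests_def)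
  have "{z. tens f g z \<noteq> 0} \<subseteq> {c..d} \<times> {c'..d'}"
    using cd(3) cd'(3) by (fastforce simp: tens_def)
  then have sub: "closure {z. tens f g z \<noteq> 0} \<subseteq> {c..d} \<times> {c'..d'}"
    by (intro closure_minimal closed_Times) auto
  moreover have "{c..d} \<times> {c'..d'} \<subseteq> Omega l" using cd cd' by (auto simp: Omega_def)
  moreover have "compact (closure {z. tens f g z \<noteq> 0})"
    using bounded_subset[OF compact_imp_bounded[OF compact_Times[OF compact_Icc compact_Icc]] sub]
    by (simp add: compact_eq_bounded_closed)
  ultimately show ?thesis
    using tens_Ck tests_smooth assms by (auto simp: test_functions_def)
qed

context
  fixes f f' f'' g g' g'' :: "real \<Rightarrow> real"
  assumes f: "\<And>x. (f has_real_derivative f' x) (at x)" "\<And>x. (f' has_real_derivative f'' x) (at x)"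
    and g: "\<And>x. (g has_real_derivative g' x) (at x)" "\<And>x. (g' has_real_derivative g'' x) (at x)"
begin

lemma
  shows pderivs_tens_x: "pderivs [(1, 0)] (tens f g) = tens f' g"
    and pderivs_tens_y: "pderivs [(0, 1)] (tens f g) = tens f g'"
    and pderivs_tens_xx: "pderivs [(1, 0), (1, 0)] (tens f g) = tens f'' g"
    and pderivs_tens_xy: "pderivs [(1, 0), (0, 1)] (tens f g) = tens f' g'"
    and pderivs_tens_yx: "pderivs [(0, 1), (1, 0)] (tens f g) = tens f' g'"
  unfolding pderivs_def foldr.simps o_apply id_apply frechet_tens[OF f(1) g(1)]
    frechet_tens[OF f(2) g(1)] frechet_tens[OF f(1) g(2)] by (rule refl)+

end

subsection \<open>Approximate identities on an interval\<close>

text \<open>The 4 leaves room: the bump of width \<open>eps\<close> started anywhere between a + eps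
  and b - 2 eps stays in [a + eps, b - eps], and the extreme centres for x = a and x = b remain
  distinct, as \<open>tent_tests\<close> requires.\<close>

definition eps :: "real \<Rightarrow> real \<Rightarrow> nat \<Rightarrow> real" where
  "eps a b n = (b - a) / (4 * real (Suc n))"

text \<open>Clipping the centre keeps the approximations compactly supported in the open interval, even when
  \<open>x\<close> is an endpoint.\<close>

definition clip :: "real \<Rightarrow> real \<Rightarrow> real \<Rightarrow> nat \<Rightarrow> real" where
  "clip a b x n = max (a + eps a b n) (min x (b - 2 * eps a b n))"

text \<open>\<open>dlt\<close>, \<open>stp\<close> and \<open>rmp\<close> approximate the Dirac mass
  at x, the Heaviside jump and the positive part of s - x; each is the derivative of the next, which
  fixes the powers of \<open>eps\<close>.\<close>

definition dlt :: "real \<Rightarrow> real \<Rightarrow> real \<Rightarrow> nat \<Rightarrow> real \<Rightarrow> real" where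
  "dlt a b x n s = moll ((s - clip a b x n) / eps a b n) / eps a b n"

definition stp :: "real \<Rightarrow> real \<Rightarrow> real \<Rightarrow> nat \<Rightarrow> real \<Rightarrow> real" where
  "stp a b x n s = step ((s - clip a b x n) / eps a b n)"

definition rmp :: "real \<Rightarrow> real \<Rightarrow> real \<Rightarrow> nat \<Rightarrow> real \<Rightarrow> real" where
  "rmp a b x n s = eps a b n * ramp ((s - clip a b x n) / eps a b n)"

context
  fixes a b :: real
  assumes ab: "a < b"
begin

lemma eps_pos: "0 < eps a b n"
  using ab by (simp add: eps_def)

lemma eps_le: "4 * eps a b n \<le> b - a"
proof -
  have "4 * eps a b n = (b - a) / real (Suc n)" by (simp add: eps_def field_simps)
  also have "\<dots> \<le> (b - a) / 1" using ab by (intro divide_left_mono) auto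
  finally show ?thesis by simp
qed

lemma eps_tendsto: "eps a b \<longlonglongrightarrow> 0"
proof -
  have "(\<lambda>n. (b - a) / 4 * inverse (real (Suc n))) \<longlonglongrightarrow> (b - a) / 4 * 0"
    by (intro tendsto_intros LIMSEQ_inverse_real_of_nat)
  then show ?thesis by (simp add: eps_def[abs_def] field_simps)
qed

lemma clip_bounds: "a + eps a b n \<le> clip a b x n" "clip a b x n \<le> b - 2 * eps a b n"
  using eps_le[of n] eps_pos[of n] by (auto simp: clip_def)

lemma clip_tendsto: assumes "x \<in> {a..b}" shows "clip a b x \<longlonglongrightarrow> x"
proof -
  have "(\<lambda>n. max (a + eps a b n) (min x (b - 2 * eps a b n))) \<longlonglongrightarrow> max (a + 0) (min x (b - 2 * 0))"
    by (intro tendsto_intros eps_tendsto)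
  then show ?thesis using assms by (simp add: clip_def[abs_def])
qed

lemma clip_left: "clip a b a n = a + eps a b n" and clip_right: "clip a b b n = b - 2 * eps a b n"
  using eps_le[of n] eps_pos[of n] by (auto simp: clip_def)

lemma scale_DERIV:
  assumes "\<And>x. (f has_real_derivative f' x) (at x)"
  shows "((\<lambda>s. f ((s - c) / e)) has_real_derivative f' ((s - c) / e) / e) (at s)"
proof (cases "e = 0")
  case False
  show ?thesis
    by (rule DERIV_cong[OF DERIV_chain'[OF _ assms]]) (use False in \<open>auto intro!: derivative_eq_intros\<close>)
qed auto

lemma stp_DERIV: "(stp a b x n has_real_derivative dlt a b x n s) (at s)"
  unfolding stp_def[abs_def] dlt_def by (rule scale_DERIV[OF step_DERIV])

lemma rmp_DERIV: "(rmp a b x n has_real_derivative stp a b x n s) (at s)"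
  unfolding rmp_def[abs_def] stp_def
  by (rule DERIV_cong[OF DERIV_cmult[OF scale_DERIV[OF ramp_DERIV]]]) (use eps_pos[of n] in simp)

lemma smooth_stp: "smooth (stp a b x n)"
  unfolding stp_def[abs_def] by (intro smooth_scale smooth_step)

lemma smooth_rmp: "smooth (rmp a b x n)"
  unfolding rmp_def[abs_def] by (intro smooth_cmult smooth_scale smooth_ramp)

lemma smooth_dlt: "smooth (dlt a b x n)"
  using smooth_deriv[OF smooth_stp stp_DERIV] .

lemma dlt_nonneg: "0 \<le> dlt a b x n s"
  using eps_pos[of n] moll_nonneg by (simp add: dlt_def)

lemma dlt_zero: "s \<notin> {clip a b x n..clip a b x n + eps a b n} \<Longrightarrow> dlt a b x n s = 0"
  using eps_pos[of n] by (auto simp: dlt_def field_simps intro!: moll_zero)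

lemma dlt_zero': "s \<notin> {a + eps a b n..b - eps a b n} \<Longrightarrow> dlt a b x n s = 0"
  using clip_bounds[where n = n and x = x] by (intro dlt_zero) auto

lemma stp_bounds: "0 \<le> stp a b x n s" "stp a b x n s \<le> 1"
  by (auto simp: stp_def step_bounds)

lemma stp_left: "s \<le> clip a b x n \<Longrightarrow> stp a b x n s = 0"
  using eps_pos[of n] by (auto simp: stp_def field_simps intro!: step_left)

lemma stp_right: "clip a b x n + eps a b n \<le> s \<Longrightarrow> stp a b x n s = 1"
  using eps_pos[of n] by (auto simp: stp_def field_simps intro!: step_right)

lemma rmp_left: "s \<le> clip a b x n \<Longrightarrow> rmp a b x n s = 0"
  using eps_pos[of n] by (auto simp: rmp_def field_simps intro!: ramp_left)

lemma rmp_right: "clip a b x n + eps a b n \<le> s \<Longrightarrow>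
  rmp a b x n s = eps a b n * (ramp 1 - 1) + (s - clip a b x n)"
  unfolding rmp_def using eps_pos[of n]
  by (subst ramp_right) (auto simp: field_simps)

lemma rmp_approx: "\<bar>rmp a b x n s - max 0 (s - clip a b x n)\<bar> \<le> eps a b n"
proof -
  have *: "max 0 (s - clip a b x n) = eps a b n * max 0 ((s - clip a b x n) / eps a b n)"
    using eps_pos[of n] by (auto simp: max_def field_simps)
  have "\<bar>rmp a b x n s - max 0 (s - clip a b x n)\<bar> =
      eps a b n * \<bar>ramp ((s - clip a b x n) / eps a b n) - max 0 ((s - clip a b x n) / eps a b n)\<bar>"
    unfolding * rmp_def using eps_pos[of n] by (simp add: abs_mult flip: right_diff_distrib)
  also have "\<dots> \<le> eps a b n * 1"
    using eps_pos[of n] by (intro mult_left_mono ramp_approx) auto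
  finally show ?thesis by simp
qed

lemma rmp_tendsto:
  assumes "x \<in> {a..b}" shows "(\<lambda>n. rmp a b x n s) \<longlonglongrightarrow> max 0 (s - x)"
proof -
  have "(\<lambda>n. rmp a b x n s - max 0 (s - clip a b x n)) \<longlonglongrightarrow> 0"
    by (rule tendsto_rabs_zero_cancel, rule tendsto_sandwich[OF _ _ tendsto_const eps_tendsto])
      (auto intro!: always_eventually rmp_approx)
  moreover have "(\<lambda>n. max 0 (s - clip a b x n)) \<longlonglongrightarrow> max 0 (s - x)"
    by (intro tendsto_intros clip_tendsto assms)
  ultimately show ?thesis by (auto dest: tendsto_add)
qed

text \<open>The point s must be interior because the clipped centre for x = a lies right of a and
  the one for x = b lies left of b; a fixed interior s is eventually on the correct side. The limit
  at s = x is 0.\<close>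

lemma stp_tendsto:
  assumes x: "x \<in> {a..b}" and s: "a < s" "s < b"
  shows "(\<lambda>n. stp a b x n s) \<longlonglongrightarrow> (if x < s then 1 else 0)"
proof (cases "x < s")
  case True
  have "(\<lambda>n. clip a b x n + eps a b n) \<longlonglongrightarrow> x + 0"
    by (intro tendsto_add clip_tendsto x eps_tendsto)
  then have "\<forall>\<^sub>F n in sequentially. clip a b x n + eps a b n < s"
    using True by (intro order_tendstoD) auto
  then show ?thesis using True
    by (intro tendsto_eventually) (auto elim!: eventually_mono intro!: stp_right)
next
  case False
  \<comment> \<open>For s at most x, only the upper clipping could move the centre to the left of s,
    and it eventually lies beyond s.\<close>
  have "(\<lambda>n. b - 2 * eps a b n) \<longlonglongrightarrow> b - 2 * 0"
    by (intro tendsto_intros eps_tendsto)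
  then have "\<forall>\<^sub>F n in sequentially. s < b - 2 * eps a b n"
    using s by (intro order_tendstoD) auto
  then show ?thesis using False
    by (intro tendsto_eventually) (auto elim!: eventually_mono intro!: stp_left simp: clip_def)
qed

text \<open>A single smoothed step is not compactly supported; in a difference the value 1 cancels
  to the right of both bumps.\<close>

lemma stp_diff_tests: "(\<lambda>s. stp a b x n s - stp a b y n s) \<in> tests a b"
proof (rule testsI[where c = "a + eps a b n" and d = "b - eps a b n"])
  fix s assume "s \<notin> {a + eps a b n..b - eps a b n}"
  then show "stp a b x n s - stp a b y n s = 0"
    using clip_bounds[where n = n and x = x] clip_bounds[where n = n and x = y]
    by (cases "s < a + eps a b n") (auto simp: stp_left stp_right)
qed (use eps_pos[of n] in \<open>auto intro: smooth_diff smooth_stp\<close>)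

lemma dlt_tests: "dlt a b x n \<in> tests a b"
  by (rule testsI[where c = "a + eps a b n" and d = "b - eps a b n"])
    (use eps_pos[of n] in \<open>auto intro: smooth_dlt dlt_zero'\<close>)

lemma dlt_integral:
  shows "integrable lborel (dlt a b x n)" "(LINT s|lborel. dlt a b x n s) = 1"
proof -
  have eq: "dlt a b x n = (\<lambda>s. dlt a b x n s * indicator {a..b} s)"
  proof
    fix s show "dlt a b x n s = dlt a b x n s * indicator {a..b} s"
      using dlt_zero'[of s n x] eps_pos[of n] by (cases "s \<in> {a..b}") auto
  qed
  have "set_integrable lborel {a..b} (dlt a b x n)"
    using smooth_continuous[OF smooth_dlt] continuous_on_subset by (intro borel_integrable_atLeastAtMost') blast
  then show "integrable lborel (dlt a b x n)"
    unfolding set_integrable_def by (subst eq) (simp add: mult.commute)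
  have "(LINT s|lborel. dlt a b x n s * indicator {a..b} s) = stp a b x n b - stp a b x n a"
    using ab stp_DERIV smooth_continuous[OF smooth_dlt]
    by (intro integral_FTC_Icc_real) (auto simp: continuous_on_eq_continuous_at)
  also have "\<dots> = 1"
    using clip_bounds[where n = n and x = x] eps_pos[of n] by (simp add: stp_left stp_right)
  finally show "(LINT s|lborel. dlt a b x n s) = 1" by (subst eq)
qed

lemma continuous_dlt_integrable:
  assumes "continuous_on {a..b} U"
  shows "integrable lborel (\<lambda>s. U s * dlt a b x n s)"
proof -
  have "continuous_on {a..b} (\<lambda>s. U s * dlt a b x n s)"
    using assms smooth_continuous[OF smooth_dlt] continuous_on_subset by (intro continuous_on_mult) blast+
  from borel_integrable_atLeastAtMost'[OF this]
  have "integrable lborel (\<lambda>s. indicator {a..b} s * (U s * dlt a b x n s))" by (simp add: set_integrable_def)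
  moreover have "(\<lambda>s. indicator {a..b} s * (U s * dlt a b x n s)) = (\<lambda>s. U s * dlt a b x n s)"
  proof
    fix s show "indicator {a..b} s * (U s * dlt a b x n s) = U s * dlt a b x n s"
      using dlt_zero'[of s n x] eps_pos[of n] by (cases "s \<in> {a..b}") auto
  qed
  ultimately show ?thesis by simp
qed

text \<open>Valid up to the endpoints, because the clipped bumps stay inside the interval while
  shrinking to x. This is how values of u on the edges are recovered from interior tests.\<close>

lemma dlt_limit:
  assumes U: "continuous_on {a..b} U" and x: "x \<in> {a..b}"
  shows "(\<lambda>n. LINT s|lborel. U s * dlt a b x n s) \<longlonglongrightarrow> U x"
proof (rule LIMSEQ_I)
  fix r :: real assume "r > 0"
  then obtain d where d: "d > 0" "\<And>s. s \<in> {a..b} \<Longrightarrow> \<bar>s - x\<bar> < d \<Longrightarrow> \<bar>U s - U x\<bar> < r / 2"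
    using U x unfolding continuous_on_iff dist_real_def by (meson half_gt_zero)
  have "(\<lambda>n. \<bar>clip a b x n - x\<bar> + eps a b n) \<longlonglongrightarrow> \<bar>x - x\<bar> + 0"
    by (intro tendsto_intros clip_tendsto x eps_tendsto)
  then have "\<forall>\<^sub>F n in sequentially. \<bar>clip a b x n - x\<bar> + eps a b n < d"
    using d(1) by (intro order_tendstoD) auto
  then obtain N where N: "\<And>n. n \<ge> N \<Longrightarrow> \<bar>clip a b x n - x\<bar> + eps a b n < d"
    by (auto simp: eventually_sequentially)
  have "norm ((LINT s|lborel. U s * dlt a b x n s) - U x) < r" if "n \<ge> N" for n
  proof -
    have "(LINT s|lborel. U s * dlt a b x n s) - U x =
       (LINT s|lborel. U s * dlt a b x n s) - (LINT s|lborel. U x * dlt a b x n s)"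
      using dlt_integral by simp
    also have "\<dots> = (LINT s|lborel. (U s - U x) * dlt a b x n s)"
      by (subst Bochner_Integration.integral_diff[symmetric])
        (auto intro!: continuous_dlt_integrable U dlt_integral simp: left_diff_distrib)
    finally have eq: "(LINT s|lborel. U s * dlt a b x n s) - U x = (LINT s|lborel. (U s - U x) * dlt a b x n s)" .
    have "norm (LINT s|lborel. (U s - U x) * dlt a b x n s) \<le> (LINT s|lborel. r / 2 * dlt a b x n s)"
    proof (rule Bochner_Integration.integral_norm_bound_integral)
      show "integrable lborel (\<lambda>s. (U s - U x) * dlt a b x n s)"
        by (intro continuous_dlt_integrable continuous_intros U)
      show "integrable lborel (\<lambda>s. r / 2 * dlt a b x n s)"
        using dlt_integral by simp
      fix s
      show "norm ((U s - U x) * dlt a b x n s) \<le> r / 2 * dlt a b x n s"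
      proof (cases "s \<in> {clip a b x n..clip a b x n + eps a b n}")
        case True
        then have "\<bar>s - x\<bar> < d" "s \<in> {a..b}" using N[OF that] clip_bounds[where n = n and x = x] eps_pos[of n] by auto
        then have "\<bar>U s - U x\<bar> \<le> r / 2" using d(2) by fastforce
        from mult_right_mono[OF this dlt_nonneg[of x n s]] show ?thesis
          by (simp add: abs_mult dlt_nonneg)
      qed (simp add: dlt_zero)
    qed
    also have "\<dots> = r / 2" using dlt_integral by simp
    finally show ?thesis using eq \<open>r > 0\<close> by simp
  qed
  then show "\<exists>no. \<forall>n\<ge>no. norm ((LINT s|lborel. U s * dlt a b x n s) - U x) < r" by blast
qed

text \<open>\<open>al\<close> and \<open>be\<close> are the barycentric coordinates of the clipped
  centre of x between those of a and b. Hence to the right of all bumps the three affine branches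
  cancel in slope and in constant term. The function is a smoothed tent with peak at x, an
  approximation of Green's function.\<close>

lemma tent_tests:
  fixes x n
  defines "cl \<equiv> \<lambda>y. clip a b y n"
  defines "al \<equiv> (cl b - cl x) / (cl b - cl a)" and "be \<equiv> (cl x - cl a) / (cl b - cl a)"
  shows "(\<lambda>s. al * rmp a b a n s - rmp a b x n s + be * rmp a b b n s) \<in> tests a b"
proof (rule testsI[where c = "a + eps a b n" and d = "b - eps a b n"])
  have p: "cl b - cl a > 0" using eps_pos[of n] eps_le[of n] ab
    by (auto simp: cl_def clip_left clip_right)
  have 1: "al + be = 1" using p by (simp add: al_def be_def flip: add_divide_distrib)
  have 2: "al * cl a + be * cl b = cl x"
  proof -
    have "al * cl a + be * cl b = ((cl b - cl x) * cl a + (cl x - cl a) * cl b) / (cl b - cl a)"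
      by (simp add: al_def be_def add_divide_distrib)
    also have "(cl b - cl x) * cl a + (cl x - cl a) * cl b = cl x * (cl b - cl a)"
      by (simp add: algebra_simps)
    finally show ?thesis using p by simp
  qed
  fix s assume s: "s \<notin> {a + eps a b n..b - eps a b n}"
  show "al * rmp a b a n s - rmp a b x n s + be * rmp a b b n s = 0"
  proof (cases "s < a + eps a b n")
    case True
    then have "s \<le> clip a b y n" for y using clip_bounds[where n = n and x = y] by linarith
    then show ?thesis by (simp add: rmp_left)
  next
    case False
    then have "clip a b y n + eps a b n \<le> s" for y using clip_bounds[where n = n and x = y] s by auto
    then have "rmp a b y n s = eps a b n * (ramp 1 - 1) + (s - cl y)" for y
      by (simp add: rmp_right cl_def)
    then have "al * rmp a b a n s - rmp a b x n s + be * rmp a b b n s =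
      (al + be) * (eps a b n * (ramp 1 - 1) + s) - (eps a b n * (ramp 1 - 1) + s)
       - (al * cl a + be * cl b) + cl x"
      by (simp only:) (simp add: algebra_simps)
    then show ?thesis using 1 2 by simp
  qed
qed (use eps_pos[of n] in \<open>auto intro!: smooth_add smooth_diff smooth_cmult smooth_rmp\<close>)

end

subsection \<open>Square integrable functions\<close>

definition L2 :: "'a measure \<Rightarrow> ('a \<Rightarrow> real) set" where
  "L2 M = {f \<in> borel_measurable M. integrable M (\<lambda>z. (f z)\<^sup>2)}"

lemma Lp_space_2: "Lp_space M 2 = L2 M"
proof -
  have "(2::ereal) \<noteq> \<infinity>" by simp
  moreover have "real_of_ereal 2 = 2" by simp
  ultimately show ?thesis by (simp add: Lp_space_def L2_def)
qed

lemma L2_measurable[measurable_dest]: "f \<in> L2 M \<Longrightarrow> f \<in> borel_measurable M"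
  and L2_square: "f \<in> L2 M \<Longrightarrow> integrable M (\<lambda>z. (f z)\<^sup>2)"
  by (auto simp: L2_def)

lemma L2_mult:
  assumes "f \<in> L2 M" "g \<in> L2 M" shows "integrable M (\<lambda>z. f z * g z)"
proof (rule Bochner_Integration.integrable_bound)
  show "integrable M (\<lambda>z. (f z)\<^sup>2 + (g z)\<^sup>2)" using assms by (auto simp: L2_def)
  show "(\<lambda>z. f z * g z) \<in> borel_measurable M" using assms by (auto simp: L2_def)
  have "\<bar>x * y\<bar> \<le> x\<^sup>2 + y\<^sup>2" for x y :: real
    using sum_squares_bound[of x y] sum_squares_bound[of x "- y"] zero_le_power2[of x] zero_le_power2[of y]
    by (simp add: abs_le_iff)
  then show "AE z in M. norm (f z * g z) \<le> norm ((f z)\<^sup>2 + (g z)\<^sup>2)" by auto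
qed

lemma L2_cmult: "f \<in> L2 M \<Longrightarrow> (\<lambda>z. c * f z) \<in> L2 M"
  by (auto simp: L2_def power_mult_distrib)

lemma L2_add: "f \<in> L2 M \<Longrightarrow> g \<in> L2 M \<Longrightarrow> (\<lambda>z. f z + g z) \<in> L2 M"
  using L2_mult[of f M g] by (auto simp: L2_def power2_sum mult.assoc)

lemma L2_diff: "f \<in> L2 M \<Longrightarrow> g \<in> L2 M \<Longrightarrow> (\<lambda>z. f z - g z) \<in> L2 M"
  using L2_add[OF _ L2_cmult, of f M g "-1"] by simp

lemma L2_bdd_mult:
  assumes "f \<in> L2 M" and [measurable]: "w \<in> borel_measurable M" and "\<And>z. z \<in> space M \<Longrightarrow> \<bar>w z\<bar> \<le> C"
  shows "(\<lambda>z. f z * w z) \<in> L2 M"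
proof -
  have [measurable]: "f \<in> borel_measurable M" using assms by (simp add: L2_def)
  have "integrable M (\<lambda>z. (f z * w z)\<^sup>2)"
  proof (rule Bochner_Integration.integrable_bound)
    show "integrable M (\<lambda>z. C\<^sup>2 * (f z)\<^sup>2)" using assms by (auto simp: L2_def)
    show "AE z in M. norm ((f z * w z)\<^sup>2) \<le> norm (C\<^sup>2 * (f z)\<^sup>2)"
    proof (rule AE_I2)
      fix z assume "z \<in> space M"
      then have "(w z)\<^sup>2 \<le> C\<^sup>2" using assms(3)[of z] power_mono[of "\<bar>w z\<bar>" C 2] by simp
      then show "norm ((f z * w z)\<^sup>2) \<le> norm (C\<^sup>2 * (f z)\<^sup>2)"
        using mult_left_mono[of "(w z)\<^sup>2" "C\<^sup>2" "(f z)\<^sup>2"] by (simp add: power_mult_distrib mult.commute)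
    qed
  qed simp
  then show ?thesis by (simp add: L2_def)
qed

lemma (in finite_measure) L2_bounded:
  assumes [measurable]: "w \<in> borel_measurable M" and "\<And>z. z \<in> space M \<Longrightarrow> \<bar>w z\<bar> \<le> C"
  shows "w \<in> L2 M"
proof -
  have "(\<lambda>z. 1) \<in> L2 M" by (simp add: L2_def)
  from L2_bdd_mult[OF this assms] show ?thesis by simp
qed

lemma (in finite_measure) L2_integrable:
  assumes "f \<in> L2 M" shows "integrable M f"
  using L2_mult[OF assms L2_bounded[of "\<lambda>_. 1" 1]] by simp

text \<open>The discriminant criterion, evaluated at the vertex. It gives Cauchy-Schwarz twice, and
  the Euler equation in \<open>riesz\<close>, where E is the error of a minimizing sequence.\<close>

lemma quadratic_nonneg_imp:
  fixes A C E :: real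
  assumes q: "\<And>t. 0 \<le> t\<^sup>2 * A + 2 * t * C + E" and A: "0 \<le> A"
  shows "C\<^sup>2 \<le> A * E"
proof (cases "A = 0")
  case True
  have "C = 0"
  proof (rule ccontr)
    assume "C \<noteq> 0"
    \<comment> \<open>At this t the affine function 2tC + E takes the value -1.\<close>
    then show False using q[of "- (E + 1) / (2 * C)"] True by (simp add: field_simps)
  qed
  then show ?thesis using True by simp
next
  case False
  then have "A > 0" using A by simp
  then show ?thesis using q[of "- C / A"] by (simp add: field_simps power2_eq_square)
qed

lemma L2_CS:
  assumes "f \<in> L2 M" "g \<in> L2 M"
  shows "\<bar>LINT z|M. f z * g z\<bar> \<le> sqrt (LINT z|M. (f z)\<^sup>2) * sqrt (LINT z|M. (g z)\<^sup>2)"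
proof -
  define A B C where "A = (LINT z|M. (f z)\<^sup>2)" and "B = (LINT z|M. (g z)\<^sup>2)" and "C = (LINT z|M. f z * g z)"
  have nn: "A \<ge> 0" "B \<ge> 0" by (auto simp: A_def B_def)
  have q: "0 \<le> t\<^sup>2 * A + 2 * t * C + B" for t
  proof -
    have "0 \<le> (LINT z|M. (t * f z + g z)\<^sup>2)" by simp
    also have "\<dots> = (LINT z|M. t\<^sup>2 * (f z)\<^sup>2 + (2 * t) * (f z * g z) + (g z)\<^sup>2)"
      by (rule Bochner_Integration.integral_cong) (auto simp: power2_eq_square algebra_simps)
    also have "\<dots> = t\<^sup>2 * A + 2 * t * C + B"
      using assms L2_mult[OF assms] by (simp add: L2_def A_def B_def C_def)
    finally show ?thesis .
  qed
  from quadratic_nonneg_imp[OF this nn(1)]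
  have "\<bar>C\<bar> \<le> sqrt (A * B)" using real_le_rsqrt by auto
  then show ?thesis by (simp add: real_sqrt_mult A_def B_def C_def)
qed

definition L2_tendsto :: "'a measure \<Rightarrow> (nat \<Rightarrow> 'a \<Rightarrow> real) \<Rightarrow> ('a \<Rightarrow> real) \<Rightarrow> bool" where
  "L2_tendsto M F f \<longleftrightarrow> (\<forall>n. F n \<in> L2 M) \<and> f \<in> L2 M \<and> (\<lambda>n. LINT z|M. (F n z - f z)\<^sup>2) \<longlonglongrightarrow> 0"

lemma L2_tendsto_integral:
  assumes "L2_tendsto M F f" "g \<in> L2 M"
  shows "(\<lambda>n. LINT z|M. F n z * g z) \<longlonglongrightarrow> (LINT z|M. f z * g z)"
proof -
  note a = assms(1)[unfolded L2_tendsto_def]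
  have "(\<lambda>n. (LINT z|M. F n z * g z) - (LINT z|M. f z * g z)) \<longlonglongrightarrow> 0"
  proof (rule tendsto_rabs_zero_cancel, rule tendsto_sandwich[OF _ _ tendsto_const])
    have "(\<lambda>n. sqrt (LINT z|M. (F n z - f z)\<^sup>2) * sqrt (LINT z|M. (g z)\<^sup>2))
      \<longlonglongrightarrow> sqrt 0 * sqrt (LINT z|M. (g z)\<^sup>2)"
      using a by (intro tendsto_intros) auto
    then show "(\<lambda>n. sqrt (LINT z|M. (F n z - f z)\<^sup>2) * sqrt (LINT z|M. (g z)\<^sup>2)) \<longlonglongrightarrow> 0" by simp
    show "\<forall>\<^sub>F n in sequentially. \<bar>(LINT z|M. F n z * g z) - (LINT z|M. f z * g z)\<bar>
      \<le> sqrt (LINT z|M. (F n z - f z)\<^sup>2) * sqrt (LINT z|M. (g z)\<^sup>2)"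
    proof (intro always_eventually allI)
      fix n
      have "(LINT z|M. F n z * g z) - (LINT z|M. f z * g z) = (LINT z|M. (F n z - f z) * g z)"
        using a assms(2) L2_mult by (subst Bochner_Integration.integral_diff[symmetric]) (auto simp: left_diff_distrib)
      then show "\<bar>(LINT z|M. F n z * g z) - (LINT z|M. f z * g z)\<bar>
        \<le> sqrt (LINT z|M. (F n z - f z)\<^sup>2) * sqrt (LINT z|M. (g z)\<^sup>2)"
        using L2_CS[OF L2_diff assms(2)] a by auto
    qed
  qed auto
  then show ?thesis by (simp add: LIM_zero_iff)
qed

text \<open>On a finite measure an L^2 Cauchy sequence is Cauchy in L^1, so a subsequence converges
  almost everywhere. Fatou's lemma then turns the Cauchy estimate into an estimate against the
  limit.\<close>

lemma (in finite_measure) L2_complete: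
  assumes F: "\<And>n. F n \<in> L2 M"
    and C: "\<And>e. e > 0 \<Longrightarrow> \<exists>N. \<forall>i\<ge>N. \<forall>j\<ge>N. (LINT z|M. (F i z - F j z)\<^sup>2) < e"
  obtains f where "L2_tendsto M F f"
proof -
  have [measurable]: "F n \<in> borel_measurable M" for n using F by (simp add: L2_def)
  have one: "(\<lambda>_. 1) \<in> L2 M" by (simp add: L2_def)
  \<comment> \<open>The summand 1 keeps K positive even for a null measure, since K is divided by
    below.\<close>
  define K where "K = sqrt (measure M (space M)) + 1"
  have K: "K > 0" by (simp add: K_def add_nonneg_pos)
  have L1: "(LINT z|M. norm (F i z - F j z)) \<le> K * sqrt (LINT z|M. (F i z - F j z)\<^sup>2)" for i j
  proof -
    have "(\<lambda>z. \<bar>F i z - F j z\<bar>) \<in> L2 M" using L2_diff[OF F F, of i j] by (auto simp: L2_def)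
    from L2_CS[OF this one] have "(LINT z|M. \<bar>F i z - F j z\<bar>) \<le>
       sqrt (LINT z|M. (F i z - F j z)\<^sup>2) * sqrt (measure M (space M))" by simp
    also have "\<dots> \<le> sqrt (LINT z|M. (F i z - F j z)\<^sup>2) * K"
      by (intro mult_left_mono) (auto simp: K_def)
    finally show ?thesis by (simp add: mult.commute)
  qed
  have "\<exists>N. \<forall>i\<ge>N. \<forall>j\<ge>N. (LINT z|M. norm (F i z - F j z)) < e" if "e > 0" for e
  proof -
    have "(e / K)\<^sup>2 > 0" using that K by simp
    from C[OF this] obtain N where N: "\<And>i j. i \<ge> N \<Longrightarrow> j \<ge> N \<Longrightarrow> (LINT z|M. (F i z - F j z)\<^sup>2) < (e / K)\<^sup>2"
      by blast
    have "(LINT z|M. norm (F i z - F j z)) < e" if "i \<ge> N" "j \<ge> N" for i j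
    proof -
      have "sqrt (LINT z|M. (F i z - F j z)\<^sup>2) < sqrt ((e / K)\<^sup>2)"
        using N[OF that] by (rule real_sqrt_less_mono)
      also have "sqrt ((e / K)\<^sup>2) = e / K" using \<open>e > 0\<close> K by simp
      finally have "K * sqrt (LINT z|M. (F i z - F j z)\<^sup>2) < e" using K by (simp add: field_simps)
      then show ?thesis using L1[of i j] by linarith
    qed
    then show ?thesis by blast
  qed
  then obtain r where r: "strict_mono r" and ae: "AE x in M. Cauchy (\<lambda>i. F (r i) x)"
    using cauchy_L1_AE_cauchy_subseq[of M F] L2_integrable[OF F] by metis
  define f where "f x = lim (\<lambda>i. F (r i) x)" for x
  have [measurable]: "f \<in> borel_measurable M" unfolding f_def by measurable
  have lim: "AE x in M. (\<lambda>i. F (r i) x) \<longlonglongrightarrow> f x"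
    using ae by eventually_elim (simp add: f_def Cauchy_convergent_iff convergent_LIMSEQ_iff)
  have est: "(\<integral>\<^sup>+x. ennreal ((F n x - f x)\<^sup>2) \<partial>M) \<le> ennreal e"
    if N: "\<forall>i\<ge>N. \<forall>j\<ge>N. (LINT z|M. (F i z - F j z)\<^sup>2) < e" and n: "n \<ge> N" for n N e
  proof -
    \<comment> \<open>The index n stays fixed while the second index runs through the convergent
      subsequence.\<close>
    have "(\<integral>\<^sup>+x. ennreal ((F n x - f x)\<^sup>2) \<partial>M) = (\<integral>\<^sup>+x. liminf (\<lambda>i. ennreal ((F n x - F (r i) x)\<^sup>2)) \<partial>M)"
    proof (rule nn_integral_cong_AE, use lim in eventually_elim)
      case (elim x)
      then have "(\<lambda>i. ennreal ((F n x - F (r i) x)\<^sup>2)) \<longlonglongrightarrow> ennreal ((F n x - f x)\<^sup>2)"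
        by (intro tendsto_intros)
      then show ?case by (rule lim_imp_Liminf[OF trivial_limit_sequentially, symmetric])
    qed
    also have "\<dots> \<le> liminf (\<lambda>i. \<integral>\<^sup>+x. ennreal ((F n x - F (r i) x)\<^sup>2) \<partial>M)"
      by (rule nn_integral_liminf) measurable
    also have "\<dots> \<le> liminf (\<lambda>i. ennreal e)"
    proof (rule Liminf_mono, rule eventually_sequentiallyI[of N])
      fix i assume "i \<ge> N"
      then have "r i \<ge> N" using seq_suble[OF r, of i] by linarith
      then have "(LINT z|M. (F n z - F (r i) z)\<^sup>2) \<le> e" using N n by (meson less_imp_le)
      then show "(\<integral>\<^sup>+x. ennreal ((F n x - F (r i) x)\<^sup>2) \<partial>M) \<le> ennreal e"
        using L2_square[OF L2_diff[OF F F]] by (subst nn_integral_eq_integral) (auto intro: ennreal_leI)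
    qed
    also have "\<dots> = ennreal e" by (simp add: Liminf_const)
    finally show ?thesis .
  qed
  have in_L2: "(\<lambda>x. F n x - f x) \<in> L2 M"
    if N: "\<forall>i\<ge>N. \<forall>j\<ge>N. (LINT z|M. (F i z - F j z)\<^sup>2) < e" and n: "n \<ge> N" for n N e
    using est[OF that] by (auto simp: L2_def intro!: integrableI_bounded) (metis ennreal_less_top le_less_trans)
  have f: "f \<in> L2 M"
  proof -
    obtain N where "\<forall>i\<ge>N. \<forall>j\<ge>N. (LINT z|M. (F i z - F j z)\<^sup>2) < 1" using C[of 1] by auto
    from L2_diff[OF F in_L2[OF this order_refl], of N] show ?thesis by simp
  qed
  have "(\<lambda>n. LINT z|M. (F n z - f z)\<^sup>2) \<longlonglongrightarrow> 0"
  proof (rule LIMSEQ_I)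
    fix e :: real assume "e > 0"
    then obtain N where N: "\<forall>i\<ge>N. \<forall>j\<ge>N. (LINT z|M. (F i z - F j z)\<^sup>2) < e / 2" using C[of "e/2"] by auto
    have "(LINT z|M. (F n z - f z)\<^sup>2) \<le> e / 2" if "n \<ge> N" for n
    proof -
      have "ennreal (LINT z|M. (F n z - f z)\<^sup>2) = (\<integral>\<^sup>+x. ennreal ((F n x - f x)\<^sup>2) \<partial>M)"
        using L2_square[OF in_L2[OF N that]] by (subst nn_integral_eq_integral) auto
      also have "\<dots> \<le> ennreal (e / 2)" by (rule est[OF N that])
      finally show ?thesis using \<open>e > 0\<close> by (simp add: ennreal_le_iff)
    qed
    then show "\<exists>no. \<forall>n\<ge>no. norm ((LINT z|M. (F n z - f z)\<^sup>2) - 0) < e"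
      using \<open>e > 0\<close> by (intro exI[of _ N]) (auto, fastforce)
  qed
  then show ?thesis using that f F by (auto simp: L2_tendsto_def)
qed

subsection \<open>Test functions and weak derivatives\<close>

lemma test_frechet:
  assumes "\<phi> \<in> test_functions S" "b \<in> Basis"
  shows "(\<lambda>z. frechet_derivative \<phi> (at z) b) \<in> test_functions S"
proof -
  let ?D = "\<lambda>z. frechet_derivative \<phi> (at z) b" and ?K = "closure {z. \<phi> z \<noteq> 0}"
  have a: "\<And>k. Ck (Suc k) \<phi>" "compact ?K" "?K \<subseteq> S" using assms(1) unfolding test_functions_def by blast+
  have "?D z = 0" if "z \<notin> ?K" for z
  proof -
    have "(\<phi> has_derivative (\<lambda>_. 0)) (at z)"
    proof (rule has_derivative_transform_within_open[of "\<lambda>_. 0" _ _ UNIV "- ?K"])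
      show "0 = \<phi> x" if "x \<in> - ?K" for x
        using that closure_subset[of "{z. \<phi> z \<noteq> 0}"] by (auto dest: subsetD)
    qed (use that in auto)
    from frechet_derivative_at[OF this, symmetric] show ?thesis by simp
  qed
  then have "{z. ?D z \<noteq> 0} \<subseteq> ?K" by blast
  then have sub: "closure {z. ?D z \<noteq> 0} \<subseteq> ?K" by (intro closure_minimal) auto
  moreover have "compact (closure {z. ?D z \<noteq> 0})"
    using bounded_subset[OF compact_imp_bounded[OF a(2)] sub] by (simp add: compact_eq_bounded_closed)
  ultimately show ?thesis using a assms(2) unfolding test_functions_def by auto
qed

lemma test_pderivs: "\<phi> \<in> test_functions S \<Longrightarrow> set bs \<subseteq> Basis \<Longrightarrow> pderivs bs \<phi> \<in> test_functions S"
proof (induction bs)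
  case Nil then show ?case by (simp add: pderivs_def)
next
  case (Cons b bs)
  then have "(\<lambda>z. frechet_derivative (pderivs bs \<phi>) (at z) b) \<in> test_functions S"
    by (intro test_frechet) auto
  then show ?case by (simp add: pderivs_def)
qed

lemma test_continuous: "\<phi> \<in> test_functions S \<Longrightarrow> continuous_on T \<phi>"
  using continuous_on_subset[of UNIV \<phi> T] unfolding test_functions_def by (auto dest: spec[of _ 0])

lemma test_bounded:
  assumes "\<phi> \<in> test_functions S" obtains C where "\<And>z. \<bar>\<phi> z\<bar> \<le> C"
proof -
  let ?K = "closure {z. \<phi> z \<noteq> 0}"
  have "compact ?K" using assms by (simp add: test_functions_def)
  from compact_imp_bounded[OF compact_continuous_image[OF test_continuous[OF assms] this]]
  obtain C where C: "\<forall>y\<in>\<phi> ` ?K. norm y \<le> C" unfolding bounded_iff by blast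
  have "\<bar>\<phi> z\<bar> \<le> \<bar>C\<bar>" for z
  proof (cases "\<phi> z = 0")
    case False
    then have "z \<in> ?K" using closure_subset[of "{z. \<phi> z \<noteq> 0}"] by blast
    then show ?thesis using C by fastforce
  qed simp
  then show ?thesis using that by blast
qed

lemma borel_lebesgue_on: "f \<in> borel_measurable borel \<Longrightarrow> f \<in> borel_measurable (lebesgue_on S)"
  by (intro measurable_restrict_space1 measurable_completion) simp

lemma test_measurable: "\<phi> \<in> test_functions S \<Longrightarrow> \<phi> \<in> borel_measurable (lebesgue_on S)"
  by (intro borel_lebesgue_on borel_measurable_continuous_onI test_continuous)

lemma test_L2:
  assumes "S \<in> lmeasurable" "\<phi> \<in> test_functions S" shows "\<phi> \<in> L2 (lebesgue_on S)"
proof -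
  interpret finite_measure "lebesgue_on S" by (rule finite_measure_lebesgue_on[OF assms(1)])
  obtain C where "\<And>z. \<bar>\<phi> z\<bar> \<le> C" using test_bounded assms(2) by blast
  then show ?thesis by (intro L2_bounded test_measurable assms(2))
qed

lemma has_weak_deriv_L2:
  "has_weak_deriv S bs u g \<Longrightarrow> u \<in> L2 (lebesgue_on S)" "has_weak_deriv S bs u g \<Longrightarrow> g \<in> L2 (lebesgue_on S)"
  by (auto simp only: has_weak_deriv_def Lp_space_2)

lemma has_weak_deriv_lincomb:
  assumes S: "S \<in> lmeasurable" and bs: "set bs \<subseteq> Basis"
    and u: "has_weak_deriv S bs u g" and v: "has_weak_deriv S bs v h"
  shows "has_weak_deriv S bs (\<lambda>z. a * u z + b * v z) (\<lambda>z. a * g z + b * h z)"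
proof -
  note L = has_weak_deriv_L2[OF u] has_weak_deriv_L2[OF v]
  have eq: "(LINT z|lebesgue_on S. (a * p z + b * q z) * \<phi> z) =
      a * (LINT z|lebesgue_on S. p z * \<phi> z) + b * (LINT z|lebesgue_on S. q z * \<phi> z)"
    if "p \<in> L2 (lebesgue_on S)" "q \<in> L2 (lebesgue_on S)" "\<phi> \<in> L2 (lebesgue_on S)" for p q \<phi>
  proof -
    have "(LINT z|lebesgue_on S. (a * p z + b * q z) * \<phi> z) =
        (LINT z|lebesgue_on S. a * (p z * \<phi> z) + b * (q z * \<phi> z))" by (simp add: algebra_simps)
    also have "\<dots> = a * (LINT z|lebesgue_on S. p z * \<phi> z) + b * (LINT z|lebesgue_on S. q z * \<phi> z)"
      using L2_mult[OF that(1,3)] L2_mult[OF that(2,3)] by simp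
    finally show ?thesis .
  qed
  show ?thesis
    unfolding has_weak_deriv_def Lp_space_2
  proof (intro conjI ballI L2_add L2_cmult L)
    fix \<phi> assume t: "\<phi> \<in> test_functions S"
    then show "(LINT z|lebesgue_on S. (a * u z + b * v z) * pderivs bs \<phi> z) =
        (- 1) ^ length bs * (LINT z|lebesgue_on S. (a * g z + b * h z) * \<phi> z)"
      using u v unfolding eq[OF L(1,3) test_L2[OF S test_pderivs[OF t bs]]] eq[OF L(2,4) test_L2[OF S t]]
      by (simp add: has_weak_deriv_def distrib_left)
  qed
qed

text \<open>Weak differentiation is a closed operator: both sides of the defining identity pair the
  sequence with a fixed L^2 function.\<close>

lemma has_weak_deriv_limit:
  assumes S: "S \<in> lmeasurable" and bs: "set bs \<subseteq> Basis"
    and w: "\<And>n. has_weak_deriv S bs (U n) (G n)"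
    and U: "L2_tendsto (lebesgue_on S) U u" and G: "L2_tendsto (lebesgue_on S) G g"
  shows "has_weak_deriv S bs u g"
  unfolding has_weak_deriv_def Lp_space_2
proof (intro conjI ballI)
  show "u \<in> L2 (lebesgue_on S)" "g \<in> L2 (lebesgue_on S)" using U G by (auto simp: L2_tendsto_def)
  fix \<phi> assume t: "\<phi> \<in> test_functions S"
  have "(\<lambda>n. LINT z|lebesgue_on S. U n z * pderivs bs \<phi> z) \<longlonglongrightarrow> (LINT z|lebesgue_on S. u z * pderivs bs \<phi> z)"
    by (intro L2_tendsto_integral U test_L2 S test_pderivs t bs)
  moreover have eq: "(LINT z|lebesgue_on S. U n z * pderivs bs \<phi> z) =
      (- 1) ^ length bs * (LINT z|lebesgue_on S. G n z * \<phi> z)" for n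
    using w[of n] t by (simp add: has_weak_deriv_def)
  moreover have "(\<lambda>n. (- 1) ^ length bs * (LINT z|lebesgue_on S. G n z * \<phi> z)) \<longlonglongrightarrow>
      (- 1) ^ length bs * (LINT z|lebesgue_on S. g z * \<phi> z)"
    by (intro tendsto_intros L2_tendsto_integral G test_L2 S t)
  ultimately show "(LINT z|lebesgue_on S. u z * pderivs bs \<phi> z) =
      (- 1) ^ length bs * (LINT z|lebesgue_on S. g z * \<phi> z)"
    by (simp only: eq) (rule LIMSEQ_unique)
qed

subsection \<open>The rectangle\<close>

lemma Omega_open: "open (Omega l)"
  unfolding Omega_def by (intro open_Times) auto

lemma Omega_bounded: "bounded (Omega l)"
  unfolding Omega_def by (intro bounded_Times) auto

lemma Omega_lmeasurable: "Omega l \<in> lmeasurable"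
  by (rule bounded_set_imp_lmeasurable[OF Omega_bounded lmeasurable_open[OF Omega_bounded Omega_open, THEN fmeasurableD]])

lemma Omega_sets: "Omega l \<in> sets lebesgue"
  using Omega_lmeasurable by (rule fmeasurableD)

interpretation Om: finite_measure "lebesgue_on (Omega l)" for l
  by (rule finite_measure_lebesgue_on[OF Omega_lmeasurable])

lemma closure_Omega: "l > 0 \<Longrightarrow> closure (Omega l) = {0..pi} \<times> {-l..l}"
  by (simp add: Omega_def closure_Times)

section \<open>Integrals over the rectangle against product functions\<close>

lemma tens_borel:
  assumes "f \<in> borel_measurable borel" "g \<in> borel_measurable borel"
  shows "tens f g \<in> borel_measurable borel"
proof -
  have [measurable]: "f \<in> borel_measurable borel" "g \<in> borel_measurable borel" by fact+
  have "(\<lambda>z. f (fst z) * g (snd z)) \<in> borel_measurable (borel \<Otimes>\<^sub>M borel)" by measurable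
  then show ?thesis by (simp add: tens_def[abs_def] borel_prod)
qed

lemma tens_integrable:
  assumes "integrable (lebesgue_on (Omega l)) g"
    and "\<phi> \<in> borel_measurable borel" "\<psi> \<in> borel_measurable borel"
    and "\<And>s. s \<in> {0<..<pi} \<Longrightarrow> \<bar>\<phi> s\<bar> \<le> A" "\<And>t. t \<in> {-l<..<l} \<Longrightarrow> \<bar>\<psi> t\<bar> \<le> B"
  shows "integrable (lebesgue_on (Omega l)) (\<lambda>z. g z * tens \<phi> \<psi> z)"
proof (rule Bochner_Integration.integrable_bound)
  show "integrable (lebesgue_on (Omega l)) (\<lambda>z. A * B * g z)" using assms(1) by simp
  have "tens \<phi> \<psi> \<in> borel_measurable (lebesgue_on (Omega l))"
    by (intro borel_lebesgue_on tens_borel assms)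
  then show "(\<lambda>z. g z * tens \<phi> \<psi> z) \<in> borel_measurable (lebesgue_on (Omega l))" using assms(1) by auto
  show "AE z in lebesgue_on (Omega l). norm (g z * tens \<phi> \<psi> z) \<le> norm (A * B * g z)"
  proof (rule AE_I2)
    fix z assume "z \<in> space (lebesgue_on (Omega l))"
    then have z: "fst z \<in> {0<..<pi}" "snd z \<in> {-l<..<l}" by (auto simp: Omega_def)
    have "\<bar>tens \<phi> \<psi> z\<bar> \<le> \<bar>A * B\<bar>"
      unfolding tens_def abs_mult using assms(4)[OF z(1)] assms(5)[OF z(2)] by (intro mult_mono) auto
    then show "norm (g z * tens \<phi> \<psi> z) \<le> norm (A * B * g z)"
      by (simp add: abs_mult mult_right_mono mult.commute[of "\<bar>g z\<bar>"])
  qed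
qed

text \<open>Bounds and limits are asked for on the open intervals only, since the smoothed steps
  need not converge to the jump at the endpoints.\<close>

lemma tens_DCT:
  assumes g: "integrable (lebesgue_on (Omega l)) g"
    and m: "\<And>n. \<phi> n \<in> borel_measurable borel" "\<And>n. \<psi> n \<in> borel_measurable borel"
      "\<phi>0 \<in> borel_measurable borel" "\<psi>0 \<in> borel_measurable borel"
    and b: "\<And>n s. s \<in> {0<..<pi} \<Longrightarrow> \<bar>\<phi> n s\<bar> \<le> A" "\<And>n t. t \<in> {-l<..<l} \<Longrightarrow> \<bar>\<psi> n t\<bar> \<le> B"
    and c: "\<And>s. s \<in> {0<..<pi} \<Longrightarrow> (\<lambda>n. \<phi> n s) \<longlonglongrightarrow> \<phi>0 s" "\<And>t. t \<in> {-l<..<l} \<Longrightarrow> (\<lambda>n. \<psi> n t) \<longlonglongrightarrow> \<psi>0 t"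
  shows "(\<lambda>n. LINT z|lebesgue_on (Omega l). g z * tens (\<phi> n) (\<psi> n) z)
    \<longlonglongrightarrow> (LINT z|lebesgue_on (Omega l). g z * tens \<phi>0 \<psi>0 z)"
proof (rule integral_dominated_convergence[where w = "\<lambda>z. norm (A * B * g z)"])
  have [measurable]: "g \<in> borel_measurable (lebesgue_on (Omega l))" using g by auto
  have [measurable]: "tens (\<phi> n) (\<psi> n) \<in> borel_measurable (lebesgue_on (Omega l))"
    "tens \<phi>0 \<psi>0 \<in> borel_measurable (lebesgue_on (Omega l))" for n
    by (intro borel_lebesgue_on tens_borel m)+
  show "(\<lambda>z. g z * tens \<phi>0 \<psi>0 z) \<in> borel_measurable (lebesgue_on (Omega l))" by measurable
  show "(\<lambda>z. g z * tens (\<phi> n) (\<psi> n) z) \<in> borel_measurable (lebesgue_on (Omega l))" for n by measurable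
  show "integrable (lebesgue_on (Omega l)) (\<lambda>z. norm (A * B * g z))" using g by simp
  show "AE z in lebesgue_on (Omega l). (\<lambda>n. g z * tens (\<phi> n) (\<psi> n) z) \<longlonglongrightarrow> g z * tens \<phi>0 \<psi>0 z"
  proof (rule AE_I2)
    fix z assume "z \<in> space (lebesgue_on (Omega l))"
    then have z: "fst z \<in> {0<..<pi}" "snd z \<in> {-l<..<l}" by (auto simp: Omega_def)
    show "(\<lambda>n. g z * tens (\<phi> n) (\<psi> n) z) \<longlonglongrightarrow> g z * tens \<phi>0 \<psi>0 z"
      unfolding tens_def by (intro tendsto_intros c z)
  qed
  show "AE z in lebesgue_on (Omega l). norm (g z * tens (\<phi> n) (\<psi> n) z) \<le> norm (A * B * g z)" for n
  proof (rule AE_I2)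
    fix z assume "z \<in> space (lebesgue_on (Omega l))"
    then have z: "fst z \<in> {0<..<pi}" "snd z \<in> {-l<..<l}" by (auto simp: Omega_def)
    have "\<bar>tens (\<phi> n) (\<psi> n) z\<bar> \<le> \<bar>A * B\<bar>"
      unfolding tens_def abs_mult using b(1)[OF z(1), of n] b(2)[OF z(2), of n] by (intro mult_mono) auto
    then show "norm (g z * tens (\<phi> n) (\<psi> n) z) \<le> norm (A * B * g z)"
      by (simp add: abs_mult mult_right_mono mult.commute[of "\<bar>g z\<bar>"])
  qed
qed

text \<open>The strict inequality matches the limit of \<open>stp\<close>; for a \<le> b the
  difference \<open>heav a s - heav b s\<close> is the indicator of the half-open interval from a
  (excluded) to b (included).\<close>

definition heav :: "real \<Rightarrow> real \<Rightarrow> real" where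
  "heav x s = (if x < s then 1 else 0)"

lemma heav_borel: "heav x \<in> borel_measurable borel"
  unfolding heav_def by measurable

lemma stp_borel: "a < b \<Longrightarrow> stp a b x n \<in> borel_measurable borel"
  by (intro borel_measurable_continuous_onI smooth_continuous smooth_stp)

lemma stp_heav:
  assumes "a < b" "x \<in> {a..b}" "s \<in> {a<..<b}" shows "(\<lambda>n. stp a b x n s) \<longlonglongrightarrow> heav x s"
  using stp_tendsto[OF assms(1,2)] assms(3) by (simp add: heav_def)

lemma stp_diff_bound: "\<bar>stp a b x n s - stp a b y n s\<bar> \<le> 1" if "a < b"
  using stp_bounds[OF that, of x n s] stp_bounds[OF that, of y n s] by linarith

text \<open>The fundamental lemma of the calculus of variations for product tests. Smoothed steps
  converge to indicators of rectangles, so g has integral zero over all small squares, and Lebesgue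
  differentiation gives g = 0.\<close>

lemma tens_zero_imp_AE_zero:
  assumes l: "l > 0" and g: "integrable (lebesgue_on (Omega l)) g"
    and z: "\<And>\<phi> \<psi>. \<phi> \<in> tests 0 pi \<Longrightarrow> \<psi> \<in> tests (-l) l \<Longrightarrow> (LINT z|lebesgue_on (Omega l). g z * tens \<phi> \<psi> z) = 0"
  shows "AE z in lebesgue_on (Omega l). g z = 0"
proof -
  have ll: "-l < l" using l by simp
  have rect: "(LINT z|lebesgue_on (Omega l). g z * tens (\<lambda>s. heav a s - heav b s) (\<lambda>t. heav c t - heav d t) z) = 0"
    if ab: "a \<in> {0..pi}" "b \<in> {0..pi}" "c \<in> {-l..l}" "d \<in> {-l..l}" for a b c d
  proof -
    have "(\<lambda>n. LINT z|lebesgue_on (Omega l). g z *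
          tens (\<lambda>s. stp 0 pi a n s - stp 0 pi b n s) (\<lambda>t. stp (-l) l c n t - stp (-l) l d n t) z) \<longlonglongrightarrow>
       (LINT z|lebesgue_on (Omega l). g z * tens (\<lambda>s. heav a s - heav b s) (\<lambda>t. heav c t - heav d t) z)"
      using l ab by (intro tens_DCT[OF g, where A = 1 and B = 1] borel_measurable_diff stp_borel heav_borel
          stp_diff_bound tendsto_diff stp_heav) auto
    moreover have "(LINT z|lebesgue_on (Omega l). g z *
          tens (\<lambda>s. stp 0 pi a n s - stp 0 pi b n s) (\<lambda>t. stp (-l) l c n t - stp (-l) l d n t) z) = 0" for n
      by (intro z stp_diff_tests ll pi_gt_zero)
    ultimately show ?thesis by (simp add: LIMSEQ_const_iff)
  qed
  \<comment> \<open>Extension by zero to the plane, where the differentiation theorem is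
    applied.\<close>
  define G where "G z = indicator (Omega l) z * g z" for z
  have intG: "integrable lebesgue G"
    using g Omega_sets by (simp add: G_def[abs_def] integrable_restrict_space)
  have GA: "G absolutely_integrable_on cbox a b" for a b
  proof -
    have "G absolutely_integrable_on UNIV"
      using intG by (simp add: set_integrable_def)
    then show "G absolutely_integrable_on cbox a b"
      by (rule set_integrable_subset) auto
  qed
  note GB = set_lebesgue_integral_eq_integral(1)[OF GA]
  \<comment> \<open>Lebesgue differentiation along squares whose lower left corner is the given
    point.\<close>
  obtain N where N: "negligible N" "\<And>x e. \<lbrakk>x \<notin> N; 0 < e\<rbrakk> \<Longrightarrow> \<exists>d>0. \<forall>h. 0 < h \<and> h < d \<longrightarrow>
      norm (integral (cbox x (x + h *\<^sub>R One)) G /\<^sub>R h ^ DIM(real \<times> real) - G x) < e"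
    using integrable_ccontinuous_explicit[of G, OF GB] by metis
  have One: "(One :: real \<times> real) = (1, 1)"
    by (simp add: Basis_real_prod)
  have cb0: "integral (cbox (x, y) (x + h, y + h)) G = 0"
    if "0 < h" "0 < x" "x + h < pi" "-l < y" "y + h < l" for x y h
  proof -
    define T where "T = tens (\<lambda>s. heav x s - heav (x + h) s) (\<lambda>t. heav y t - heav (y + h) t)"
    have Tb: "T \<in> borel_measurable borel" unfolding T_def
      by (intro tens_borel borel_measurable_diff heav_borel)
    have "integral (cbox (x, y) (x + h, y + h)) G = (LINT z:cbox (x, y) (x + h, y + h)|lebesgue. G z)"
      by (rule set_lebesgue_integral_eq_integral(2)[OF GA, symmetric])
    also have "\<dots> = (LINT z|lebesgue. G z * T z)"
      unfolding set_lebesgue_integral_def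
    proof (rule integral_cong_AE)
      have Gm: "G \<in> borel_measurable lebesgue" by (rule borel_measurable_integrable[OF intG])
      have Tm: "T \<in> borel_measurable lebesgue" using Tb by (intro measurable_completion) simp
      show "(\<lambda>z. indicat_real (cbox (x, y) (x + h, y + h)) z *\<^sub>R G z) \<in> borel_measurable lebesgue"
        by (intro borel_measurable_scaleR borel_measurable_indicator Gm) auto
      show "(\<lambda>z. G z * T z) \<in> borel_measurable lebesgue" by (intro borel_measurable_times Gm Tm)
      \<comment> \<open>T is the indicator of a half-open square; it differs from the closed one
        only on the lines through its left and lower sides.\<close>
      have "negligible {z :: real \<times> real. z \<bullet> (1, 0) = x}"
        by (rule negligible_standard_hyperplane) (simp add: Basis_real_prod)
      moreover have "negligible {z :: real \<times> real. z \<bullet> (0, 1) = y}"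
        by (rule negligible_standard_hyperplane) (simp add: Basis_real_prod)
      ultimately have "negligible ({z :: real \<times> real. z \<bullet> (1, 0) = x} \<union> {z. z \<bullet> (0, 1) = y})" by (rule negligible_Un)
      then have "{z :: real \<times> real. z \<bullet> (1, 0) = x} \<union> {z. z \<bullet> (0, 1) = y} \<in> null_sets lebesgue"
        by (simp add: negligible_iff_null_sets)
      then show "AE z in lebesgue. indicat_real (cbox (x, y) (x + h, y + h)) z *\<^sub>R G z = G z * T z"
      proof (rule AE_I', safe)
        fix a b assume "indicat_real (cbox (x, y) (x + h, y + h)) (a, b) *\<^sub>R G (a, b) \<noteq> G (a, b) * T (a, b)"
          "(a, b) \<bullet> (0, 1) \<noteq> y"
        then show "(a, b) \<bullet> (1, 0) = x"
          using that(1) by (auto simp: T_def tens_def heav_def indicator_def cbox_Pair_eq split: if_splits)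
      qed
    qed
    also have "\<dots> = (LINT z|lebesgue_on (Omega l). g z * T z)"
      using Omega_sets by (simp add: integral_restrict_space G_def mult.assoc)
    also have "\<dots> = 0"
      unfolding T_def using that by (intro rect) auto
    finally show ?thesis .
  qed
  have "g z = 0" if z: "z \<in> Omega l" "z \<notin> N" for z
  proof (rule ccontr)
    assume "g z \<noteq> 0"
    then have gz: "\<bar>G z\<bar> > 0" using z by (simp add: G_def)
    obtain d where d: "d > 0" "\<And>h. 0 < h \<Longrightarrow> h < d \<Longrightarrow>
      norm (integral (cbox z (z + h *\<^sub>R One)) G /\<^sub>R h ^ DIM(real \<times> real) - G z) < \<bar>G z\<bar>"
      using N(2)[OF z(2) gz] by blast
    obtain x y where xy: "z = (x, y)" by (cases z)
    \<comment> \<open>Halving each distance makes the inequalities strict: the closed square stays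
      inside the open rectangle and its side is below d.\<close>
    define h where "h = min (d / 2) (min ((pi - x) / 2) ((l - y) / 2))"
    have h: "0 < h" "h < d" "x + h < pi" "y + h < l"
    proof -
      have p: "0 < pi - x" "0 < l - y" using z(1) by (auto simp: xy Omega_def)
      have "h \<le> d / 2" "h \<le> (pi - x) / 2" "h \<le> (l - y) / 2" unfolding h_def by linarith+
      then have "2 * h \<le> d" "2 * h \<le> pi - x" "2 * h \<le> l - y" by simp_all
      moreover show "0 < h" using p d(1) by (simp add: h_def)
      ultimately show "h < d" "x + h < pi" "y + h < l" by linarith+
    qed
    have "integral (cbox z (z + h *\<^sub>R One)) G = 0"
      using cb0[of h x y] h z(1) by (simp add: xy One Omega_def)
    then show False using d(2)[OF h(1,2)] by simp
  qed
  then have "AE z in lebesgue. z \<in> Omega l \<longrightarrow> g z = 0"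
    using N(1) by (intro AE_I'[of N]) (auto simp: negligible_iff_null_sets)
  then show ?thesis using Omega_sets by (simp add: AE_restrict_space_iff)
qed

lemma has_weak_deriv_unique:
  assumes l: "l > 0" and "has_weak_deriv (Omega l) bs u g" "has_weak_deriv (Omega l) bs u h"
  shows "AE z in lebesgue_on (Omega l). g z = h z"
proof -
  note L = has_weak_deriv_L2[OF assms(2)] has_weak_deriv_L2[OF assms(3)]
  have "AE z in lebesgue_on (Omega l). g z - h z = 0"
  proof (rule tens_zero_imp_AE_zero[OF l])
    show "integrable (lebesgue_on (Omega l)) (\<lambda>z. g z - h z)"
      by (intro Om.L2_integrable L2_diff L)
    fix \<phi> \<psi> assume "\<phi> \<in> tests 0 pi" "\<psi> \<in> tests (-l) l"
    then have t: "tens \<phi> \<psi> \<in> test_functions (Omega l)" by (rule tens_test)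
    note tL = test_L2[OF Omega_lmeasurable t]
    have "(LINT z|lebesgue_on (Omega l). (g z - h z) * tens \<phi> \<psi> z) =
        (LINT z|lebesgue_on (Omega l). g z * tens \<phi> \<psi> z) - (LINT z|lebesgue_on (Omega l). h z * tens \<phi> \<psi> z)"
      using L2_mult[OF L(2) tL] L2_mult[OF L(4) tL] by (simp add: left_diff_distrib)
    also have "\<dots> = 0" using assms(2,3) t by (simp add: has_weak_deriv_def)
    finally show "(LINT z|lebesgue_on (Omega l). (g z - h z) * tens \<phi> \<psi> z) = 0" .
  qed
  then show ?thesis by simp
qed

subsection \<open>Representation of functions in the energy space\<close>

lemma has_weak_deriv_test:
  assumes "has_weak_deriv S bs u g" "\<phi> \<in> test_functions S"
  shows "(LINT z|lebesgue_on S. u z * pderivs bs \<phi> z) = (- 1) ^ length bs * (LINT z|lebesgue_on S. g z * \<phi> z)"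
  using assms by (simp add: has_weak_deriv_def)

text \<open>An average of u in the second variable. For u in the energy space it is continuous in s
  and vanishes at 0 and \<pi>, so it can be evaluated pointwise where a weak derivative
  cannot.\<close>

definition slice :: "(real \<times> real \<Rightarrow> real) \<Rightarrow> (real \<Rightarrow> real) \<Rightarrow> real \<Rightarrow> real" where
  "slice u \<psi> s = (LINT t|lborel. u (s, t) * \<psi> t)"

text \<open>Green's function of \<open>- d\<^sup>2/dx\<^sup>2\<close> on \<open>]0, \<pi>[\<close> with Dirichlet conditions.\<close>

definition green :: "real \<Rightarrow> real \<Rightarrow> real" where
  "green x s = (1 - x / pi) * s - max 0 (s - x)"

lemma green_borel: "green x \<in> borel_measurable borel"
  unfolding green_def by measurable

lemma green_bound:
  assumes "x \<in> {0..pi}" "s \<in> {0..pi}" shows "\<bar>green x s\<bar> \<le> pi"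
proof -
  have "0 \<le> 1 - x / pi" "1 - x / pi \<le> 1" using assms by auto
  then have "0 \<le> (1 - x / pi) * s" "(1 - x / pi) * s \<le> 1 * s"
    using assms by (intro mult_nonneg_nonneg mult_right_mono; simp)+
  then have "0 \<le> (1 - x / pi) * s" "(1 - x / pi) * s \<le> s" by simp_all
  moreover have "0 \<le> max 0 (s - x)" "max 0 (s - x) \<le> s" using assms by auto
  moreover have "s \<le> pi" using assms by simp
  ultimately show ?thesis unfolding green_def abs_le_iff by linarith
qed

context
  fixes l :: real and u :: "real \<times> real \<Rightarrow> real"
  assumes l: "l > 0" and u: "u \<in> H2star l"
begin

lemma H2star_continuous: "continuous_on ({0..pi} \<times> {-l..l}) u"
  and H2star_outside: "z \<notin> {0..pi} \<times> {-l..l} \<Longrightarrow> u z = 0"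
  and H2star_left: "t \<in> {-l<..<l} \<Longrightarrow> u (0, t) = 0"
  and H2star_right: "t \<in> {-l<..<l} \<Longrightarrow> u (pi, t) = 0"
  using u l unfolding H2star_def mem_Collect_eq closure_Omega[OF l] by blast+

text \<open>Extended by zero, u is continuous across the vertical sides, where it vanishes, but may
  jump across y = -l and y = l; the factor \<psi> removes these jumps.\<close>

lemma cut_continuous:
  assumes "\<psi> \<in> tests (-l) l"
  shows "continuous_on UNIV (\<lambda>z. u z * \<psi> (snd z))"
proof -
  obtain c d where cd: "-l < c" "d < l" "\<And>t. t \<notin> {c..d} \<Longrightarrow> \<psi> t = 0"
    using assms by (auto simp: tests_def)
  \<comment> \<open>The horizontal strips of \<open>?B\<close> must be closed and keep away from the
    support of \<psi>, hence levels strictly between the support and the edges. Two closed sets then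
    cover the plane.\<close>
  obtain c' d' where c': "-l < c'" "c' < c" and d': "d < d'" "d' < l"
    using cd dense by meson
  let ?A = "{0..pi} \<times> {-l..l}" and ?B = "({..0} \<times> UNIV) \<union> ({pi..} \<times> UNIV) \<union> (UNIV \<times> {..c'}) \<union> (UNIV \<times> {d'..}) :: (real \<times> real) set"
  have z: "u z * \<psi> (snd z) = 0" if zB: "z \<in> ?B" for z
  proof (cases "\<psi> (snd z) = 0")
    case False
    then have t: "snd z \<in> {c..d}" using cd(3) by blast
    then have t': "snd z \<in> {-l<..<l}" using cd(1,2) by auto
    have "fst z \<le> 0 \<or> fst z \<ge> pi" using zB t c' d' by (auto simp: mem_Times_iff)
    then have "u z = 0"
      using H2star_left[OF t'] H2star_right[OF t'] H2star_outside[of z]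
      by (cases z) (auto, fastforce+)
    then show ?thesis by simp
  qed simp
  have "continuous_on (?A \<union> ?B) (\<lambda>z. u z * \<psi> (snd z))"
  proof (rule continuous_on_closed_Un)
    show "closed ?A" "closed ?B" by (intro closed_Times closed_Un closed_UNIV closed_atLeast closed_atMost closed_atLeastAtMost)+
    show "continuous_on ?A (\<lambda>z. u z * \<psi> (snd z))"
      by (intro continuous_on_mult H2star_continuous continuous_on_compose2[OF tests_continuous[OF assms] _ subset_UNIV]
          continuous_on_snd continuous_on_id)
    show "continuous_on ?B (\<lambda>z. u z * \<psi> (snd z))"
      using continuous_on_const[of ?B "0::real"] z by (subst continuous_on_cong[OF refl z]) auto
  qed
  moreover have "?A \<union> ?B = UNIV" using c' d' by (auto simp: mem_Times_iff)
  ultimately show ?thesis by simp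
qed

lemma slice_integral:
  assumes "\<psi> \<in> tests (-l) l"
  shows "slice u \<psi> s = integral {-l..l} (\<lambda>t. u (s, t) * \<psi> t)"
proof -
  have c: "continuous_on S (\<lambda>t. u (s, t) * \<psi> t)" for S
    using continuous_on_compose2[OF cut_continuous[OF assms], of S "\<lambda>t. (s, t)"] by (simp add: continuous_on_Pair)
  have "slice u \<psi> s = (LINT t:{-l..l}|lborel. u (s, t) * \<psi> t)"
    unfolding slice_def set_lebesgue_integral_def
  proof (rule Bochner_Integration.integral_cong)
    show "u (s, t) * \<psi> t = indicator {-l..l} t *\<^sub>R (u (s, t) * \<psi> t)" for t
      using tests_zero[OF assms, of t] by (cases "t \<in> {-l..l}") auto
  qed simp
  also have "\<dots> = integral {-l..l} (\<lambda>t. u (s, t) * \<psi> t)"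
    by (intro set_borel_integral_eq_integral(2) borel_integrable_atLeastAtMost' c)
  finally show ?thesis .
qed

lemma slice_continuous:
  assumes "\<psi> \<in> tests (-l) l"
  shows "continuous_on UNIV (slice u \<psi>)"
proof -
  have "continuous_on UNIV (\<lambda>s. integral (cbox (-l) l) (\<lambda>t. u (s, t) * \<psi> t))"
  proof (rule integral_continuous_on_param)
    have "(\<lambda>(x, t). u (x, t) * \<psi> t) = (\<lambda>z. u z * \<psi> (snd z))" by auto
    then show "continuous_on (UNIV \<times> cbox (-l) l) (\<lambda>(x, t). u (x, t) * \<psi> t)"
      using continuous_on_subset[OF cut_continuous[OF assms]] by simp
  qed
  then show ?thesis by (simp add: slice_integral[OF assms, abs_def])
qed

lemma slice_boundary:
  assumes "\<psi> \<in> tests (-l) l" shows "slice u \<psi> 0 = 0" "slice u \<psi> pi = 0"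
proof -
  have "u (0, t) * \<psi> t = 0" "u (pi, t) * \<psi> t = 0" for t
    using tests_zero[OF assms, of t] H2star_left[of t] H2star_right[of t] by (cases "t \<in> {-l<..<l}"; auto)+
  then show "slice u \<psi> 0 = 0" "slice u \<psi> pi = 0" unfolding slice_def by (simp_all only: Bochner_Integration.integral_zero)
qed

text \<open>Fubini; the integrand, cut off by both test functions, is continuous on the whole plane
  and vanishes outside the rectangle.\<close>

lemma tens_slice:
  assumes \<phi>: "\<phi> \<in> tests 0 pi" and \<psi>: "\<psi> \<in> tests (-l) l"
  shows "(LINT z|lebesgue_on (Omega l). u z * tens \<phi> \<psi> z) = (LINT s|lborel. slice u \<psi> s * \<phi> s)"
proof -
  let ?K = "{0..pi} \<times> {-l..l}"
  define W where "W z = u z * \<psi> (snd z) * \<phi> (fst z)" for z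
  have cW: "continuous_on S W" for S
  proof -
    have "continuous_on UNIV W" unfolding W_def
      by (intro continuous_on_mult cut_continuous \<psi> continuous_on_compose2[OF tests_continuous[OF \<phi>] _ subset_UNIV]
          continuous_on_fst continuous_on_id)
    then show ?thesis using continuous_on_subset by blast
  qed
  have Wm: "W \<in> borel_measurable borel" using borel_measurable_continuous_onI[OF cW] .
  have Wz: "W z = 0" if "z \<notin> Omega l" for z
    using that tests_zero[OF \<phi>, of "fst z"] tests_zero[OF \<psi>, of "snd z"] by (auto simp: W_def Omega_def mem_Times_iff)
  have "integrable lborel (\<lambda>z. indicator ?K z *\<^sub>R W z)"
    by (intro borel_integrable_compact compact_Times compact_Icc cW)
  moreover have "(\<lambda>z. indicator ?K z *\<^sub>R W z) = W"
  proof
    fix z show "indicator ?K z *\<^sub>R W z = W z"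
      using Wz[of z] by (cases "z \<in> ?K") (auto simp: Omega_def mem_Times_iff)
  qed
  ultimately have Wi: "integrable (lborel \<Otimes>\<^sub>M lborel) W" by (simp add: lborel_prod)
  have "(LINT z|lebesgue_on (Omega l). u z * tens \<phi> \<psi> z) = (LINT z|lebesgue. W z)"
  proof -
    have "indicator (Omega l) z *\<^sub>R (u z * tens \<phi> \<psi> z) = W z" for z
      using Wz[of z] by (cases "z \<in> Omega l") (auto simp: W_def tens_def)
    then show ?thesis using Omega_sets by (simp add: integral_restrict_space)
  qed
  also have "\<dots> = (LINT z|lborel. W z)"
    by (rule integral_completion) (simp add: Wm)
  also have "\<dots> = (LINT s|lborel. LINT t|lborel. W (s, t))"
    using lborel_pair.integral_fst'[OF Wi] by (simp add: lborel_prod)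
  also have "\<dots> = (LINT s|lborel. slice u \<psi> s * \<phi> s)"
    by (simp add: W_def slice_def)
  finally show ?thesis .
qed

lemma slice_dlt:
  assumes "\<psi> \<in> tests (-l) l" "x \<in> {0..pi}"
  shows "(\<lambda>n. LINT s|lborel. slice u \<psi> s * dlt 0 pi x n s) \<longlonglongrightarrow> slice u \<psi> x"
  by (rule dlt_limit) (use assms continuous_on_subset[OF slice_continuous] in auto)

lemma slice_dlt_integrable:
  assumes "\<psi> \<in> tests (-l) l"
  shows "integrable lborel (\<lambda>s. slice u \<psi> s * dlt 0 pi x n s)"
  by (rule continuous_dlt_integrable) (use assms continuous_on_subset[OF slice_continuous] in auto)

text \<open>Testing u_xx with a smoothed tent puts two derivatives on the tent and produces
  approximate point masses at 0, x and \<pi>. The masses at 0 and \<pi> see the zero boundary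
  values, so only minus the value at x survives, while the tents converge to
  \<open>green x\<close>.\<close>

lemma slice_green:
  assumes f: "has_weak_deriv (Omega l) [(1, 0), (1, 0)] u f" and \<psi>: "\<psi> \<in> tests (-l) l" and x: "x \<in> {0..pi}"
  shows "slice u \<psi> x = - (LINT z|lebesgue_on (Omega l). f z * tens (green x) \<psi> z)"
proof -
  define cl where "cl y n = clip 0 pi y n" for y n
  define al where "al n = (cl pi n - cl x n) / (cl pi n - cl 0 n)" for n
  define be where "be n = (cl x n - cl 0 n) / (cl pi n - cl 0 n)" for n
  define \<phi> where "\<phi> n s = al n * rmp 0 pi 0 n s - rmp 0 pi x n s + be n * rmp 0 pi pi n s" for n s
  define \<phi>1 where "\<phi>1 n s = al n * stp 0 pi 0 n s - stp 0 pi x n s + be n * stp 0 pi pi n s" for n s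
  \<comment> \<open>The weights \<open>al\<close> and \<open>be\<close> converge to 1 - x/\<pi> and
    x/\<pi>, the coordinates of x in the interval.\<close>
  define \<phi>2 where "\<phi>2 n s = al n * dlt 0 pi 0 n s - dlt 0 pi x n s + be n * dlt 0 pi pi n s" for n s
  have t: "\<phi> n \<in> tests 0 pi" for n
    unfolding \<phi>_def[abs_def] al_def be_def cl_def by (rule tent_tests) simp
  have d1: "(\<phi> n has_real_derivative \<phi>1 n s) (at s)" for n s
    unfolding \<phi>_def[abs_def] \<phi>1_def by (intro DERIV_add DERIV_diff DERIV_cmult rmp_DERIV) auto
  have d2: "(\<phi>1 n has_real_derivative \<phi>2 n s) (at s)" for n s
    unfolding \<phi>1_def[abs_def] \<phi>2_def by (intro DERIV_add DERIV_diff DERIV_cmult stp_DERIV) auto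
  have t2: "\<phi>2 n \<in> tests 0 pi" for n
    by (rule tests_deriv[OF tests_deriv[OF t d1] d2])
  obtain \<psi>' where \<psi>': "\<And>x. (\<psi> has_real_derivative \<psi>' x) (at x)" "\<psi>' \<in> tests (-l) l"
    using tests_obtain_deriv[OF \<psi>] by blast
  obtain \<psi>'' where \<psi>'': "\<And>x. (\<psi>' has_real_derivative \<psi>'' x) (at x)"
    using tests_obtain_deriv[OF \<psi>'(2)] by blast
  have weak: "(LINT z|lebesgue_on (Omega l). f z * tens (\<phi> n) \<psi> z) = (LINT s|lborel. slice u \<psi> s * \<phi>2 n s)" for n
    using has_weak_deriv_test[OF f tens_test[OF t \<psi>], of n] tens_slice[OF t2 \<psi>, of n]
    unfolding pderivs_tens_xx[OF d1 d2 \<psi>'(1) \<psi>''] by simp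
  have lc: "cl 0 \<longlonglongrightarrow> 0" "cl pi \<longlonglongrightarrow> pi" "cl x \<longlonglongrightarrow> x"
    unfolding cl_def using x by (auto intro!: clip_tendsto)
  have "al \<longlonglongrightarrow> (pi - x) / (pi - 0)" "be \<longlonglongrightarrow> (x - 0) / (pi - 0)"
    unfolding al_def be_def by (intro tendsto_intros lc; simp)+
  then have la: "al \<longlonglongrightarrow> 1 - x / pi" and lb: "be \<longlonglongrightarrow> x / pi" by (simp_all add: diff_divide_distrib)
  have 1: "(\<lambda>n. LINT s|lborel. slice u \<psi> s * \<phi>2 n s) \<longlonglongrightarrow>
      (1 - x / pi) * slice u \<psi> 0 - slice u \<psi> x + (x / pi) * slice u \<psi> pi"
  proof -
    have "(LINT s|lborel. slice u \<psi> s * \<phi>2 n s) = al n * (LINT s|lborel. slice u \<psi> s * dlt 0 pi 0 n s)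
        - (LINT s|lborel. slice u \<psi> s * dlt 0 pi x n s) + be n * (LINT s|lborel. slice u \<psi> s * dlt 0 pi pi n s)" for n
    proof -
      have "(LINT s|lborel. slice u \<psi> s * \<phi>2 n s) = (LINT s|lborel. al n * (slice u \<psi> s * dlt 0 pi 0 n s)
        - (slice u \<psi> s * dlt 0 pi x n s) + be n * (slice u \<psi> s * dlt 0 pi pi n s))"
        by (simp add: \<phi>2_def algebra_simps)
      then show ?thesis using slice_dlt_integrable[OF \<psi>] by simp
    qed
    moreover have "(\<lambda>n. al n * (LINT s|lborel. slice u \<psi> s * dlt 0 pi 0 n s)
        - (LINT s|lborel. slice u \<psi> s * dlt 0 pi x n s) + be n * (LINT s|lborel. slice u \<psi> s * dlt 0 pi pi n s))
        \<longlonglongrightarrow> (1 - x / pi) * slice u \<psi> 0 - slice u \<psi> x + (x / pi) * slice u \<psi> pi"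
      using x by (intro tendsto_intros slice_dlt \<psi> la lb) auto
    ultimately show ?thesis by simp
  qed
  have p: "cl 0 n \<le> cl x n" "cl x n \<le> cl pi n" "0 \<le> cl y n" "cl y n \<le> pi" "cl 0 n < cl pi n" for n y
    unfolding cl_def using clip_bounds[where a = 0 and b = pi and n = n] eps_pos[of 0 pi n] eps_le[of 0 pi n]
    by (auto simp: clip_left clip_right intro: order_trans[OF _ clip_bounds(1)] order_trans[OF clip_bounds(2)])
  have ab: "\<bar>al n\<bar> \<le> 1" "\<bar>be n\<bar> \<le> 1" for n
    using p[of n] by (auto simp: al_def be_def abs_le_iff field_simps)
  have rb: "\<bar>rmp 0 pi y n s\<bar> \<le> 2 * pi" if "s \<in> {0<..<pi}" for y n s
    using rmp_approx[of 0 pi y n s] p(3,4)[of y n] eps_le[of 0 pi n] eps_pos[of 0 pi n] that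
    by (auto simp: cl_def abs_le_iff max_def split: if_splits)
  obtain B where B: "\<And>t. \<bar>\<psi> t\<bar> \<le> B" using tests_bounded[OF \<psi>] by blast
  have 2: "(\<lambda>n. LINT z|lebesgue_on (Omega l). f z * tens (\<phi> n) \<psi> z) \<longlonglongrightarrow>
      (LINT z|lebesgue_on (Omega l). f z * tens (green x) \<psi> z)"
  proof (rule tens_DCT[where A = "6 * pi" and B = B])
    show "integrable (lebesgue_on (Omega l)) f"
      using has_weak_deriv_L2(2)[OF f] by (rule Om.L2_integrable)
    show "\<phi> n \<in> borel_measurable borel" "\<psi> \<in> borel_measurable borel" for n
      using t \<psi> by (auto intro: tests_borel)
    fix s assume s: "s \<in> {0<..<pi}"
    have "\<bar>\<phi> n s\<bar> \<le> 1 * (2 * pi) + 2 * pi + 1 * (2 * pi)" for n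
    proof -
      have "\<bar>al n * rmp 0 pi 0 n s\<bar> \<le> 1 * (2 * pi)" "\<bar>be n * rmp 0 pi pi n s\<bar> \<le> 1 * (2 * pi)"
        unfolding abs_mult by (intro mult_mono ab rb s; simp)+
      then show ?thesis using rb[OF s, of x n] by (simp add: \<phi>_def)
    qed
    then show "\<bar>\<phi> n s\<bar> \<le> 6 * pi" for n by simp
    have "(\<lambda>n. \<phi> n s) \<longlonglongrightarrow> (1 - x / pi) * max 0 (s - 0) - max 0 (s - x) + (x / pi) * max 0 (s - pi)"
      unfolding \<phi>_def using x by (intro tendsto_intros rmp_tendsto la lb) auto
    then show "(\<lambda>n. \<phi> n s) \<longlonglongrightarrow> green x s" using s by (simp add: green_def)
  qed (use green_borel B tests_borel[OF \<psi>] in auto)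
  have "(LINT z|lebesgue_on (Omega l). f z * tens (green x) \<psi> z) =
      (1 - x / pi) * slice u \<psi> 0 - slice u \<psi> x + (x / pi) * slice u \<psi> pi"
    using LIMSEQ_unique[OF 2] 1 by (simp add: weak)
  then show ?thesis using slice_boundary[OF \<psi>] by simp
qed

text \<open>The weak form of u_y(x, .) being the integral of u_xy from 0 to x. The test function in
  the first variable is a smoothed indicator of the interval from 0 to x, whose derivative is an
  approximate mass at 0 minus one at x; the value at 0 vanishes.\<close>

lemma slice_heav:
  assumes h: "has_weak_deriv (Omega l) [(1, 0), (0, 1)] u h" and \<psi>: "\<psi> \<in> tests (-l) l"
    and \<psi>': "\<And>t. (\<psi> has_real_derivative \<psi>' t) (at t)" and x: "x \<in> {0..pi}"
  shows "slice u \<psi>' x = - (LINT z|lebesgue_on (Omega l). h z * tens (\<lambda>s. heav 0 s - heav x s) \<psi> z)"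
proof -
  have \<psi>1: "\<psi>' \<in> tests (-l) l" by (rule tests_deriv[OF \<psi> \<psi>'])
  obtain \<psi>'' where \<psi>'': "\<And>x. (\<psi>' has_real_derivative \<psi>'' x) (at x)"
    using tests_obtain_deriv[OF \<psi>1] by blast
  define \<phi> where "\<phi> n s = stp 0 pi 0 n s - stp 0 pi x n s" for n s
  define \<phi>1 where "\<phi>1 n s = dlt 0 pi 0 n s - dlt 0 pi x n s" for n s
  have t: "\<phi> n \<in> tests 0 pi" for n
    unfolding \<phi>_def[abs_def] by (rule stp_diff_tests) simp
  have d1: "(\<phi> n has_real_derivative \<phi>1 n s) (at s)" for n s
    unfolding \<phi>_def[abs_def] \<phi>1_def by (intro DERIV_diff stp_DERIV) auto
  have t1: "\<phi>1 n \<in> tests 0 pi" for n by (rule tests_deriv[OF t d1])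
  have weak: "(LINT z|lebesgue_on (Omega l). h z * tens (\<phi> n) \<psi> z) = (LINT s|lborel. slice u \<psi>' s * \<phi>1 n s)" for n
  proof -
    obtain \<phi>2 where d2: "\<And>x. (\<phi>1 n has_real_derivative \<phi>2 x) (at x)"
      using tests_obtain_deriv[OF t1] by blast
    show ?thesis
      using has_weak_deriv_test[OF h tens_test[OF t \<psi>], of n] tens_slice[OF t1 \<psi>1, of n]
      unfolding pderivs_tens_xy[OF d1 d2 \<psi>' \<psi>''] by simp
  qed
  have 1: "(\<lambda>n. LINT s|lborel. slice u \<psi>' s * \<phi>1 n s) \<longlonglongrightarrow> slice u \<psi>' 0 - slice u \<psi>' x"
  proof -
    have "(LINT s|lborel. slice u \<psi>' s * \<phi>1 n s) = (LINT s|lborel. slice u \<psi>' s * dlt 0 pi 0 n s)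
        - (LINT s|lborel. slice u \<psi>' s * dlt 0 pi x n s)" for n
      using slice_dlt_integrable[OF \<psi>1] by (simp add: \<phi>1_def right_diff_distrib)
    moreover have "(\<lambda>n. (LINT s|lborel. slice u \<psi>' s * dlt 0 pi 0 n s)
        - (LINT s|lborel. slice u \<psi>' s * dlt 0 pi x n s)) \<longlonglongrightarrow> slice u \<psi>' 0 - slice u \<psi>' x"
      using x by (intro tendsto_intros slice_dlt \<psi>1) auto
    ultimately show ?thesis by simp
  qed
  obtain B where B: "\<And>t. \<bar>\<psi> t\<bar> \<le> B" using tests_bounded[OF \<psi>] by blast
  have 2: "(\<lambda>n. LINT z|lebesgue_on (Omega l). h z * tens (\<phi> n) \<psi> z) \<longlonglongrightarrow>
      (LINT z|lebesgue_on (Omega l). h z * tens (\<lambda>s. heav 0 s - heav x s) \<psi> z)"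
  proof (rule tens_DCT[where A = 1 and B = B])
    show "integrable (lebesgue_on (Omega l)) h"
      using has_weak_deriv_L2(2)[OF h] by (rule Om.L2_integrable)
    show "\<phi> n \<in> borel_measurable borel" "\<psi> \<in> borel_measurable borel" for n
      using t \<psi> by (auto intro: tests_borel)
    fix s assume s: "s \<in> {0<..<pi}"
    show "\<bar>\<phi> n s\<bar> \<le> 1" for n unfolding \<phi>_def by (rule stp_diff_bound) simp
    show "(\<lambda>n. \<phi> n s) \<longlonglongrightarrow> heav 0 s - heav x s"
      unfolding \<phi>_def using x s by (intro tendsto_intros stp_heav) auto
  qed (use heav_borel B tests_borel[OF \<psi>] in auto)
  have "(LINT z|lebesgue_on (Omega l). h z * tens (\<lambda>s. heav 0 s - heav x s) \<psi> z) = slice u \<psi>' 0 - slice u \<psi>' x"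
    using LIMSEQ_unique[OF 2] 1 by (simp add: weak)
  then show ?thesis using slice_boundary[OF \<psi>1] by simp
qed

text \<open>Apply \<open>slice_heav\<close> with smoothed steps in y: the derivative of the test
  function is a difference of approximate masses at \<open>y1\<close> and \<open>y2\<close>.
  Continuity of u up to the boundary admits the edges y = -l and y = l.\<close>

lemma mixed_difference:
  assumes h: "has_weak_deriv (Omega l) [(1, 0), (0, 1)] u h"
    and x: "x \<in> {0..pi}" and y: "y1 \<in> {-l..l}" "y2 \<in> {-l..l}"
  shows "u (x, y1) - u (x, y2) =
    - (LINT z|lebesgue_on (Omega l). h z * tens (\<lambda>s. heav 0 s - heav x s) (\<lambda>t. heav y1 t - heav y2 t) z)"
proof -
  have ll: "-l < l" using l by simp
  define \<psi> where "\<psi> n t = stp (-l) l y1 n t - stp (-l) l y2 n t" for n t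
  define \<psi>1 where "\<psi>1 n t = dlt (-l) l y1 n t - dlt (-l) l y2 n t" for n t
  have t: "\<psi> n \<in> tests (-l) l" for n
    unfolding \<psi>_def[abs_def] by (rule stp_diff_tests[OF ll])
  have d1: "(\<psi> n has_real_derivative \<psi>1 n s) (at s)" for n s
    unfolding \<psi>_def[abs_def] \<psi>1_def by (intro DERIV_diff stp_DERIV ll)
  have eq: "slice u (\<psi>1 n) x = - (LINT z|lebesgue_on (Omega l). h z * tens (\<lambda>s. heav 0 s - heav x s) (\<psi> n) z)" for n
    by (rule slice_heav[OF h t d1 x])
  have cu: "continuous_on {-l..l} (\<lambda>t. u (x, t))"
    using x by (intro continuous_on_compose2[OF H2star_continuous]) (auto intro!: continuous_intros)
  have 1: "(\<lambda>n. slice u (\<psi>1 n) x) \<longlonglongrightarrow> u (x, y1) - u (x, y2)"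
  proof -
    have "slice u (\<psi>1 n) x = (LINT t|lborel. u (x, t) * dlt (-l) l y1 n t) - (LINT t|lborel. u (x, t) * dlt (-l) l y2 n t)" for n
      using continuous_dlt_integrable[OF ll cu] by (simp add: slice_def \<psi>1_def right_diff_distrib)
    moreover have "(\<lambda>n. (LINT t|lborel. u (x, t) * dlt (-l) l y1 n t) - (LINT t|lborel. u (x, t) * dlt (-l) l y2 n t))
      \<longlonglongrightarrow> u (x, y1) - u (x, y2)"
      by (intro tendsto_intros dlt_limit[OF ll cu] y)
    ultimately show ?thesis by simp
  qed
  have 2: "(\<lambda>n. LINT z|lebesgue_on (Omega l). h z * tens (\<lambda>s. heav 0 s - heav x s) (\<psi> n) z) \<longlonglongrightarrow>
      (LINT z|lebesgue_on (Omega l). h z * tens (\<lambda>s. heav 0 s - heav x s) (\<lambda>t. heav y1 t - heav y2 t) z)"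
  proof (rule tens_DCT[where A = 1 and B = 1])
    show "integrable (lebesgue_on (Omega l)) h"
      using has_weak_deriv_L2(2)[OF h] by (rule Om.L2_integrable)
    show "\<psi> n \<in> borel_measurable borel" for n
      using t by (auto intro: tests_borel)
    fix s assume s: "s \<in> {-l<..<l}"
    show "\<bar>\<psi> n s\<bar> \<le> 1" for n unfolding \<psi>_def by (rule stp_diff_bound[OF ll])
    show "(\<lambda>n. \<psi> n s) \<longlonglongrightarrow> heav y1 s - heav y2 s"
      unfolding \<psi>_def using s by (intro tendsto_intros stp_heav ll y) auto
  qed (auto intro!: heav_borel borel_measurable_diff simp: heav_def)
  show ?thesis
    using LIMSEQ_unique[OF 1] tendsto_minus[OF 2] by (simp add: eq)
qed

end

subsection \<open>Bounds by second derivatives\<close>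

lemma (in pair_sigma_finite) integrable_product_fun:
  fixes a :: "'a \<Rightarrow> real" and b :: "'b \<Rightarrow> real"
  assumes a: "integrable M1 a" and b: "integrable M2 b"
  shows "integrable (M1 \<Otimes>\<^sub>M M2) (\<lambda>z. a (fst z) * b (snd z))"
proof (rule Fubini_integrable)
  have [measurable]: "a \<in> borel_measurable M1" "b \<in> borel_measurable M2" using a b by auto
  show "(\<lambda>z. a (fst z) * b (snd z)) \<in> borel_measurable (M1 \<Otimes>\<^sub>M M2)" by measurable
  show "integrable M1 (\<lambda>x. LINT y|M2. norm (a (fst (x, y)) * b (snd (x, y))))"
    using a by (simp add: abs_mult)
  show "AE x in M1. integrable M2 (\<lambda>y. a (fst (x, y)) * b (snd (x, y)))"
    using b by simp
qed

text \<open>Fubini is used on the product of Borel-Lebesgue measures; for Borel functions supported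
  in the rectangle, completing that measure changes nothing.\<close>

lemma Omega_integral:
  fixes W :: "real \<times> real \<Rightarrow> real"
  assumes W: "W \<in> borel_measurable borel" and z: "\<And>z. z \<notin> Omega l \<Longrightarrow> W z = 0"
  shows "integrable (lebesgue_on (Omega l)) W \<longleftrightarrow> integrable (lborel \<Otimes>\<^sub>M lborel) W"
    and "(LINT z|lebesgue_on (Omega l). W z) = (LINT z|(lborel \<Otimes>\<^sub>M lborel). W z)"
proof -
  have eq: "(\<lambda>z. indicator (Omega l) z * W z) = W"
  proof
    fix z show "indicator (Omega l) z * W z = W z" using z[of z] by (cases "z \<in> Omega l") auto
  qed
  have W': "W \<in> borel_measurable lborel" using W by simp
  show "integrable (lebesgue_on (Omega l)) W \<longleftrightarrow> integrable (lborel \<Otimes>\<^sub>M lborel) W"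
    using integrable_completion[OF W'] by (simp add: integrable_restrict_space Omega_sets eq lborel_prod)
  show "(LINT z|lebesgue_on (Omega l). W z) = (LINT z|(lborel \<Otimes>\<^sub>M lborel). W z)"
    using integral_completion[OF W'] by (simp add: integral_restrict_space Omega_sets eq lborel_prod)
qed

lemma tests_integrable: assumes "\<phi> \<in> tests a b" shows "integrable lborel \<phi>"
proof -
  have "set_integrable lborel {a..b} \<phi>" by (intro borel_integrable_atLeastAtMost' tests_continuous[OF assms])
  moreover have "(\<lambda>x. indicator {a..b} x *\<^sub>R \<phi> x) = \<phi>"
  proof
    fix x show "indicator {a..b} x *\<^sub>R \<phi> x = \<phi> x"
      using tests_zero[OF assms, of x] by (cases "x \<in> {a..b}") auto
  qed
  ultimately show ?thesis by (simp add: set_integrable_def)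
qed

text \<open>Integration in the first variable against a bounded kernel k(x, s). It covers u_y from
  u_xy (kernel a Heaviside difference), u from - u_xx (Green's function) and u_x from u_xx (its
  derivative, up to sign).\<close>

locale bounded_kernel =
  fixes k :: "real \<Rightarrow> real \<Rightarrow> real" and C :: real
  assumes kernel_measurable[measurable]: "case_prod k \<in> borel_measurable (borel \<Otimes>\<^sub>M borel)"
    and kernel_bound: "\<And>x s. x \<in> {0<..<pi} \<Longrightarrow> s \<in> {0<..<pi} \<Longrightarrow> \<bar>k x s\<bar> \<le> C"
begin

lemma C_nonneg: "C \<ge> 0"
  using kernel_bound[of 1 1] pi_gt3 by auto

text \<open>The transposed operator applied to a test function; the weak identities determine the
  kernel operator only through it.\<close>

definition dual :: "(real \<Rightarrow> real) \<Rightarrow> real \<Rightarrow> real" where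
  "dual \<phi> s = (LINT x|lborel. k x s * \<phi> x)"

lemma dual_borel:
  assumes [measurable]: "\<phi> \<in> borel_measurable borel"
  shows "dual \<phi> \<in> borel_measurable borel"
  unfolding dual_def[abs_def] by measurable

lemma dual_bound:
  assumes \<phi>: "\<phi> \<in> tests 0 pi" and s: "s \<in> {0<..<pi}"
  shows "\<bar>dual \<phi> s\<bar> \<le> C * (LINT x|lborel. \<bar>\<phi> x\<bar>)"
proof -
  have "norm (LINT x|lborel. k x s * \<phi> x) \<le> (LINT x|lborel. C * \<bar>\<phi> x\<bar>)"
  proof (rule Bochner_Integration.integral_norm_bound_integral)
    show b: "norm (k x s * \<phi> x) \<le> C * \<bar>\<phi> x\<bar>" for x
      using kernel_bound[OF _ s, of x] tests_zero[OF \<phi>, of x]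
      by (cases "x \<in> {0<..<pi}") (auto simp: abs_mult intro!: mult_right_mono)
    show i: "integrable lborel (\<lambda>x. C * \<bar>\<phi> x\<bar>)" using tests_integrable[OF \<phi>] by simp
    have [measurable]: "\<phi> \<in> borel_measurable borel" by (rule tests_borel[OF \<phi>])
    show "integrable lborel (\<lambda>x. k x s * \<phi> x)"
      by (rule Bochner_Integration.integrable_bound[OF i]) (use b C_nonneg in \<open>auto simp: abs_mult\<close>)
  qed
  then show ?thesis by (simp add: dual_def)
qed

lemma integral_dual:
  assumes f: "integrable (lebesgue_on (Omega l)) f" and \<phi>: "\<phi> \<in> tests 0 pi" and \<psi>: "\<psi> \<in> tests (-l) l"
  shows "(LINT x|lborel. \<phi> x * (LINT z|lebesgue_on (Omega l). f z * tens (k x) \<psi> z)) =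
    (LINT z|lebesgue_on (Omega l). f z * tens (dual \<phi>) \<psi> z)"
proof -
  let ?M = "lebesgue_on (Omega l)"
  interpret P: pair_sigma_finite lborel ?M ..
  have [measurable]: "\<phi> \<in> borel_measurable borel" "\<psi> \<in> borel_measurable borel"
    using \<phi> \<psi> by (auto intro: tests_borel)
  have [measurable]: "f \<in> borel_measurable ?M" using f by auto
  have [measurable]: "fst \<in> borel_measurable ?M" "snd \<in> borel_measurable ?M"
    by (intro borel_lebesgue_on borel_measurable_continuous_onI continuous_on_fst continuous_on_snd continuous_on_id)+
  obtain B where B: "\<And>t. \<bar>\<psi> t\<bar> \<le> B" "B > 0" using tests_bounded[OF \<psi>] by blast
  let ?J = "\<lambda>x z. \<phi> x * (f z * tens (k x) \<psi> z)"
  have int: "integrable (lborel \<Otimes>\<^sub>M ?M) (case_prod ?J)"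
  proof (rule Bochner_Integration.integrable_bound)
    show "integrable (lborel \<Otimes>\<^sub>M ?M) (\<lambda>z :: real \<times> real \<times> real. \<phi> (fst z) * (C * B * f (snd z)))"
      by (rule P.integrable_product_fun) (use tests_integrable[OF \<phi>] f in auto)
    show "case_prod ?J \<in> borel_measurable (lborel \<Otimes>\<^sub>M ?M)"
      unfolding tens_def by measurable
    show "AE z in lborel \<Otimes>\<^sub>M ?M. norm (case_prod ?J z) \<le> norm (\<phi> (fst z) * (C * B * f (snd z)))"
    proof (rule AE_I2)
      fix z :: "real \<times> real \<times> real" assume "z \<in> space (lborel \<Otimes>\<^sub>M ?M)"
      then have s: "fst (snd z) \<in> {0<..<pi}" by (auto simp: space_pair_measure Omega_def)
      have "\<bar>\<phi> (fst z)\<bar> * (\<bar>f (snd z)\<bar> * (\<bar>k (fst z) (fst (snd z))\<bar> * \<bar>\<psi> (snd (snd z))\<bar>)) \<le>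
        \<bar>\<phi> (fst z)\<bar> * (\<bar>f (snd z)\<bar> * (C * B))"
      proof (cases "fst z \<in> {0<..<pi}")
        case True
        show ?thesis by (intro mult_left_mono mult_mono kernel_bound True s B C_nonneg) auto
      qed (simp add: tests_zero[OF \<phi>])
      then show "norm (case_prod ?J z) \<le> norm (\<phi> (fst z) * (C * B * f (snd z)))"
        using C_nonneg B(2) by (simp add: case_prod_beta abs_mult tens_def mult_ac)
    qed
  qed
  have "(LINT x|lborel. \<phi> x * (LINT z|?M. f z * tens (k x) \<psi> z)) = (LINT x|lborel. (LINT z|?M. ?J x z))"
    by simp
  also have "\<dots> = (LINT z|?M. (LINT x|lborel. ?J x z))"
    using P.Fubini_integral[OF int] by simp
  also have "\<dots> = (LINT z|?M. f z * tens (dual \<phi>) \<psi> z)"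
  proof (rule Bochner_Integration.integral_cong[OF refl])
    fix z
    have "(LINT x|lborel. ?J x z) = (LINT x|lborel. (f z * \<psi> (snd z)) * (k x (fst z) * \<phi> x))"
      by (simp add: tens_def mult_ac)
    then show "(LINT x|lborel. ?J x z) = f z * tens (dual \<phi>) \<psi> z"
      by (simp add: tens_def dual_def)
  qed
  finally show ?thesis .
qed

text \<open>Cauchy-Schwarz on an interval of length \<pi>, carried out in the extended nonnegative
  reals because an individual slice of F need not be square integrable.\<close>

lemma kernel_operator_nn_bound:
  fixes F :: "real \<times> real \<Rightarrow> real"
  assumes F[measurable]: "F \<in> borel_measurable (borel \<Otimes>\<^sub>M borel)" and F0: "\<And>s t. s \<notin> {0<..<pi} \<Longrightarrow> F (s, t) = 0"
    and x: "x \<in> {0<..<pi}"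
  shows "ennreal ((LINT s|lborel. k x s * F (s, t))\<^sup>2) \<le> ennreal (C\<^sup>2 * pi) * (\<integral>\<^sup>+s. ennreal ((F (s, t))\<^sup>2) \<partial>lborel)"
proof -
  let ?I = "\<integral>\<^sup>+s. ennreal \<bar>k x s * F (s, t)\<bar> \<partial>lborel"
  have "ennreal \<bar>LINT s|lborel. k x s * F (s, t)\<bar> \<le> ?I"
  proof (cases "integrable lborel (\<lambda>s. k x s * F (s, t))")
    case True
    from integral_norm_bound_ennreal[OF this] show ?thesis by simp
  \<comment> \<open>A slice that is not integrable has integral 0 by convention, so the bound
    persists.\<close>
  qed (simp add: not_integrable_integral_eq)
  then have "(ennreal \<bar>LINT s|lborel. k x s * F (s, t)\<bar>)\<^sup>2 \<le> ?I\<^sup>2" by (rule power_mono) simp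
  then have "ennreal ((LINT s|lborel. k x s * F (s, t))\<^sup>2) \<le> ?I\<^sup>2"
    by (simp add: ennreal_power)
  also have "?I \<le> (\<integral>\<^sup>+s. ennreal (C * indicator {0<..<pi} s) * ennreal \<bar>F (s, t)\<bar> \<partial>lborel)"
  proof (rule nn_integral_mono)
    fix s
    have "\<bar>k x s * F (s, t)\<bar> \<le> C * indicator {0<..<pi} s * \<bar>F (s, t)\<bar>"
      using kernel_bound[OF x, of s] F0[of s t]
      by (cases "s \<in> {0<..<pi}") (auto simp: abs_mult intro!: mult_right_mono)
    then show "ennreal \<bar>k x s * F (s, t)\<bar> \<le> ennreal (C * indicator {0<..<pi} s) * ennreal \<bar>F (s, t)\<bar>"
      using C_nonneg by (simp add: ennreal_mult[symmetric] ennreal_leI)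
  qed
  then have "?I\<^sup>2 \<le> (\<integral>\<^sup>+s. ennreal (C * indicator {0<..<pi} s) * ennreal \<bar>F (s, t)\<bar> \<partial>lborel)\<^sup>2"
    by (rule power_mono) simp
  also have "\<dots> \<le> (\<integral>\<^sup>+s. (ennreal (C * indicator {0<..<pi} s))\<^sup>2 \<partial>lborel) * (\<integral>\<^sup>+s. (ennreal \<bar>F (s, t)\<bar>)\<^sup>2 \<partial>lborel)"
    by (rule Cauchy_Schwarz_nn_integral) measurable
  also have "(\<integral>\<^sup>+s. (ennreal (C * indicator {0<..<pi} s))\<^sup>2 \<partial>lborel) = (\<integral>\<^sup>+s. ennreal (C\<^sup>2) * indicator {0<..<pi} s \<partial>lborel)"
    using C_nonneg by (intro nn_integral_cong) (auto simp: indicator_def ennreal_power)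
  also have "\<dots> = ennreal (C\<^sup>2) * ennreal pi" by (simp add: nn_integral_cmult_indicator)
  also have "\<dots> = ennreal (C\<^sup>2 * pi)" by (simp add: ennreal_mult)
  also have "(\<integral>\<^sup>+s. (ennreal \<bar>F (s, t)\<bar>)\<^sup>2 \<partial>lborel) = (\<integral>\<^sup>+s. ennreal ((F (s, t))\<^sup>2) \<partial>lborel)"
    by (simp add: ennreal_power)
  finally show ?thesis by simp
qed

text \<open>If \<open>g\<close> is obtained from \<open>f\<close> by integrating against the kernel in the first variable, tested weakly,
  then \<open>g\<close> coincides with that integral almost everywhere.\<close>

lemma kernel_L2_bound:
  assumes l: "l > 0" and f: "f \<in> L2 (lebesgue_on (Omega l))" and g: "g \<in> L2 (lebesgue_on (Omega l))"
    and eq: "\<And>\<phi> \<psi>. \<phi> \<in> tests 0 pi \<Longrightarrow> \<psi> \<in> tests (-l) l \<Longrightarrow>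
      (LINT z|lebesgue_on (Omega l). g z * tens \<phi> \<psi> z) = (LINT z|lebesgue_on (Omega l). f z * tens (dual \<phi>) \<psi> z)"
  shows "(LINT z|lebesgue_on (Omega l). (g z)\<^sup>2) \<le> (C * pi)\<^sup>2 * (LINT z|lebesgue_on (Omega l). (f z)\<^sup>2)"
proof -
  let ?M = "lebesgue_on (Omega l)" and ?P = "lborel \<Otimes>\<^sub>M lborel :: (real \<times> real) measure"
  \<comment> \<open>f is only Lebesgue measurable; it is replaced by a Borel function F, equal to f
    almost everywhere on the rectangle and zero outside, so that slices and Fubini are
    available.\<close>
  have fm: "(\<lambda>z. indicator (Omega l) z *\<^sub>R f z) \<in> borel_measurable lebesgue"
    using L2_measurable[OF f] Omega_sets by (simp add: borel_measurable_restrict_space_iff)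
  obtain f' where f': "f' \<in> borel_measurable lborel" "AE z in lborel. indicator (Omega l) z *\<^sub>R f z = f' z"
    using completion_ex_borel_measurable_real[OF fm] by blast
  define F where "F z = indicator (Omega l) z * f' z" for z
  have Fb: "F \<in> borel_measurable borel"
    unfolding F_def using f'(1) Omega_open by (intro borel_measurable_times borel_measurable_indicator) auto
  then have Fm[measurable]: "F \<in> borel_measurable (borel \<Otimes>\<^sub>M borel)" by (simp add: borel_prod)
  have F0: "F z = 0" if "z \<notin> Omega l" for z using that by (simp add: F_def)
  have F0': "F (s, t) = 0" if "s \<notin> {0<..<pi}" for s t using that by (intro F0) (auto simp: Omega_def)
  have Ff: "AE z in ?M. f z = F z"
  proof -
    have "AE z in lebesgue. indicator (Omega l) z *\<^sub>R f z = f' z"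
      using f'(2) by (rule AE_completion)
    then have "AE z in lebesgue. z \<in> Omega l \<longrightarrow> f z = F z" by eventually_elim (auto simp: F_def)
    then show ?thesis using Omega_sets by (simp add: AE_restrict_space_iff)
  qed
  have fM[measurable]: "f \<in> borel_measurable ?M" "g \<in> borel_measurable ?M" using f g by (auto simp: L2_def)
  have FM[measurable]: "F \<in> borel_measurable ?M" by (rule borel_lebesgue_on[OF Fb])
  have F2: "integrable ?M (\<lambda>z. (F z)\<^sup>2)"
    by (rule integrable_cong_AE_imp[OF L2_square[OF f]]) (use Ff in auto)
  then have FL2: "F \<in> L2 ?M" by (simp add: L2_def)
  have F2b: "(\<lambda>z. (F z)\<^sup>2) \<in> borel_measurable borel" using Fb by simp
  have F2P: "integrable ?P (\<lambda>z. (F z)\<^sup>2)"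
    using F2 Omega_integral(1)[OF F2b] F0 by simp
  have F1P: "integrable ?P F"
    using Om.L2_integrable[OF FL2] Omega_integral(1)[OF Fb F0] by simp
  \<comment> \<open>The candidate for g: the kernel operator applied slice by slice.\<close>
  define H where "H z = indicator (Omega l) z * (LINT s|lborel. k (fst z) s * F (s, snd z))" for z
  have Hm[measurable]: "H \<in> borel_measurable (borel \<Otimes>\<^sub>M borel)"
  proof -
    have "(\<lambda>z. LINT s|lborel. k (fst z) s * F (s, snd z)) \<in> borel_measurable (borel \<Otimes>\<^sub>M borel)"
      by measurable
    moreover have "indicator (Omega l) \<in> borel_measurable (borel :: (real \<times> real) measure)"
      using Omega_open by (intro borel_measurable_indicator) auto
    ultimately show ?thesis unfolding H_def by (intro borel_measurable_times) (simp_all add: borel_prod)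
  qed
  then have Hb: "H \<in> borel_measurable borel" by (simp add: borel_prod)
  have H0: "H z = 0" if "z \<notin> Omega l" for z using that by (simp add: H_def)
  have nnH: "(\<integral>\<^sup>+z. ennreal ((H z)\<^sup>2) \<partial>?P) \<le> ennreal ((C * pi)\<^sup>2) * (\<integral>\<^sup>+z. ennreal ((F z)\<^sup>2) \<partial>?P)"
  proof -
    let ?n = "\<lambda>t. \<integral>\<^sup>+s. ennreal ((F (s, t))\<^sup>2) \<partial>lborel"
    \<comment> \<open>The bound does not depend on x, so integrating it over x contributes a second
      factor \<pi>; this is the origin of (C \<pi>) squared.\<close>
    have pt: "ennreal ((H (x, t))\<^sup>2) \<le> ennreal (C\<^sup>2 * pi) * ?n t * indicator {0<..<pi} x" for x t
    proof (cases "x \<in> {0<..<pi}")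
      case True
      have "ennreal ((H (x, t))\<^sup>2) \<le> ennreal ((LINT s|lborel. k x s * F (s, t))\<^sup>2)"
        by (auto simp: H_def indicator_def intro!: ennreal_leI)
      also have "\<dots> \<le> ennreal (C\<^sup>2 * pi) * ?n t" by (rule kernel_operator_nn_bound[OF Fm F0' True])
      finally show ?thesis using True by simp
    next
      case False
      then have "H (x, t) = 0" by (intro H0) (auto simp: Omega_def)
      then show ?thesis by simp
    qed
    have "(\<integral>\<^sup>+z. ennreal ((H z)\<^sup>2) \<partial>?P) = (\<integral>\<^sup>+t. \<integral>\<^sup>+x. ennreal ((H (x, t))\<^sup>2) \<partial>lborel \<partial>lborel)"
      by (rule lborel_pair.nn_integral_snd[symmetric]) measurable
    also have "\<dots> \<le> (\<integral>\<^sup>+t. \<integral>\<^sup>+x. ennreal (C\<^sup>2 * pi) * ?n t * indicator {0<..<pi} x \<partial>lborel \<partial>lborel)"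
      by (intro nn_integral_mono pt)
    also have "\<dots> = (\<integral>\<^sup>+t. ennreal (C\<^sup>2 * pi) * ?n t * ennreal pi \<partial>lborel)"
      by (simp add: nn_integral_cmult_indicator)
    also have "\<dots> = (\<integral>\<^sup>+t. ennreal ((C * pi)\<^sup>2) * ?n t \<partial>lborel)"
    proof (rule nn_integral_cong)
      fix t
      have "ennreal (C\<^sup>2 * pi) * ?n t * ennreal pi = (ennreal (C\<^sup>2 * pi) * ennreal pi) * ?n t" by (simp add: mult_ac)
      also have "ennreal (C\<^sup>2 * pi) * ennreal pi = ennreal ((C * pi)\<^sup>2)"
        using C_nonneg by (subst ennreal_mult[symmetric]) (auto simp: power2_eq_square mult_ac)
      finally show "ennreal (C\<^sup>2 * pi) * ?n t * ennreal pi = ennreal ((C * pi)\<^sup>2) * ?n t" .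
    qed
    also have "\<dots> = ennreal ((C * pi)\<^sup>2) * (\<integral>\<^sup>+t. ?n t \<partial>lborel)"
      by (rule nn_integral_cmult) measurable
    also have "(\<integral>\<^sup>+t. ?n t \<partial>lborel) = (\<integral>\<^sup>+z. ennreal ((F z)\<^sup>2) \<partial>?P)"
      by (rule lborel_pair.nn_integral_snd) measurable
    finally show ?thesis .
  qed
  also have "(\<integral>\<^sup>+z. ennreal ((F z)\<^sup>2) \<partial>?P) = ennreal (LINT z|?P. (F z)\<^sup>2)"
    using F2P by (subst nn_integral_eq_integral) auto
  finally have nnH': "(\<integral>\<^sup>+z. ennreal ((H z)\<^sup>2) \<partial>?P) \<le> ennreal ((C * pi)\<^sup>2 * (LINT z|?P. (F z)\<^sup>2))"
    by (simp add: ennreal_mult)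
  have H2P: "integrable ?P (\<lambda>z. (H z)\<^sup>2)"
  proof (rule integrableI_bounded)
    show "(\<integral>\<^sup>+z. ennreal (norm ((H z)\<^sup>2)) \<partial>?P) < \<infinity>"
      using le_less_trans[OF nnH' ennreal_less_top] by simp
  qed measurable
  have H2: "(LINT z|?P. (H z)\<^sup>2) \<le> (C * pi)\<^sup>2 * (LINT z|?P. (F z)\<^sup>2)"
    using nnH' by (subst (asm) nn_integral_eq_integral[OF H2P]) (auto simp: ennreal_le_iff)
  have H2b: "(\<lambda>z. (H z)\<^sup>2) \<in> borel_measurable borel" using Hb by simp
  have HM[measurable]: "H \<in> borel_measurable ?M" by (rule borel_lebesgue_on[OF Hb])
  have HL2: "H \<in> L2 ?M"
    using H2P Omega_integral(1)[OF H2b] H0 by (simp add: L2_def)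
  have H1P: "integrable ?P H"
    using Om.L2_integrable[OF HL2] Omega_integral(1)[OF Hb H0] by simp
  have gH: "(LINT z|?M. H z * tens \<phi> \<psi> z) = (LINT z|?M. g z * tens \<phi> \<psi> z)"
    if \<phi>: "\<phi> \<in> tests 0 pi" and \<psi>: "\<psi> \<in> tests (-l) l" for \<phi> \<psi>
  proof -
    have [measurable]: "\<phi> \<in> borel_measurable borel" "\<psi> \<in> borel_measurable borel"
      using \<phi> \<psi> by (auto intro: tests_borel)
    have db[measurable]: "dual \<phi> \<in> borel_measurable borel" by (rule dual_borel) measurable
    obtain A where A: "\<And>t. \<bar>\<phi> t\<bar> \<le> A" "A > 0" using tests_bounded[OF \<phi>] by blast
    obtain B where B: "\<And>t. \<bar>\<psi> t\<bar> \<le> B" "B > 0" using tests_bounded[OF \<psi>] by blast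
    have b1: "(\<lambda>z. H z * tens \<phi> \<psi> z) \<in> borel_measurable borel" "(\<lambda>z. F z * tens (dual \<phi>) \<psi> z) \<in> borel_measurable borel"
      by (intro borel_measurable_times Hb Fb tens_borel; measurable)+
    have i1: "integrable ?P (\<lambda>z. H z * tens \<phi> \<psi> z)"
      using Omega_integral(1)[OF b1(1), of l] H0 tens_integrable[OF Om.L2_integrable[OF HL2], of \<phi> \<psi> A B] A B by simp
    have i2: "integrable ?P (\<lambda>z. F z * tens (dual \<phi>) \<psi> z)"
      using Omega_integral(1)[OF b1(2), of l] F0 dual_bound[OF \<phi>]
       tens_integrable[OF Om.L2_integrable[OF FL2], of "dual \<phi>" \<psi> "C * (LINT x|lborel. \<bar>\<phi> x\<bar>)" B] B by simp
    have Fub: "(LINT t|lborel. LINT x|lborel. W (x, t)) = (LINT z|?P. W z)" if "integrable ?P W" for W :: "real \<times> real \<Rightarrow> real"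
      using lborel_pair.integral_snd[of "\<lambda>x t. W (x, t)"] that by (simp only: case_prod_eta)
    \<comment> \<open>Moving the kernel onto \<phi> needs an integrable slice, which Fubini grants
      for almost every t; that is enough under the outer integral.\<close>
    have slice_eq: "(LINT x|lborel. H (x, t) * tens \<phi> \<psi> (x, t)) = (LINT s|lborel. F (s, t) * tens (dual \<phi>) \<psi> (s, t))"
      if Ft: "integrable lborel (\<lambda>s. F (s, t))" for t
    proof (cases "t \<in> {-l<..<l}")
      case False
      then show ?thesis using tests_zero[OF \<psi>, of t] by (simp add: tens_def)
    next
      case True
      let ?J = "\<lambda>x s. \<phi> x * (k x s * F (s, t))"
      have int: "integrable ?P (case_prod ?J)"
      proof (rule Bochner_Integration.integrable_bound)
        show "integrable ?P (\<lambda>z. \<phi> (fst z) * (C * F (snd z, t)))"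
          by (rule lborel_pair.integrable_product_fun) (use tests_integrable[OF \<phi>] Ft in auto)
        show "case_prod ?J \<in> borel_measurable ?P" by measurable
        show "AE z in ?P. norm (case_prod ?J z) \<le> norm (\<phi> (fst z) * (C * F (snd z, t)))"
        proof (rule AE_I2)
          fix z :: "real \<times> real"
          have "\<bar>\<phi> (fst z)\<bar> * (\<bar>k (fst z) (snd z)\<bar> * \<bar>F (snd z, t)\<bar>) \<le> \<bar>\<phi> (fst z)\<bar> * (C * \<bar>F (snd z, t)\<bar>)"
          proof (cases "fst z \<in> {0<..<pi} \<and> snd z \<in> {0<..<pi}")
            case True
            then show ?thesis by (intro mult_left_mono mult_right_mono kernel_bound) auto
          next
            case False
            then show ?thesis using tests_zero[OF \<phi>, of "fst z"] F0'[of "snd z" t] by auto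
          qed
          then show "norm (case_prod ?J z) \<le> norm (\<phi> (fst z) * (C * F (snd z, t)))"
            using C_nonneg by (simp add: case_prod_beta abs_mult)
        qed
      qed
      have "(LINT x|lborel. H (x, t) * tens \<phi> \<psi> (x, t)) = (LINT x|lborel. \<psi> t * (LINT s|lborel. ?J x s))"
      proof (rule Bochner_Integration.integral_cong[OF refl])
        fix x
        show "H (x, t) * tens \<phi> \<psi> (x, t) = \<psi> t * (LINT s|lborel. ?J x s)"
          using tests_zero[OF \<phi>, of x] True
          by (cases "x \<in> {0<..<pi}") (auto simp: H_def tens_def Omega_def)
      qed
      also have "\<dots> = \<psi> t * (LINT x|lborel. (LINT s|lborel. ?J x s))" by simp
      also have "(LINT x|lborel. (LINT s|lborel. ?J x s)) = (LINT s|lborel. (LINT x|lborel. ?J x s))"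
        using lborel_pair.Fubini_integral[OF int] by simp
      also have "\<psi> t * \<dots> = (LINT s|lborel. \<psi> t * (LINT x|lborel. ?J x s))" by simp
      also have "\<dots> = (LINT s|lborel. F (s, t) * tens (dual \<phi>) \<psi> (s, t))"
      proof (rule Bochner_Integration.integral_cong[OF refl])
        fix s
        have "(LINT x|lborel. ?J x s) = (LINT x|lborel. F (s, t) * (k x s * \<phi> x))" by (simp add: mult_ac)
        then show "\<psi> t * (LINT x|lborel. ?J x s) = F (s, t) * tens (dual \<phi>) \<psi> (s, t)"
          by (simp add: tens_def dual_def)
      qed
      finally show ?thesis .
    qed
    have "(LINT z|?M. H z * tens \<phi> \<psi> z) = (LINT z|?P. H z * tens \<phi> \<psi> z)"
      by (rule Omega_integral(2)[OF b1(1)]) (simp add: H0)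
    also have "\<dots> = (LINT t|lborel. LINT x|lborel. H (x, t) * tens \<phi> \<psi> (x, t))"
      by (rule Fub[OF i1, symmetric])
    also have "\<dots> = (LINT t|lborel. LINT s|lborel. F (s, t) * tens (dual \<phi>) \<psi> (s, t))"
    proof (rule integral_cong_AE)
      have "AE t in lborel. integrable lborel (\<lambda>s. F (s, t))"
        using lborel_pair.AE_integrable_snd[of "\<lambda>s t. F (s, t)"] F1P by (simp add: case_prod_beta)
      then show "AE t in lborel. (LINT x|lborel. H (x, t) * tens \<phi> \<psi> (x, t)) = (LINT s|lborel. F (s, t) * tens (dual \<phi>) \<psi> (s, t))"
        by eventually_elim (rule slice_eq)
    qed (unfold tens_def, measurable)
    also have "\<dots> = (LINT z|?P. F z * tens (dual \<phi>) \<psi> z)"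
      by (rule Fub[OF i2])
    also have "\<dots> = (LINT z|?M. F z * tens (dual \<phi>) \<psi> z)"
      by (rule Omega_integral(2)[OF b1(2), symmetric]) (simp add: F0)
    also have "\<dots> = (LINT z|?M. f z * tens (dual \<phi>) \<psi> z)"
      using Ff borel_lebesgue_on[OF tens_borel[OF db, of \<psi>]] by (intro integral_cong_AE) auto
    also have "\<dots> = (LINT z|?M. g z * tens \<phi> \<psi> z)" by (rule eq[OF \<phi> \<psi>, symmetric])
    finally show ?thesis .
  qed
  \<comment> \<open>g and H have the same integrals against all product tests, so the norm bound for
    H passes to g.\<close>
  have "AE z in ?M. g z - H z = 0"
  proof (rule tens_zero_imp_AE_zero[OF l])
    show "integrable ?M (\<lambda>z. g z - H z)" by (intro Om.L2_integrable L2_diff g HL2)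
    fix \<phi> \<psi> assume t: "\<phi> \<in> tests 0 pi" "\<psi> \<in> tests (-l) l"
    note tL = test_L2[OF Omega_lmeasurable tens_test[OF t]]
    show "(LINT z|?M. (g z - H z) * tens \<phi> \<psi> z) = 0"
      using L2_mult[OF g tL] L2_mult[OF HL2 tL] gH[OF t] by (simp add: left_diff_distrib)
  qed
  then have "(LINT z|?M. (g z)\<^sup>2) = (LINT z|?M. (H z)\<^sup>2)"
    by (intro integral_cong_AE) auto
  also have "\<dots> = (LINT z|?P. (H z)\<^sup>2)" by (rule Omega_integral(2)[OF H2b]) (simp add: H0)
  also have "\<dots> \<le> (C * pi)\<^sup>2 * (LINT z|?P. (F z)\<^sup>2)" by (rule H2)
  also have "(LINT z|?P. (F z)\<^sup>2) = (LINT z|?M. (F z)\<^sup>2)"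
    by (rule Omega_integral(2)[OF F2b, symmetric]) (simp add: F0)
  also have "\<dots> = (LINT z|?M. (f z)\<^sup>2)" using Ff by (intro integral_cong_AE) auto
  finally show ?thesis .
qed

end

subsection \<open>The energy space\<close>

text \<open>A reference energy independent of \<sigma> and of the weight. All pointwise and weak
  bounds refer to it, and \<open>wform_bounds\<close> compares it with the plate forms.\<close>

definition hess :: "real \<Rightarrow> (real \<times> real \<Rightarrow> real) \<Rightarrow> real" where
  "hess l u = (LINT z|lebesgue_on (Omega l). (uxx l u z)\<^sup>2) + (LINT z|lebesgue_on (Omega l). (uxy l u z)\<^sup>2)
    + (LINT z|lebesgue_on (Omega l). (uyy l u z)\<^sup>2)"

lemma hess_nonneg: "0 \<le> hess l u"
  by (simp add: hess_def)

lemma hess_ge: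
  "(LINT z|lebesgue_on (Omega l). (uxx l u z)\<^sup>2) \<le> hess l u"
  "(LINT z|lebesgue_on (Omega l). (uxy l u z)\<^sup>2) \<le> hess l u"
  "(LINT z|lebesgue_on (Omega l). (uyy l u z)\<^sup>2) \<le> hess l u"
  by (simp_all add: hess_def)

lemma weak_deriv_has:
  assumes "u \<in> H2star l" "set bs \<subseteq> Basis" "length bs \<le> 2"
  shows "has_weak_deriv (Omega l) bs u (weak_deriv (Omega l) bs u)"
proof -
  have "\<exists>g. has_weak_deriv (Omega l) bs u g" using assms unfolding H2star_def H2_def by blast
  then show ?thesis unfolding weak_deriv_def by (rule someI_ex)
qed

lemma second_weak:
  assumes "u \<in> H2star l"
  shows uxx_weak: "has_weak_deriv (Omega l) [(1, 0), (1, 0)] u (uxx l u)"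
    and uxy_weak: "has_weak_deriv (Omega l) [(1, 0), (0, 1)] u (uxy l u)"
    and uyy_weak: "has_weak_deriv (Omega l) [(0, 1), (0, 1)] u (uyy l u)"
  unfolding uxx_def uxy_def uyy_def using assms by (auto intro!: weak_deriv_has simp: Basis_real_prod)

lemma second_L2:
  assumes "u \<in> H2star l"
  shows uxx_L2: "uxx l u \<in> L2 (lebesgue_on (Omega l))"
    and uxy_L2: "uxy l u \<in> L2 (lebesgue_on (Omega l))"
    and uyy_L2: "uyy l u \<in> L2 (lebesgue_on (Omega l))"
  using second_weak[OF assms] has_weak_deriv_L2 by blast+

lemma H2star_lincomb:
  assumes "l > 0" "u \<in> H2star l" "v \<in> H2star l"
  shows "(\<lambda>z. a * u z + b * v z) \<in> H2star l"
proof -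
  have "\<exists>g. has_weak_deriv (Omega l) bs (\<lambda>z. a * u z + b * v z) g" if "set bs \<subseteq> Basis" "length bs \<le> 2" for bs
    using has_weak_deriv_lincomb[OF Omega_lmeasurable that(1) weak_deriv_has[OF assms(2) that] weak_deriv_has[OF assms(3) that]]
    by blast
  moreover have "(\<lambda>z. a * u z + b * v z) \<in> Lp_space (lebesgue_on (Omega l)) 2"
    using assms unfolding H2star_def H2_def Lp_space_2 by (auto intro: L2_add L2_cmult)
  moreover have "continuous_on (closure (Omega l)) (\<lambda>z. a * u z + b * v z)"
    using assms unfolding H2star_def by (intro continuous_intros) auto
  ultimately show ?thesis using assms(2,3) unfolding H2star_def H2_def by auto
qed

lemma H2star_cmult: "l > 0 \<Longrightarrow> u \<in> H2star l \<Longrightarrow> (\<lambda>z. c * u z) \<in> H2star l"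
  using H2star_lincomb[of l u u c 0] by simp

lemma H2star_diff: "l > 0 \<Longrightarrow> u \<in> H2star l \<Longrightarrow> v \<in> H2star l \<Longrightarrow> (\<lambda>z. u z - v z) \<in> H2star l"
  using H2star_lincomb[of l u v 1 "-1"] by simp

text \<open>Each \<open>weak_deriv\<close> is an arbitrary choice in its class, so linearity comes
  from uniqueness and holds only off a null set.\<close>

lemma second_lincomb:
  assumes l: "l > 0" and "u \<in> H2star l" "v \<in> H2star l"
  shows "AE z in lebesgue_on (Omega l).
     uxx l (\<lambda>z. a * u z + b * v z) z = a * uxx l u z + b * uxx l v z \<and>
     uxy l (\<lambda>z. a * u z + b * v z) z = a * uxy l u z + b * uxy l v z \<and>
     uyy l (\<lambda>z. a * u z + b * v z) z = a * uyy l u z + b * uyy l v z"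
proof -
  note H = H2star_lincomb[OF assms, of a b]
  have "AE z in lebesgue_on (Omega l). uxx l (\<lambda>z. a * u z + b * v z) z = a * uxx l u z + b * uxx l v z"
    by (rule has_weak_deriv_unique[OF l uxx_weak[OF H] has_weak_deriv_lincomb[OF Omega_lmeasurable _ uxx_weak uxx_weak]])
      (use assms in \<open>auto simp: Basis_real_prod\<close>)
  moreover have "AE z in lebesgue_on (Omega l). uxy l (\<lambda>z. a * u z + b * v z) z = a * uxy l u z + b * uxy l v z"
    by (rule has_weak_deriv_unique[OF l uxy_weak[OF H] has_weak_deriv_lincomb[OF Omega_lmeasurable _ uxy_weak uxy_weak]])
      (use assms in \<open>auto simp: Basis_real_prod\<close>)
  moreover have "AE z in lebesgue_on (Omega l). uyy l (\<lambda>z. a * u z + b * v z) z = a * uyy l u z + b * uyy l v z"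
    by (rule has_weak_deriv_unique[OF l uyy_weak[OF H] has_weak_deriv_lincomb[OF Omega_lmeasurable _ uyy_weak uyy_weak]])
      (use assms in \<open>auto simp: Basis_real_prod\<close>)
  ultimately show ?thesis by eventually_elim auto
qed

text \<open>Membership in \<open>H2\<close> involves both orders of the mixed derivative, while
  \<open>hess\<close> contains one. On product tests both orders give the same classical derivative,
  and these tests separate.\<close>

lemma mixed_symmetric:
  assumes l: "l > 0" and g: "has_weak_deriv (Omega l) [(0, 1), (1, 0)] u g"
    and h: "has_weak_deriv (Omega l) [(1, 0), (0, 1)] u h"
  shows "AE z in lebesgue_on (Omega l). g z = h z"
proof -
  note L = has_weak_deriv_L2(2)[OF g] has_weak_deriv_L2(2)[OF h]
  have "AE z in lebesgue_on (Omega l). g z - h z = 0"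
  proof (rule tens_zero_imp_AE_zero[OF l])
    show "integrable (lebesgue_on (Omega l)) (\<lambda>z. g z - h z)"
      by (intro Om.L2_integrable L2_diff L)
    fix \<phi> \<psi> assume p: "\<phi> \<in> tests 0 pi" "\<psi> \<in> tests (-l) l"
    then have t: "tens \<phi> \<psi> \<in> test_functions (Omega l)" by (rule tens_test)
    note tL = test_L2[OF Omega_lmeasurable t]
    obtain \<phi>' where \<phi>': "\<And>x. (\<phi> has_real_derivative \<phi>' x) (at x)" "\<phi>' \<in> tests 0 pi" using tests_obtain_deriv[OF p(1)] by blast
    obtain \<phi>'' where \<phi>'': "\<And>x. (\<phi>' has_real_derivative \<phi>'' x) (at x)" using tests_obtain_deriv[OF \<phi>'(2)] by blast
    obtain \<psi>' where \<psi>': "\<And>x. (\<psi> has_real_derivative \<psi>' x) (at x)" "\<psi>' \<in> tests (-l) l" using tests_obtain_deriv[OF p(2)] by blast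
    obtain \<psi>'' where \<psi>'': "\<And>x. (\<psi>' has_real_derivative \<psi>'' x) (at x)" using tests_obtain_deriv[OF \<psi>'(2)] by blast
    have "(LINT z|lebesgue_on (Omega l). (g z - h z) * tens \<phi> \<psi> z) =
        (LINT z|lebesgue_on (Omega l). g z * tens \<phi> \<psi> z) - (LINT z|lebesgue_on (Omega l). h z * tens \<phi> \<psi> z)"
      using L2_mult[OF L(1) tL] L2_mult[OF L(2) tL] by (simp add: left_diff_distrib)
    also have "\<dots> = 0"
      using has_weak_deriv_test[OF g t] has_weak_deriv_test[OF h t]
      unfolding pderivs_tens_xy[OF \<phi>'(1) \<phi>'' \<psi>'(1) \<psi>''] pderivs_tens_yx[OF \<phi>'(1) \<phi>'' \<psi>'(1) \<psi>''] by simp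
    finally show "(LINT z|lebesgue_on (Omega l). (g z - h z) * tens \<phi> \<psi> z) = 0" .
  qed
  then show ?thesis by simp
qed

section \<open>First derivatives controlled by second derivatives\<close>

interpretation heav_kernel: bounded_kernel "\<lambda>x s. heav 0 s - heav x s" 1
proof
  show "(\<lambda>(x, s). heav 0 s - heav x s) \<in> borel_measurable (borel \<Otimes>\<^sub>M borel)"
    unfolding heav_def by measurable
qed (auto simp: heav_def)

text \<open>Moving the y-derivative onto the test function turns g into slices of u, and
  \<open>slice_heav\<close> expresses those by u_xy. So g is the Heaviside kernel operator applied
  to u_xy.\<close>

lemma weak_y_bound:
  assumes l: "l > 0" and u: "u \<in> H2star l" and g: "has_weak_deriv (Omega l) [(0, 1)] u g"
  shows "(LINT z|lebesgue_on (Omega l). (g z)\<^sup>2) \<le> pi\<^sup>2 * hess l u"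
proof -
  note h = uxy_weak[OF u]
  have "(LINT z|lebesgue_on (Omega l). (g z)\<^sup>2) \<le> (1 * pi)\<^sup>2 * (LINT z|lebesgue_on (Omega l). (uxy l u z)\<^sup>2)"
  proof (rule heav_kernel.kernel_L2_bound[OF l uxy_L2[OF u] has_weak_deriv_L2(2)[OF g]])
    fix \<phi> \<psi> assume p: "\<phi> \<in> tests 0 pi" "\<psi> \<in> tests (-l) l"
    obtain \<phi>' where \<phi>': "\<And>x. (\<phi> has_real_derivative \<phi>' x) (at x)" "\<phi>' \<in> tests 0 pi" using tests_obtain_deriv[OF p(1)] by blast
    obtain \<phi>'' where \<phi>'': "\<And>x. (\<phi>' has_real_derivative \<phi>'' x) (at x)" using tests_obtain_deriv[OF \<phi>'(2)] by blast
    obtain \<psi>' where \<psi>': "\<And>x. (\<psi> has_real_derivative \<psi>' x) (at x)" "\<psi>' \<in> tests (-l) l" using tests_obtain_deriv[OF p(2)] by blast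
    obtain \<psi>'' where \<psi>'': "\<And>x. (\<psi>' has_real_derivative \<psi>'' x) (at x)" using tests_obtain_deriv[OF \<psi>'(2)] by blast
    have "(LINT z|lebesgue_on (Omega l). g z * tens \<phi> \<psi> z) = - (LINT z|lebesgue_on (Omega l). u z * tens \<phi> \<psi>' z)"
      using has_weak_deriv_test[OF g tens_test[OF p]] unfolding pderivs_tens_y[OF \<phi>'(1) \<phi>'' \<psi>'(1) \<psi>''] by simp
    also have "\<dots> = - (LINT s|lborel. slice u \<psi>' s * \<phi> s)"
      by (simp add: tens_slice[OF l u p(1) \<psi>'(2)])
    also have "(LINT s|lborel. slice u \<psi>' s * \<phi> s) =
      (LINT x|lborel. - (\<phi> x * (LINT z|lebesgue_on (Omega l). uxy l u z * tens (\<lambda>s. heav 0 s - heav x s) \<psi> z)))"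
    proof (rule Bochner_Integration.integral_cong[OF refl])
      fix x
      show "slice u \<psi>' x * \<phi> x = - (\<phi> x * (LINT z|lebesgue_on (Omega l). uxy l u z * tens (\<lambda>s. heav 0 s - heav x s) \<psi> z))"
        using slice_heav[OF l u h p(2) \<psi>'(1), of x] tests_zero[OF p(1), of x] by (cases "x \<in> {0<..<pi}") auto
    qed
    also have "- \<dots> = (LINT z|lebesgue_on (Omega l). uxy l u z * tens (heav_kernel.dual \<phi>) \<psi> z)"
      using heav_kernel.integral_dual[OF Om.L2_integrable[OF uxy_L2[OF u]] p] by simp
    finally show "(LINT z|lebesgue_on (Omega l). g z * tens \<phi> \<psi> z) =
      (LINT z|lebesgue_on (Omega l). uxy l u z * tens (heav_kernel.dual \<phi>) \<psi> z)" .
  qed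
  also have "\<dots> \<le> pi\<^sup>2 * hess l u" using hess_ge(2)[of l u] by (simp add: mult_left_mono)
  finally show ?thesis .
qed

text \<open>The derivative of Green's function in its first argument, up to sign.\<close>

interpretation dgreen_kernel: bounded_kernel "\<lambda>x s. s / pi - (if x \<le> s then 1 else 0)" 1
proof
  show "(\<lambda>(x, s). s / pi - (if x \<le> s then 1 else 0)) \<in> borel_measurable (borel \<Otimes>\<^sub>M borel)"
    by measurable
qed (auto simp: abs_le_iff field_simps)

interpretation green_kernel: bounded_kernel green pi
proof
  show "(\<lambda>(x, s). green x s) \<in> borel_measurable (borel \<Otimes>\<^sub>M borel)"
    unfolding green_def by measurable
qed (use green_bound in auto)

lemma Icc_indicator_integral:
  fixes f :: "real \<Rightarrow> real"
  assumes "\<And>x. x \<notin> {a..b} \<Longrightarrow> f x = 0"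
  shows "(LINT x|lborel. f x * indicator {a..b} x) = (LINT x|lborel. f x)"
  using assms by (intro Bochner_Integration.integral_cong) (auto simp: indicator_def)

text \<open>Integration by parts in the first argument of Green's function, whose x-derivative is
  the indicator of x < s minus s/\<pi>. The boundary terms vanish with \<phi>.\<close>

lemma green_dual_deriv:
  assumes \<phi>: "\<phi> \<in> tests 0 pi" and d: "\<And>x. (\<phi> has_real_derivative \<phi>' x) (at x)" and s: "s \<in> {0<..<pi}"
  shows "green_kernel.dual \<phi>' s = dgreen_kernel.dual \<phi> s"
proof -
  have \<phi>': "\<phi>' \<in> tests 0 pi" by (rule tests_deriv[OF \<phi> d])
  have c: "isCont \<phi> x" "isCont \<phi>' x" for x
    using tests_continuous[OF \<phi>, of UNIV] tests_continuous[OF \<phi>', of UNIV] by (auto simp: continuous_on_eq_continuous_at)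
  have z: "\<phi> 0 = 0" "\<phi> pi = 0" using tests_zero[OF \<phi>] by auto
  have i: "integrable lborel (\<lambda>x. f x * indicator {a..b} x)" if "\<And>x. isCont f x" for f :: "real \<Rightarrow> real" and a b
    using borel_integrable_atLeastAtMost'[of a b f] that
    by (simp add: set_integrable_def mult.commute continuous_at_imp_continuous_on)
  have 1: "(LINT x|lborel. (\<phi>' x * (s - x * s / pi) - \<phi> x * (s / pi)) * indicator {0..pi} x) = 0"
  proof -
    have "(LINT x|lborel. (\<phi>' x * (s - x * s / pi) - \<phi> x * (s / pi)) * indicator {0..pi} x) =
        \<phi> pi * (s - pi * s / pi) - \<phi> 0 * (s - 0 * s / pi)"
      by (rule integral_FTC_Icc_real) (auto intro!: derivative_eq_intros d continuous_intros c)
    then show ?thesis using z by simp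
  qed
  have 2: "(LINT x|lborel. (\<phi>' x * (s - x) - \<phi> x) * indicator {0..s} x) = 0"
  proof -
    have "(LINT x|lborel. (\<phi>' x * (s - x) - \<phi> x) * indicator {0..s} x) = \<phi> s * (s - s) - \<phi> 0 * (s - 0)"
      by (rule integral_FTC_Icc_real) (use s in \<open>auto intro!: derivative_eq_intros d continuous_intros c\<close>)
    then show ?thesis using z by simp
  qed
  \<comment> \<open>Green's function has a kink at x = s. It is split into its affine part on the
    whole interval and the positive part of s - x, supported in [0, s]; each is then the subject of
    one fundamental theorem, \<open>1\<close> and \<open>2\<close>.\<close>
  have e: "green x s * \<phi>' x - (s / pi - (if x \<le> s then 1 else 0)) * \<phi> x =
      (\<phi>' x * (s - x * s / pi) - \<phi> x * (s / pi)) * indicator {0..pi} x - (\<phi>' x * (s - x) - \<phi> x) * indicator {0..s} x" for x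
  proof (cases "x \<in> {0<..<pi}")
    case True
    then show ?thesis using s by (auto simp: green_def indicator_def max_def algebra_simps)
  next
    case False
    then have "\<phi> x = 0" "\<phi>' x = 0" using tests_zero[OF \<phi>] tests_zero[OF \<phi>'] by auto
    then show ?thesis by simp
  qed
  have "(LINT x|lborel. green x s * \<phi>' x - (s / pi - (if x \<le> s then 1 else 0)) * \<phi> x) = 0"
    unfolding e using 1 2
    by (subst Bochner_Integration.integral_diff) (auto intro!: i continuous_intros c)
  moreover have "integrable lborel (\<lambda>x. green x s * \<phi>' x)"
  proof (rule Bochner_Integration.integrable_bound[of _ "\<lambda>x. pi * \<phi>' x"])
    show "(\<lambda>x. green x s * \<phi>' x) \<in> borel_measurable lborel"
      using tests_borel[OF \<phi>'] unfolding green_def by simp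
    show "AE x in lborel. norm (green x s * \<phi>' x) \<le> norm (pi * \<phi>' x)"
    proof (rule AE_I2)
      fix x show "norm (green x s * \<phi>' x) \<le> norm (pi * \<phi>' x)"
        using green_bound[of x s] s tests_zero[OF \<phi>', of x]
        by (cases "x \<in> {0<..<pi}") (auto simp: abs_mult intro!: mult_right_mono)
    qed
  qed (use tests_integrable[OF \<phi>'] in simp)
  moreover have "integrable lborel (\<lambda>x. (s / pi - (if x \<le> s then 1 else 0)) * \<phi> x)"
  proof (rule Bochner_Integration.integrable_bound[OF tests_integrable[OF \<phi>]])
    show "(\<lambda>x. (s / pi - (if x \<le> s then 1 else 0)) * \<phi> x) \<in> borel_measurable lborel"
      using tests_borel[OF \<phi>] by simp
    show "AE x in lborel. norm ((s / pi - (if x \<le> s then 1 else 0)) * \<phi> x) \<le> norm (\<phi> x)"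
    proof (rule AE_I2)
      fix x
      have "\<bar>s / pi - (if x \<le> s then 1 else 0)\<bar> \<le> 1" using s by (auto simp: abs_le_iff field_simps)
      from mult_right_mono[OF this, of "\<bar>\<phi> x\<bar>"]
      show "norm ((s / pi - (if x \<le> s then 1 else 0)) * \<phi> x) \<le> norm (\<phi> x)" by (simp add: abs_mult)
    qed
  qed
  ultimately show ?thesis
    unfolding green_kernel.dual_def dgreen_kernel.dual_def
    by (subst (asm) Bochner_Integration.integral_diff) auto
qed

text \<open>The x-derivative is moved to \<phi>, \<open>slice_green\<close> replaces slices of u by
  u_xx, and \<open>green_dual_deriv\<close> moves the derivative from \<phi> to the kernel. The
  resulting kernel is bounded by 1.\<close>

lemma weak_x_bound:
  assumes l: "l > 0" and u: "u \<in> H2star l" and g: "has_weak_deriv (Omega l) [(1, 0)] u g"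
  shows "(LINT z|lebesgue_on (Omega l). (g z)\<^sup>2) \<le> pi\<^sup>2 * hess l u"
proof -
  note h = uxx_weak[OF u]
  have "(LINT z|lebesgue_on (Omega l). (g z)\<^sup>2) \<le> (1 * pi)\<^sup>2 * (LINT z|lebesgue_on (Omega l). (uxx l u z)\<^sup>2)"
  proof (rule dgreen_kernel.kernel_L2_bound[OF l uxx_L2[OF u] has_weak_deriv_L2(2)[OF g]])
    fix \<phi> \<psi> assume p: "\<phi> \<in> tests 0 pi" "\<psi> \<in> tests (-l) l"
    obtain \<phi>' where \<phi>': "\<And>x. (\<phi> has_real_derivative \<phi>' x) (at x)" "\<phi>' \<in> tests 0 pi" using tests_obtain_deriv[OF p(1)] by blast
    obtain \<phi>'' where \<phi>'': "\<And>x. (\<phi>' has_real_derivative \<phi>'' x) (at x)" using tests_obtain_deriv[OF \<phi>'(2)] by blast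
    obtain \<psi>' where \<psi>': "\<And>x. (\<psi> has_real_derivative \<psi>' x) (at x)" "\<psi>' \<in> tests (-l) l" using tests_obtain_deriv[OF p(2)] by blast
    obtain \<psi>'' where \<psi>'': "\<And>x. (\<psi>' has_real_derivative \<psi>'' x) (at x)" using tests_obtain_deriv[OF \<psi>'(2)] by blast
    have "(LINT z|lebesgue_on (Omega l). g z * tens \<phi> \<psi> z) = - (LINT z|lebesgue_on (Omega l). u z * tens \<phi>' \<psi> z)"
      using has_weak_deriv_test[OF g tens_test[OF p]] unfolding pderivs_tens_x[OF \<phi>'(1) \<phi>'' \<psi>'(1) \<psi>''] by simp
    also have "\<dots> = - (LINT s|lborel. slice u \<psi> s * \<phi>' s)"
      by (simp add: tens_slice[OF l u \<phi>'(2) p(2)])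
    also have "(LINT s|lborel. slice u \<psi> s * \<phi>' s) =
      (LINT x|lborel. - (\<phi>' x * (LINT z|lebesgue_on (Omega l). uxx l u z * tens (green x) \<psi> z)))"
    proof (rule Bochner_Integration.integral_cong[OF refl])
      fix x
      show "slice u \<psi> x * \<phi>' x = - (\<phi>' x * (LINT z|lebesgue_on (Omega l). uxx l u z * tens (green x) \<psi> z))"
        using slice_green[OF l u h p(2), of x] tests_zero[OF \<phi>'(2), of x] by (cases "x \<in> {0<..<pi}") auto
    qed
    also have "- \<dots> = (LINT z|lebesgue_on (Omega l). uxx l u z * tens (green_kernel.dual \<phi>') \<psi> z)"
      using green_kernel.integral_dual[OF Om.L2_integrable[OF uxx_L2[OF u]] \<phi>'(2) p(2)] by simp
    also have "\<dots> = (LINT z|lebesgue_on (Omega l). uxx l u z * tens (dgreen_kernel.dual \<phi>) \<psi> z)"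
    proof (rule Bochner_Integration.integral_cong[OF refl])
      fix z assume "z \<in> space (lebesgue_on (Omega l))"
      then show "uxx l u z * tens (green_kernel.dual \<phi>') \<psi> z = uxx l u z * tens (dgreen_kernel.dual \<phi>) \<psi> z"
        using green_dual_deriv[OF p(1) \<phi>'(1), of "fst z"] by (auto simp: tens_def Omega_def)
    qed
    finally show "(LINT z|lebesgue_on (Omega l). g z * tens \<phi> \<psi> z) =
      (LINT z|lebesgue_on (Omega l). uxx l u z * tens (dgreen_kernel.dual \<phi>) \<psi> z)" .
  qed
  also have "\<dots> \<le> pi\<^sup>2 * hess l u" using hess_ge(1)[of l u] by (simp add: mult_left_mono)
  finally show ?thesis .
qed

section \<open>The sup bound and the modulus of continuity of the gap\<close>

lemma L2_bounded_test:
  assumes f: "f \<in> L2 (lebesgue_on (Omega l))" and T: "T \<in> borel_measurable (lebesgue_on (Omega l))"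
    and b: "\<And>z. z \<in> Omega l \<Longrightarrow> \<bar>T z\<bar> \<le> B" and B: "0 \<le> B"
  shows "\<bar>LINT z|lebesgue_on (Omega l). f z * T z\<bar> \<le>
    sqrt (LINT z|lebesgue_on (Omega l). (f z)\<^sup>2) * (B * sqrt (measure lebesgue (Omega l)))"
proof -
  have TL: "T \<in> L2 (lebesgue_on (Omega l))" using b by (intro Om.L2_bounded[OF T, of B]) simp
  have "(LINT z|lebesgue_on (Omega l). (T z)\<^sup>2) \<le> (LINT z|lebesgue_on (Omega l). B\<^sup>2)"
  proof (rule integral_mono)
    show "integrable (lebesgue_on (Omega l)) (\<lambda>z. (T z)\<^sup>2)" by (rule L2_square[OF TL])
    fix z assume "z \<in> space (lebesgue_on (Omega l))"
    then show "(T z)\<^sup>2 \<le> B\<^sup>2" using b[of z] power_mono[of "\<bar>T z\<bar>" B 2] by simp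
  qed simp
  also have "\<dots> = B\<^sup>2 * measure lebesgue (Omega l)"
    by (simp add: measure_restrict_space Omega_sets)
  finally have "sqrt (LINT z|lebesgue_on (Omega l). (T z)\<^sup>2) \<le> B * sqrt (measure lebesgue (Omega l))"
    using B by (metis real_sqrt_le_mono real_sqrt_mult real_sqrt_abs abs_of_nonneg)
  from order_trans[OF L2_CS[OF f TL] mult_left_mono[OF this]] show ?thesis by simp
qed

text \<open>A value u(x, y) is the average of u(x, .) against a probability density \<psi> plus the
  average of the differences u(x, y) - u(x, t). The former is bounded through u_xx by
  \<open>slice_green\<close>, the latter through u_xy by \<open>mixed_difference\<close>.\<close>

lemma sup_bound:
  assumes l: "l > 0"
  obtains K where "K > 0" "\<And>u z. u \<in> H2star l \<Longrightarrow> \<bar>u z\<bar> \<le> K * sqrt (hess l u)"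
proof -
  have ll: "-l < l" using l by simp
  define \<psi> where "\<psi> = dlt (-l) l 0 0"
  have \<psi>: "\<psi> \<in> tests (-l) l" unfolding \<psi>_def by (rule dlt_tests[OF ll])
  obtain B where B: "\<And>t. \<bar>\<psi> t\<bar> \<le> B" "B > 0" using tests_bounded[OF \<psi>] by blast
  define m where "m = sqrt (measure lebesgue (Omega l))"
  have m: "m \<ge> 0" by (simp add: m_def)
  \<comment> \<open>m comes from the differences in y, the second term from the average; 1 makes K
    positive.\<close>
  define K where "K = m + pi * B * m + 1"
  have "\<bar>u z\<bar> \<le> K * sqrt (hess l u)" if u: "u \<in> H2star l" for u z
  proof (cases "z \<in> {0..pi} \<times> {-l..l}")
    case False
    then show ?thesis using H2star_outside[OF l u False] m B by (simp add: K_def hess_nonneg)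
  next
    case True
    then obtain x y where xy: "z = (x, y)" "x \<in> {0..pi}" "y \<in> {-l..l}" by auto
    let ?h = "sqrt (hess l u)"
    have md: "\<bar>u (x, y) - u (x, t)\<bar> \<le> m * ?h" if t: "t \<in> {-l..l}" for t
    proof -
      have "\<bar>u (x, y) - u (x, t)\<bar> \<le> sqrt (LINT z|lebesgue_on (Omega l). (uxy l u z)\<^sup>2) * (1 * m)"
        unfolding mixed_difference[OF l u uxy_weak[OF u] xy(2,3) t] abs_minus_cancel m_def
      proof (rule L2_bounded_test[OF uxy_L2[OF u]])
        show "tens (\<lambda>s. heav 0 s - heav x s) (\<lambda>t'. heav y t' - heav t t') \<in> borel_measurable (lebesgue_on (Omega l))"
          by (intro borel_lebesgue_on tens_borel borel_measurable_diff heav_borel)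
      qed (auto simp: tens_def heav_def)
      also have "\<dots> \<le> ?h * (1 * m)" using m hess_ge(2) by (intro mult_right_mono real_sqrt_le_mono) auto
      finally show ?thesis by (simp add: mult.commute)
    qed
    have sl: "\<bar>slice u \<psi> x\<bar> \<le> pi * B * m * ?h"
    proof -
      have "\<bar>slice u \<psi> x\<bar> \<le> sqrt (LINT z|lebesgue_on (Omega l). (uxx l u z)\<^sup>2) * ((pi * B) * m)"
        unfolding slice_green[OF l u uxx_weak[OF u] \<psi> xy(2)] abs_minus_cancel m_def
      proof (rule L2_bounded_test[OF uxx_L2[OF u]])
        show "tens (green x) \<psi> \<in> borel_measurable (lebesgue_on (Omega l))"
          by (intro borel_lebesgue_on tens_borel green_borel tests_borel[OF \<psi>])
        fix z assume "z \<in> Omega l"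
        then have "fst z \<in> {0..pi}" by (auto simp: Omega_def)
        then show "\<bar>tens (green x) \<psi> z\<bar> \<le> pi * B"
          unfolding tens_def abs_mult using green_bound[OF xy(2)] B by (intro mult_mono) auto
      qed (use B in simp)
      also have "\<dots> \<le> ?h * ((pi * B) * m)" using m B hess_ge(1) by (intro mult_right_mono real_sqrt_le_mono) auto
      finally show ?thesis by (simp add: mult_ac)
    qed
    have cu: "continuous_on {-l..l} (\<lambda>t. u (x, t))"
      using xy by (intro continuous_on_compose2[OF H2star_continuous[OF l u]]) (auto intro!: continuous_intros)
    have "u (x, y) - slice u \<psi> x = (LINT t|lborel. u (x, y) * \<psi> t) - (LINT t|lborel. u (x, t) * \<psi> t)"
      using dlt_integral[OF ll] by (simp add: slice_def \<psi>_def)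
    also have "\<dots> = (LINT t|lborel. (u (x, y) - u (x, t)) * \<psi> t)"
      unfolding left_diff_distrib \<psi>_def
      by (rule Bochner_Integration.integral_diff[symmetric])
        (intro continuous_dlt_integrable[OF ll] cu continuous_on_const)+
    finally have e: "u (x, y) - slice u \<psi> x = (LINT t|lborel. (u (x, y) - u (x, t)) * \<psi> t)" .
    have "norm (LINT t|lborel. (u (x, y) - u (x, t)) * \<psi> t) \<le> (LINT t|lborel. (m * ?h) * \<psi> t)"
    proof (rule Bochner_Integration.integral_norm_bound_integral)
      show "integrable lborel (\<lambda>t. (u (x, y) - u (x, t)) * \<psi> t)"
        unfolding \<psi>_def by (intro continuous_dlt_integrable[OF ll] continuous_intros cu)
      show "integrable lborel (\<lambda>t. m * ?h * \<psi> t)" using tests_integrable[OF \<psi>] by simp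
      show "norm ((u (x, y) - u (x, t)) * \<psi> t) \<le> m * ?h * \<psi> t" for t
      proof (cases "t \<in> {-l..l}")
        case True
        then show ?thesis using md[OF True] dlt_nonneg[OF ll, of 0 0 t]
          by (simp add: abs_mult \<psi>_def mult_right_mono)
      next
        case False then show ?thesis using tests_zero[OF \<psi>, of t] by auto
      qed
    qed
    also have "\<dots> = m * ?h" using dlt_integral(2)[OF ll, of 0 0] by (simp add: \<psi>_def)
    finally have "\<bar>u (x, y) - slice u \<psi> x\<bar> \<le> m * ?h" using e by simp
    then have "\<bar>u (x, y)\<bar> \<le> m * ?h + pi * B * m * ?h" using sl by linarith
    also have "\<dots> \<le> K * ?h" using hess_nonneg[of l u] by (simp add: K_def algebra_simps)
    finally show ?thesis by (simp add: xy)
  qed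
  moreover have "K > 0" using m B by (simp add: K_def add_nonneg_pos)
  ultimately show ?thesis using that by blast
qed

text \<open>The two gaps differ by the integral of u_xy over the strip between x and x' of full
  height. Cauchy-Schwarz yields the square root of the area of this strip.\<close>

lemma gap_holder:
  assumes l: "l > 0" and u: "u \<in> H2star l" and x: "x \<in> {0..pi}" "x' \<in> {0..pi}"
  shows "\<bar>gap l u x - gap l u x'\<bar> \<le> sqrt (2 * l * \<bar>x - x'\<bar>) * sqrt (hess l u)"
  using x
proof (induction x x' rule: linorder_wlog)
  case (sym a b)
  then show ?case by (simp add: abs_minus_commute)
next
  case (le a b)
  let ?M = "lebesgue_on (Omega l)" and ?Y = "\<lambda>t. heav l t - heav (- l) t"
  let ?T = "tens (\<lambda>s. heav b s - heav a s) ?Y"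
  have y: "l \<in> {-l..l}" "- l \<in> {-l..l}" using l by auto
  have tb: "tens (\<lambda>s. heav p s - heav q s) ?Y \<in> borel_measurable borel" for p q
    by (intro tens_borel borel_measurable_diff heav_borel)
  have TL: "tens (\<lambda>s. heav p s - heav q s) ?Y \<in> L2 ?M" for p q
    by (rule Om.L2_bounded[where C = 1, OF borel_lebesgue_on[OF tb]]) (auto simp: tens_def heav_def)
  note md = mixed_difference[OF l u uxy_weak[OF u] _ y]
  have "gap l u a - gap l u b = (LINT z|?M. uxy l u z * tens (\<lambda>s. heav 0 s - heav b s) ?Y z)
      - (LINT z|?M. uxy l u z * tens (\<lambda>s. heav 0 s - heav a s) ?Y z)"
    using md[OF le(2)] md[OF le(3)] by (simp add: gap_def)
  also have "\<dots> = (LINT z|?M. uxy l u z * tens (\<lambda>s. heav 0 s - heav b s) ?Y z - uxy l u z * tens (\<lambda>s. heav 0 s - heav a s) ?Y z)"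
    by (rule Bochner_Integration.integral_diff[symmetric]) (intro L2_mult uxy_L2 u TL)+
  also have "\<dots> = (LINT z|?M. uxy l u z * tens (\<lambda>s. heav a s - heav b s) ?Y z)"
    by (rule Bochner_Integration.integral_cong) (auto simp: tens_def algebra_simps)
  finally have e: "gap l u a - gap l u b = (LINT z|?M. uxy l u z * tens (\<lambda>s. heav a s - heav b s) ?Y z)" .
  have "(LINT z|?M. (tens (\<lambda>s. heav a s - heav b s) ?Y z)\<^sup>2) \<le> 2 * l * \<bar>a - b\<bar>"
  proof -
    let ?S = "cbox (a, -l) (b, l)"
    have "(LINT z|?M. (tens (\<lambda>s. heav a s - heav b s) ?Y z)\<^sup>2) =
        (LINT z|lebesgue. indicator (Omega l) z *\<^sub>R (tens (\<lambda>s. heav a s - heav b s) ?Y z)\<^sup>2)"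
      using Omega_sets by (simp add: integral_restrict_space)
    also have "\<dots> \<le> (LINT z|lebesgue. indicator ?S z)"
    proof (rule integral_mono)
      show "integrable lebesgue (\<lambda>z. indicator (Omega l) z *\<^sub>R (tens (\<lambda>s. heav a s - heav b s) ?Y z)\<^sup>2)"
        using L2_square[OF TL] Omega_sets by (subst integrable_restrict_space[symmetric]) auto
      show "integrable lebesgue (indicator ?S :: _ \<Rightarrow> real)"
        using lmeasurable_cbox by (subst integrable_indicator_iff) (auto simp: fmeasurable_def)
      show "indicator (Omega l) z *\<^sub>R (tens (\<lambda>s. heav a s - heav b s) ?Y z)\<^sup>2 \<le> indicator ?S z" for z
        using le(1) by (cases z) (auto simp: indicator_def tens_def heav_def Omega_def cbox_Pair_eq)
    qed
    also have "\<dots> = measure lebesgue ?S" by simp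
    also have "\<dots> = 2 * l * \<bar>a - b\<bar>" using l le(1) by (simp add: content_Pair)
    finally show ?thesis .
  qed
  then have "sqrt (LINT z|?M. (tens (\<lambda>s. heav a s - heav b s) ?Y z)\<^sup>2) \<le> sqrt (2 * l * \<bar>a - b\<bar>)"
    by (rule real_sqrt_le_mono)
  moreover have "sqrt (LINT z|?M. (uxy l u z)\<^sup>2) \<le> sqrt (hess l u)"
    by (intro real_sqrt_le_mono hess_ge)
  ultimately have "sqrt (LINT z|?M. (uxy l u z)\<^sup>2) * sqrt (LINT z|?M. (tens (\<lambda>s. heav a s - heav b s) ?Y z)\<^sup>2)
     \<le> sqrt (hess l u) * sqrt (2 * l * \<bar>a - b\<bar>)"
    by (intro mult_mono) (auto simp: hess_nonneg)
  then show ?case using L2_CS[OF uxy_L2[OF u] TL, of a b] unfolding e by (simp add: mult.commute)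
qed

section \<open>Completeness of the energy space\<close>

lemma hess_diff:
  assumes "l > 0" "u \<in> H2star l" "v \<in> H2star l"
  shows "hess l (\<lambda>z. u z - v z) = (LINT z|lebesgue_on (Omega l). (uxx l u z - uxx l v z)\<^sup>2) +
    (LINT z|lebesgue_on (Omega l). (uxy l u z - uxy l v z)\<^sup>2) + (LINT z|lebesgue_on (Omega l). (uyy l u z - uyy l v z)\<^sup>2)"
proof -
  let ?M = "lebesgue_on (Omega l)"
  note D = second_L2[OF assms(2)] second_L2[OF assms(3)] second_L2[OF H2star_diff[OF assms]]
  have [measurable]: "uxx l u \<in> borel_measurable ?M" "uxy l u \<in> borel_measurable ?M" "uyy l u \<in> borel_measurable ?M"
    "uxx l v \<in> borel_measurable ?M" "uxy l v \<in> borel_measurable ?M" "uyy l v \<in> borel_measurable ?M"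
    "uxx l (\<lambda>z. u z - v z) \<in> borel_measurable ?M" "uxy l (\<lambda>z. u z - v z) \<in> borel_measurable ?M"
    "uyy l (\<lambda>z. u z - v z) \<in> borel_measurable ?M"
    using D by (simp_all add: L2_def)
  have ae: "AE z in ?M. uxx l (\<lambda>z. u z - v z) z = uxx l u z - uxx l v z \<and>
     uxy l (\<lambda>z. u z - v z) z = uxy l u z - uxy l v z \<and> uyy l (\<lambda>z. u z - v z) z = uyy l u z - uyy l v z"
    using second_lincomb[OF assms, of 1 "-1"] by simp
  have "(LINT z|?M. (uxx l (\<lambda>z. u z - v z) z)\<^sup>2) = (LINT z|?M. (uxx l u z - uxx l v z)\<^sup>2)"
    by (rule integral_cong_AE) (use ae in auto)
  moreover have "(LINT z|?M. (uxy l (\<lambda>z. u z - v z) z)\<^sup>2) = (LINT z|?M. (uxy l u z - uxy l v z)\<^sup>2)"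
    by (rule integral_cong_AE) (use ae in auto)
  moreover have "(LINT z|?M. (uyy l (\<lambda>z. u z - v z) z)\<^sup>2) = (LINT z|?M. (uyy l u z - uyy l v z)\<^sup>2)"
    by (rule integral_cong_AE) (use ae in auto)
  ultimately show ?thesis by (simp add: hess_def)
qed

lemma H2star_L2: "u \<in> H2star l \<Longrightarrow> u \<in> L2 (lebesgue_on (Omega l))"
  unfolding H2star_def H2_def Lp_space_2 by simp

text \<open>Makes every weak derivative required by \<open>H2\<close> Cauchy along a
  \<open>hess\<close>-Cauchy sequence: orders 0 and 1 by the bounds just proved, order 2 because the
  derivative agrees almost everywhere with one occurring in \<open>hess\<close>.\<close>

lemma weak_deriv_bound:
  assumes l: "l > 0"
  obtains c where "c > 0" "\<And>u bs g. u \<in> H2star l \<Longrightarrow> set bs \<subseteq> Basis \<Longrightarrow> length bs \<le> 2 \<Longrightarrow>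
    has_weak_deriv (Omega l) bs u g \<Longrightarrow> (LINT z|lebesgue_on (Omega l). (g z)\<^sup>2) \<le> c * hess l u"
proof -
  let ?M = "lebesgue_on (Omega l)"
  obtain K where K: "K > 0" "\<And>u z. u \<in> H2star l \<Longrightarrow> \<bar>u z\<bar> \<le> K * sqrt (hess l u)" using sup_bound[OF l] by blast
  define m where "m = measure lebesgue (Omega l)"
  \<comment> \<open>The three summands serve the orders zero, one and two.\<close>
  define c where "c = K\<^sup>2 * m + pi\<^sup>2 + 1"
  have m: "m \<ge> 0" by (simp add: m_def)
  have cs: "K\<^sup>2 * m \<le> c" "pi\<^sup>2 \<le> c" "1 \<le> c" using m by (auto simp: c_def)
  have same: "(LINT z|?M. (g z)\<^sup>2) = (LINT z|?M. (h z)\<^sup>2)"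
    if "AE z in ?M. g z = h z" "g \<in> L2 ?M" "h \<in> L2 ?M" for g h
    using that by (intro integral_cong_AE) (auto simp: L2_def)
  have "(LINT z|?M. (g z)\<^sup>2) \<le> c * hess l u" if u: "u \<in> H2star l" and bs: "set bs \<subseteq> Basis" "length bs \<le> 2"
    and g: "has_weak_deriv (Omega l) bs u g" for u bs g
  proof -
    note gL = has_weak_deriv_L2(2)[OF g]
    consider "bs = []" | b where "bs = [b]" "b \<in> Basis" | a b where "bs = [a, b]" "a \<in> Basis" "b \<in> Basis"
      using bs by (cases bs; cases "tl bs"; auto simp: length_Suc_conv)
    then show ?thesis
    proof cases
      case 1
      have "has_weak_deriv (Omega l) [] u u"
        using H2star_L2[OF u] unfolding has_weak_deriv_def Lp_space_2 by (simp add: pderivs_def)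
      then have "AE z in ?M. g z = u z" using has_weak_deriv_unique[OF l] g 1 by blast
      from same[OF this gL H2star_L2[OF u]] have "(LINT z|?M. (g z)\<^sup>2) = (LINT z|?M. (u z)\<^sup>2)" .
      also have "\<dots> \<le> (LINT z|?M. K\<^sup>2 * hess l u)"
      proof (rule integral_mono)
        show "integrable ?M (\<lambda>z. (u z)\<^sup>2)" by (rule L2_square[OF H2star_L2[OF u]])
        show "(u z)\<^sup>2 \<le> K\<^sup>2 * hess l u" for z
          using power_mono[OF K(2)[OF u, of z], of 2] by (simp add: power_mult_distrib hess_nonneg)
      qed simp
      also have "\<dots> = (K\<^sup>2 * m) * hess l u" by (simp add: m_def measure_restrict_space Omega_sets)
      also have "\<dots> \<le> c * hess l u" by (intro mult_right_mono cs hess_nonneg)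
      finally show ?thesis .
    next
      case 2
      then have "(LINT z|?M. (g z)\<^sup>2) \<le> pi\<^sup>2 * hess l u"
        using weak_x_bound[OF l u, of g] weak_y_bound[OF l u, of g] g by (auto simp: Basis_real_prod)
      also have "\<dots> \<le> c * hess l u" by (intro mult_right_mono cs hess_nonneg)
      finally show ?thesis .
    next
      case 3
      then consider "bs = [(1, 0), (1, 0)]" | "bs = [(1, 0), (0, 1)]" | "bs = [(0, 1), (1, 0)]" | "bs = [(0, 1), (0, 1)]"
        by (auto simp: Basis_real_prod)
      then have "(LINT z|?M. (g z)\<^sup>2) \<le> hess l u"
      proof cases
        case 1
        then show ?thesis using same[OF has_weak_deriv_unique[OF l] gL uxx_L2[OF u], of bs u] g uxx_weak[OF u] hess_ge(1)[of l u] by simp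
      next
        case 2
        then show ?thesis using same[OF has_weak_deriv_unique[OF l] gL uxy_L2[OF u], of bs u] g uxy_weak[OF u] hess_ge(2)[of l u] by simp
      next
        case 3
        then show ?thesis using same[OF mixed_symmetric[OF l _ uxy_weak[OF u]] gL uxy_L2[OF u]] g hess_ge(2)[of l u] by simp
      next
        case 4
        then show ?thesis using same[OF has_weak_deriv_unique[OF l] gL uyy_L2[OF u], of bs u] g uyy_weak[OF u] hess_ge(3)[of l u] by simp
      qed
      also have "\<dots> \<le> c * hess l u" using mult_right_mono[OF cs(3) hess_nonneg[of l u]] by simp
      finally show ?thesis .
    qed
  qed
  moreover have "c > 0" using cs(3) by simp
  ultimately show ?thesis using that by blast
qed

lemma uniform_limit_L2:
  assumes U: "\<And>n. U n \<in> L2 (lebesgue_on (Omega l))" "u \<in> L2 (lebesgue_on (Omega l))"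
    and lim: "uniform_limit UNIV U u sequentially"
  shows "L2_tendsto (lebesgue_on (Omega l)) U u"
  unfolding L2_tendsto_def
proof (intro conjI allI U)
  let ?M = "lebesgue_on (Omega l)"
  define m where "m = measure lebesgue (Omega l)"
  have m: "m \<ge> 0" by (simp add: m_def)
  show "(\<lambda>n. LINT z|?M. (U n z - u z)\<^sup>2) \<longlonglongrightarrow> 0"
  proof (rule LIMSEQ_I)
    fix r :: real assume r: "r > 0"
    \<comment> \<open>Chosen so that d squared times the area is below r; the 1 excludes division by
      zero.\<close>
    define d where "d = sqrt (r / (m + 1))"
    have d: "d > 0" using r m by (simp add: d_def)
    have d2: "d\<^sup>2 * m < r" using r m by (simp add: d_def field_simps)
    obtain N where N: "\<And>n z. n \<ge> N \<Longrightarrow> dist (U n z) (u z) < d"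
      using lim d unfolding uniform_limit_iff eventually_sequentially by blast
    have "(LINT z|?M. (U n z - u z)\<^sup>2) \<le> (LINT z|?M. d\<^sup>2)" if "n \<ge> N" for n
    proof (rule integral_mono)
      show "integrable ?M (\<lambda>z. (U n z - u z)\<^sup>2)" by (intro L2_square L2_diff U)
      show "(U n z - u z)\<^sup>2 \<le> d\<^sup>2" for z
        using N[OF that, of z] power_mono[of "\<bar>U n z - u z\<bar>" d 2] by (simp add: dist_real_def)
    qed simp
    also have "(LINT z|?M. d\<^sup>2) = d\<^sup>2 * m" by (simp add: m_def measure_restrict_space Omega_sets)
    finally have "norm ((LINT z|?M. (U n z - u z)\<^sup>2) - 0) < r" if "n \<ge> N" for n using that d2 by fastforce
    then show "\<exists>no. \<forall>n\<ge>no. norm ((LINT z|?M. (U n z - u z)\<^sup>2) - 0) < r" by blast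
  qed
qed

text \<open>The sup bound gives a uniform limit, which keeps continuity on the closure and the
  prescribed zeros. Each weak derivative converges in L^2, and closedness identifies its limit as a
  weak derivative of that function.\<close>

lemma H2star_complete:
  assumes l: "l > 0" and U: "\<And>n. U n \<in> H2star l"
    and C: "\<And>e. e > 0 \<Longrightarrow> \<exists>N. \<forall>i\<ge>N. \<forall>j\<ge>N. hess l (\<lambda>z. U i z - U j z) < e"
  obtains u where "u \<in> H2star l" "(\<lambda>n. hess l (\<lambda>z. U n z - u z)) \<longlonglongrightarrow> 0"
proof -
  let ?M = "lebesgue_on (Omega l)"
  obtain K where K: "K > 0" "\<And>u z. u \<in> H2star l \<Longrightarrow> \<bar>u z\<bar> \<le> K * sqrt (hess l u)" using sup_bound[OF l] by blast
  obtain c where c: "c > 0" "\<And>u bs g. u \<in> H2star l \<Longrightarrow> set bs \<subseteq> Basis \<Longrightarrow> length bs \<le> 2 \<Longrightarrow>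
    has_weak_deriv (Omega l) bs u g \<Longrightarrow> (LINT z|?M. (g z)\<^sup>2) \<le> c * hess l u"
    using weak_deriv_bound[OF l] by metis
  have "uniformly_Cauchy_on UNIV U"
    unfolding uniformly_Cauchy_on_def
  proof (intro allI impI)
    fix e :: real assume e: "e > 0"
    then have "(e / K)\<^sup>2 > 0" using K(1) by simp
    from C[OF this] obtain N where N: "\<And>i j. i \<ge> N \<Longrightarrow> j \<ge> N \<Longrightarrow> hess l (\<lambda>z. U i z - U j z) < (e / K)\<^sup>2" by blast
    have "dist (U i z) (U j z) < e" if "i \<ge> N" "j \<ge> N" for i j z
    proof -
      have "sqrt (hess l (\<lambda>z. U i z - U j z)) < e / K"
        using real_sqrt_less_mono[OF N[OF that]] e K(1) by simp
      then have "K * sqrt (hess l (\<lambda>z. U i z - U j z)) < e" using K(1) by (simp add: field_simps)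
      then show ?thesis using K(2)[OF H2star_diff[OF l U[of i] U[of j]], of z] by (simp add: dist_real_def)
    qed
    then show "\<exists>M. \<forall>x\<in>UNIV. \<forall>m\<ge>M. \<forall>n\<ge>M. dist (U m x) (U n x) < e" by blast
  qed
  then obtain u where u: "uniform_limit UNIV U u sequentially"
    using Cauchy_uniformly_convergent uniformly_convergent_on_def by blast
  have pw: "(\<lambda>n. U n z) \<longlonglongrightarrow> u z" for z by (rule tendsto_uniform_limitI[OF u]) simp
  \<comment> \<open>Covers both the vanishing outside the closed rectangle and the boundary
    condition.\<close>
  have zero: "u z = 0" if "\<And>n. U n z = 0" for z using pw[of z] that by (simp add: LIMSEQ_const_iff)
  have cont: "continuous_on (closure (Omega l)) u"
    by (rule uniform_limit_theorem[OF _ uniform_limit_on_subset[OF u]])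
      (use U in \<open>auto simp: H2star_def\<close>)
  have um: "u \<in> borel_measurable ?M"
    using continuous_on_subset[OF cont closure_subset] Omega_sets
    by (intro continuous_imp_measurable_on_sets_lebesgue) auto
  have uL2: "u \<in> L2 ?M"
  proof -
    have "compact (closure (Omega l))" using Omega_bounded by (simp add: compact_closure)
    from compact_imp_bounded[OF compact_continuous_image[OF cont this]]
    obtain B where "\<forall>y\<in>u ` closure (Omega l). norm y \<le> B" unfolding bounded_iff by blast
    then show ?thesis using closure_subset[of "Omega l"] by (intro Om.L2_bounded[OF um, of B]) auto
  qed
  have L: "L2_tendsto ?M U u" by (rule uniform_limit_L2[OF H2star_L2[OF U] uL2 u])
  have deriv: "\<exists>g. L2_tendsto ?M (\<lambda>n. weak_deriv (Omega l) bs (U n)) g \<and> has_weak_deriv (Omega l) bs u g"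
    if bs: "set bs \<subseteq> Basis" "length bs \<le> 2" for bs
  proof -
    define G where "G n = weak_deriv (Omega l) bs (U n)" for n
    have G: "has_weak_deriv (Omega l) bs (U n) (G n)" for n
      unfolding G_def by (rule weak_deriv_has[OF U bs])
    have "has_weak_deriv (Omega l) bs (\<lambda>z. U i z - U j z) (\<lambda>z. G i z - G j z)" for i j
      using has_weak_deriv_lincomb[OF Omega_lmeasurable bs(1) G G, of 1 i "-1" j] by simp
    then have b: "(LINT z|?M. (G i z - G j z)\<^sup>2) \<le> c * hess l (\<lambda>z. U i z - U j z)" for i j
      by (intro c(2)[OF H2star_diff[OF l U U] bs])
    have cauchy: "\<exists>N. \<forall>i\<ge>N. \<forall>j\<ge>N. (LINT z|?M. (G i z - G j z)\<^sup>2) < e" if "e > 0" for e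
    proof -
      have "e / c > 0" using that c(1) by simp
      from C[OF this] obtain N where N: "\<And>i j. i \<ge> N \<Longrightarrow> j \<ge> N \<Longrightarrow> hess l (\<lambda>z. U i z - U j z) < e / c" by blast
      have "c * hess l (\<lambda>z. U i z - U j z) < e" if "i \<ge> N" "j \<ge> N" for i j
        using N[OF that] c(1) by (simp add: field_simps)
      then show ?thesis using b by (meson le_less_trans)
    qed
    obtain g where "L2_tendsto ?M G g"
      by (rule Om.L2_complete[OF has_weak_deriv_L2(2)[OF G] cauchy])
    with has_weak_deriv_limit[OF Omega_lmeasurable bs(1) G L] show ?thesis unfolding G_def by blast
  qed
  have uH: "u \<in> H2star l"
  proof -
    have "u \<in> H2 (Omega l)" using deriv uL2 unfolding H2_def Lp_space_2 by blast
    moreover have "u z = 0" if "z \<notin> closure (Omega l)" for z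
    proof (rule zero)
      show "U n z = 0" for n using U[of n] that unfolding H2star_def by blast
    qed
    moreover have "u z = 0" if "z \<in> {0, pi} \<times> {-l<..<l}" for z
    proof (rule zero)
      show "U n z = 0" for n using U[of n] that unfolding H2star_def by blast
    qed
    ultimately show ?thesis using cont unfolding H2star_def by blast
  qed
  have conv: "(\<lambda>n. LINT z|?M. (weak_deriv (Omega l) bs (U n) z - weak_deriv (Omega l) bs u z)\<^sup>2) \<longlonglongrightarrow> 0"
    if bs: "set bs \<subseteq> Basis" "length bs \<le> 2" for bs
  proof -
    obtain g where g: "L2_tendsto ?M (\<lambda>n. weak_deriv (Omega l) bs (U n)) g" "has_weak_deriv (Omega l) bs u g"
      using deriv[OF bs] by blast
    \<comment> \<open>The limit g and the chosen weak derivative of u agree only almost everywhere,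
      which the integrals do not see.\<close>
    have ae: "AE z in ?M. weak_deriv (Omega l) bs u z = g z"
      by (rule has_weak_deriv_unique[OF l weak_deriv_has[OF uH bs] g(2)])
    have "(LINT z|?M. (weak_deriv (Omega l) bs (U n) z - weak_deriv (Omega l) bs u z)\<^sup>2) =
        (LINT z|?M. (weak_deriv (Omega l) bs (U n) z - g z)\<^sup>2)" for n
      using ae has_weak_deriv_L2(2)[OF weak_deriv_has[OF U[of n] bs]] has_weak_deriv_L2(2)[OF g(2)] has_weak_deriv_L2(2)[OF weak_deriv_has[OF uH bs]]
      by (intro integral_cong_AE) (auto simp: L2_def)
    then show ?thesis using g(1) by (simp add: L2_tendsto_def)
  qed
  have "(\<lambda>n. hess l (\<lambda>z. U n z - u z)) \<longlonglongrightarrow> 0 + 0 + 0"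
    unfolding hess_diff[OF l U uH] uxx_def uxy_def uyy_def
    by (intro tendsto_add conv) (auto simp: Basis_real_prod)
  then show ?thesis using that uH by simp
qed

subsection \<open>The weighted plate form\<close>

definition plate_density :: "real \<Rightarrow> real \<Rightarrow> (real \<times> real \<Rightarrow> real) \<Rightarrow> (real \<times> real \<Rightarrow> real) \<Rightarrow> real \<times> real \<Rightarrow> real" where
  "plate_density l \<sigma> u v z = laplace l u z * laplace l v z
     + (1 - \<sigma>) * (2 * uxy l u z * uxy l v z - uxx l u z * uyy l v z - uyy l u z * uxx l v z)"

text \<open>One form for three uses: weight 1 + d chi_D is the quadratic part of the first energy,
  weight 1 that of the second energy and the inner product of the space.\<close>

definition wform :: "real \<Rightarrow> real \<Rightarrow> (real \<times> real \<Rightarrow> real) \<Rightarrow> (real \<times> real \<Rightarrow> real) \<Rightarrow> (real \<times> real \<Rightarrow> real) \<Rightarrow> real" where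
  "wform l \<sigma> w u v = (LINT z|lebesgue_on (Omega l). w z * plate_density l \<sigma> u v z)"

lemma plate_form_Omega: "plate_form l \<sigma> (Omega l) u v = wform l \<sigma> (\<lambda>_. 1) u v"
  by (simp add: plate_form_def wform_def plate_density_def)

lemma plate_density_integrable:
  assumes "u \<in> H2star l" "v \<in> H2star l"
  shows "integrable (lebesgue_on (Omega l)) (plate_density l \<sigma> u v)"
proof -
  let ?M = "lebesgue_on (Omega l)"
  note D = second_L2[OF assms(1)] second_L2[OF assms(2)]
  have "integrable ?M (\<lambda>z. laplace l u z * laplace l v z)"
    unfolding laplace_def by (intro L2_mult L2_add D)
  moreover have "integrable ?M (\<lambda>z. 2 * (uxy l u z * uxy l v z) - uxx l u z * uyy l v z - uyy l u z * uxx l v z)"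
    by (intro Bochner_Integration.integrable_diff integrable_mult_right L2_mult D)
  ultimately show ?thesis
    unfolding plate_density_def[abs_def] by (simp add: mult.assoc)
qed

lemma plate_density_square:
  "plate_density l \<sigma> u u z = (uxx l u z)\<^sup>2 + (uyy l u z)\<^sup>2 + 2 * \<sigma> * (uxx l u z * uyy l u z) + 2 * (1 - \<sigma>) * (uxy l u z)\<^sup>2"
  by (simp add: plate_density_def laplace_def power2_eq_square algebra_simps)

text \<open>The only indefinite term is 2\<sigma> u_xx u_yy, absorbed by \<sigma> times the sum of
  the two squares. This leaves the factor 1 - \<sigma> below and at most 2 above.\<close>

lemma plate_density_bounds:
  assumes "0 < \<sigma>" "\<sigma> < 1"
  shows "(1 - \<sigma>) * ((uxx l u z)\<^sup>2 + (uxy l u z)\<^sup>2 + (uyy l u z)\<^sup>2) \<le> plate_density l \<sigma> u u z"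
    and "plate_density l \<sigma> u u z \<le> 2 * ((uxx l u z)\<^sup>2 + (uxy l u z)\<^sup>2 + (uyy l u z)\<^sup>2)"
proof -
  define a b c where "a = uxx l u z" and "b = uxy l u z" and "c = uyy l u z"
  have 1: "- (a\<^sup>2 + c\<^sup>2) \<le> 2 * (a * c)" "2 * (a * c) \<le> a\<^sup>2 + c\<^sup>2"
    using sum_squares_bound[of a c] sum_squares_bound[of a "-c"] by (simp_all add: mult.assoc)
  have 2: "\<sigma> * (2 * (a * c)) \<le> \<sigma> * (a\<^sup>2 + c\<^sup>2)" "\<sigma> * - (a\<^sup>2 + c\<^sup>2) \<le> \<sigma> * (2 * (a * c))"
    using assms 1 by (intro mult_left_mono; simp)+
  have 3: "0 \<le> (1 - \<sigma>) * b\<^sup>2" "0 \<le> \<sigma> * b\<^sup>2" "0 \<le> (1 - \<sigma>) * (a\<^sup>2 + c\<^sup>2)" using assms by simp_all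
  have "(1 - \<sigma>) * (a\<^sup>2 + b\<^sup>2 + c\<^sup>2) \<le> a\<^sup>2 + c\<^sup>2 + 2 * \<sigma> * (a * c) + 2 * (1 - \<sigma>) * b\<^sup>2"
    using 2 3 by (simp add: algebra_simps)
  moreover have "a\<^sup>2 + c\<^sup>2 + 2 * \<sigma> * (a * c) + 2 * (1 - \<sigma>) * b\<^sup>2 \<le> 2 * (a\<^sup>2 + b\<^sup>2 + c\<^sup>2)"
    using 2 3 by (simp add: algebra_simps)
  ultimately show "(1 - \<sigma>) * ((uxx l u z)\<^sup>2 + (uxy l u z)\<^sup>2 + (uyy l u z)\<^sup>2) \<le> plate_density l \<sigma> u u z"
     "plate_density l \<sigma> u u z \<le> 2 * ((uxx l u z)\<^sup>2 + (uxy l u z)\<^sup>2 + (uyy l u z)\<^sup>2)"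
    by (simp_all add: plate_density_square a_def b_def c_def)
qed

text \<open>The lower bound 1 on the weight lets the form dominate the plain one, so functionals of
  plain dual norm 1 stay bounded; the upper bound W gives continuity with respect to
  \<open>hess\<close>.\<close>

locale weighted_plate =
  fixes l \<sigma> W :: real and w :: "real \<times> real \<Rightarrow> real"
  assumes l: "l > 0" and \<sigma>: "0 < \<sigma>" "\<sigma> < 1"
    and w_measurable: "w \<in> borel_measurable (lebesgue_on (Omega l))"
    and w_ge: "\<And>z. 1 \<le> w z" and w_le: "\<And>z. w z \<le> W"
begin

abbreviation "M \<equiv> lebesgue_on (Omega l)"
abbreviation "a \<equiv> wform l \<sigma> w"

lemma wform_integrable:
  assumes "u \<in> H2star l" "v \<in> H2star l"
  shows "integrable M (\<lambda>z. w z * plate_density l \<sigma> u v z)"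
proof (rule Bochner_Integration.integrable_bound)
  note i = plate_density_integrable[OF assms, of \<sigma>]
  show "integrable M (\<lambda>z. W * plate_density l \<sigma> u v z)" using i by simp
  show "(\<lambda>z. w z * plate_density l \<sigma> u v z) \<in> borel_measurable M"
    using borel_measurable_integrable[OF i] w_measurable by (rule borel_measurable_times[rotated])
  have "\<bar>w z\<bar> \<le> \<bar>W\<bar>" for z using w_ge[of z] w_le[of z] by linarith
  then show "AE z in M. norm (w z * plate_density l \<sigma> u v z) \<le> norm (W * plate_density l \<sigma> u v z)"
    by (intro AE_I2) (simp add: abs_mult mult_right_mono)
qed

lemma wform_sym: "a u v = a v u"
  unfolding wform_def plate_density_def by (simp add: mult_ac add_ac) (simp add: algebra_simps)

lemma wform_lincomb:
  assumes "u \<in> H2star l" "u' \<in> H2star l" "v \<in> H2star l"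
  shows "a (\<lambda>z. r * u z + s * u' z) v = r * a u v + s * a u' v"
proof -
  have "a (\<lambda>z. r * u z + s * u' z) v =
     (LINT z|M. r * (w z * plate_density l \<sigma> u v z) + s * (w z * plate_density l \<sigma> u' v z))"
    unfolding wform_def
  proof (rule integral_cong_AE)
    show "(\<lambda>z. w z * plate_density l \<sigma> (\<lambda>z. r * u z + s * u' z) v z) \<in> borel_measurable M"
      by (rule borel_measurable_integrable[OF wform_integrable[OF H2star_lincomb[OF l assms(1,2)] assms(3)]])
    show "(\<lambda>z. r * (w z * plate_density l \<sigma> u v z) + s * (w z * plate_density l \<sigma> u' v z)) \<in> borel_measurable M"
      using wform_integrable assms by (intro borel_measurable_integrable) auto
    show "AE z in M. w z * plate_density l \<sigma> (\<lambda>z. r * u z + s * u' z) v z =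
        r * (w z * plate_density l \<sigma> u v z) + s * (w z * plate_density l \<sigma> u' v z)"
      using second_lincomb[OF l assms(1,2), of r s]
      by eventually_elim (simp add: plate_density_def laplace_def algebra_simps)
  qed
  also have "\<dots> = r * a u v + s * a u' v"
    unfolding wform_def using wform_integrable assms by simp
  finally show ?thesis .
qed

lemma wform_bounds:
  assumes u: "u \<in> H2star l"
  shows "(1 - \<sigma>) * hess l u \<le> a u u" and "a u u \<le> 2 * W * hess l u"
    and "wform l \<sigma> (\<lambda>_. 1) u u \<le> a u u" and "0 \<le> a u u"
proof -
  let ?q = "\<lambda>z. (uxx l u z)\<^sup>2 + (uxy l u z)\<^sup>2 + (uyy l u z)\<^sup>2" and ?p = "plate_density l \<sigma> u u"
  note D = second_L2[OF u]
  have q: "integrable M ?q" "hess l u = (LINT z|M. ?q z)"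
    using L2_square[OF D(1)] L2_square[OF D(2)] L2_square[OF D(3)] by (auto simp: hess_def)
  have q0: "0 \<le> ?q z" for z by simp
  have p0: "0 \<le> ?p z" for z
    using order_trans[OF mult_nonneg_nonneg[OF _ q0] plate_density_bounds(1)[OF \<sigma>]] \<sigma> by simp
  have W: "0 \<le> W" using w_ge[of "(0,0)"] w_le[of "(0,0)"] by linarith
  note pi = plate_density_integrable[OF u u, of \<sigma>] and wi = wform_integrable[OF u u]
  have pw: "?p z \<le> w z * ?p z" for z using mult_right_mono[OF w_ge p0, of z z] by simp
  show 1: "wform l \<sigma> (\<lambda>_. 1) u u \<le> a u u"
    unfolding wform_def by (rule integral_mono) (use pi wi pw in auto)
  have "(1 - \<sigma>) * hess l u = (LINT z|M. (1 - \<sigma>) * ?q z)" by (simp add: q)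
  also have "\<dots> \<le> wform l \<sigma> (\<lambda>_. 1) u u"
    unfolding wform_def by (rule integral_mono) (use pi q plate_density_bounds(1)[OF \<sigma>] in auto)
  finally show "(1 - \<sigma>) * hess l u \<le> a u u" using 1 by linarith
  show "0 \<le> a u u" unfolding wform_def
    by (rule Bochner_Integration.integral_nonneg) (use order_trans[OF p0 pw] in auto)
  have "integrable M (\<lambda>z. 2 * W * ?q z)" by (intro integrable_mult_right q)
  then have qi: "integrable M (\<lambda>z. W * (2 * ?q z))" by (simp add: mult_ac)
  have "a u u \<le> (LINT z|M. W * (2 * ?q z))"
    unfolding wform_def
  proof (rule integral_mono)
    show "w z * ?p z \<le> W * (2 * ?q z)" for z
      by (intro mult_mono w_le plate_density_bounds \<sigma> W p0)
  qed (fact wi qi)+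
  also have "\<dots> = (LINT z|M. (2 * W) * ?q z)" by (simp add: mult_ac)
  also have "\<dots> = 2 * W * hess l u" unfolding q(2) by (rule integral_mult_right_zero)
  finally show "a u u \<le> 2 * W * hess l u" .
qed

end

subsection \<open>The Riesz representation theorem in a space of functions\<close>

lemma tendsto_zero_square_bound:
  fixes x y :: "nat \<Rightarrow> real"
  assumes "\<And>n. (x n)\<^sup>2 \<le> y n" "y \<longlonglongrightarrow> 0"
  shows "x \<longlonglongrightarrow> 0"
proof (rule tendsto_rabs_zero_cancel, rule tendsto_sandwich[OF _ _ tendsto_const])
  show "\<forall>\<^sub>F n in sequentially. \<bar>x n\<bar> \<le> sqrt (y n)"
    using assms(1) by (intro always_eventually allI real_le_rsqrt) simp
  show "(\<lambda>n. sqrt (y n)) \<longlonglongrightarrow> 0" using tendsto_real_sqrt[OF assms(2)] by simp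
qed simp

text \<open>Hilbert space axioms relative to a set of functions. Definiteness asks for the zero
  function itself, not a null class; \<open>H2star\<close> satisfies this because its elements are
  continuous representatives.\<close>

locale function_hilbert =
  fixes H :: "('a \<Rightarrow> real) set" and B :: "('a \<Rightarrow> real) \<Rightarrow> ('a \<Rightarrow> real) \<Rightarrow> real"
  assumes H_comb: "\<And>u v r s. u \<in> H \<Longrightarrow> v \<in> H \<Longrightarrow> (\<lambda>z. r * u z + s * v z) \<in> H"
    and H_nonempty: "H \<noteq> {}"
    and B_comb: "\<And>u u' v r s. u \<in> H \<Longrightarrow> u' \<in> H \<Longrightarrow> v \<in> H \<Longrightarrow> B (\<lambda>z. r * u z + s * u' z) v = r * B u v + s * B u' v"
    and B_sym: "\<And>u v. B u v = B v u"
    and B_nonneg: "\<And>u. u \<in> H \<Longrightarrow> 0 \<le> B u u"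
    and B_definite: "\<And>u. u \<in> H \<Longrightarrow> B u u = 0 \<Longrightarrow> u = (\<lambda>_. 0)"
    and B_complete: "\<And>U. (\<And>n. U n \<in> H) \<Longrightarrow>
      (\<And>e. e > 0 \<Longrightarrow> \<exists>N. \<forall>i\<ge>N. \<forall>j\<ge>N. B (\<lambda>z. U i z - U j z) (\<lambda>z. U i z - U j z) < e) \<Longrightarrow>
      \<exists>u\<in>H. (\<lambda>n. B (\<lambda>z. U n z - u z) (\<lambda>z. U n z - u z)) \<longlonglongrightarrow> 0"
begin

definition linear_on :: "(('a \<Rightarrow> real) \<Rightarrow> real) \<Rightarrow> bool" where
  "linear_on F \<longleftrightarrow> (\<forall>u\<in>H. \<forall>v\<in>H. \<forall>r s. F (\<lambda>z. r * u z + s * v z) = r * F u + s * F v)"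

lemma H_diff: "u \<in> H \<Longrightarrow> v \<in> H \<Longrightarrow> (\<lambda>z. u z - v z) \<in> H"
  using H_comb[of u v 1 "-1"] by simp

lemma B_diff: "u \<in> H \<Longrightarrow> u' \<in> H \<Longrightarrow> v \<in> H \<Longrightarrow> B (\<lambda>z. u z - u' z) v = B u v - B u' v"
  using B_comb[of u u' v 1 "-1"] by simp

lemma B_square_comb:
  assumes "u \<in> H" "v \<in> H"
  shows "B (\<lambda>z. r * u z + s * v z) (\<lambda>z. r * u z + s * v z) = r\<^sup>2 * B u u + 2 * r * s * B u v + s\<^sup>2 * B v v"
proof -
  let ?w = "\<lambda>z. r * u z + s * v z"
  have "B ?w ?w = r * B u ?w + s * B v ?w" by (intro B_comb assms H_comb)
  also have "B u ?w = r * B u u + s * B u v" using B_comb[OF assms assms(1), of r s] by (simp add: B_sym)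
  also have "B v ?w = r * B u v + s * B v v" using B_comb[OF assms assms(2), of r s] by (simp add: B_sym)
  finally show ?thesis by (simp add: power2_eq_square algebra_simps)
qed

lemma B_square_diff:
  assumes "u \<in> H" "v \<in> H"
  shows "B (\<lambda>z. u z - v z) (\<lambda>z. u z - v z) = B u u - 2 * B u v + B v v"
  using B_square_comb[OF assms, of 1 "-1"] by simp

lemma B_CS:
  assumes "u \<in> H" "v \<in> H" shows "(B u v)\<^sup>2 \<le> B u u * B v v"
proof (rule quadratic_nonneg_imp)
  show "0 \<le> t\<^sup>2 * B u u + 2 * t * B u v + B v v" for t
    using B_nonneg[OF H_comb[OF assms, of t 1]] B_square_comb[OF assms, of t 1] by simp
qed (rule B_nonneg[OF assms(1)])

lemma B_CS_sqrt:
  assumes "u \<in> H" "v \<in> H" shows "\<bar>B u v\<bar> \<le> sqrt (B u u) * sqrt (B v v)"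
  using real_sqrt_le_mono[OF B_CS[OF assms]] by (simp add: real_sqrt_mult)

text \<open>Direct method: minimize B(v, v) - 2 F(v). Minimizing sequences are Cauchy by the
  parallelogram law, and the representation is the Euler equation of the limit.\<close>

theorem riesz:
  assumes F: "linear_on F" and bdd: "\<And>v. v \<in> H \<Longrightarrow> \<bar>F v\<bar> \<le> C * sqrt (B v v)"
  obtains u where "u \<in> H" "\<And>v. v \<in> H \<Longrightarrow> B u v = F v"
proof -
  define E where "E v = B v v - 2 * F v" for v
  have Fc: "F (\<lambda>z. r * u z + s * v z) = r * F u + s * F v" if "u \<in> H" "v \<in> H" for u v r s
    using F that by (simp add: linear_on_def)
  \<comment> \<open>Completing the square in the norm of v.\<close>
  have low: "- (C\<^sup>2) \<le> E v" if v: "v \<in> H" for v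
  proof -
    have "(sqrt (B v v))\<^sup>2 = B v v" using B_nonneg[OF v] by simp
    then have "E v \<ge> (sqrt (B v v))\<^sup>2 - 2 * (C * sqrt (B v v))" using bdd[OF v] by (simp add: E_def)
    also have "(sqrt (B v v))\<^sup>2 - 2 * (C * sqrt (B v v)) = (sqrt (B v v) - C)\<^sup>2 - C\<^sup>2"
      by (simp add: power2_eq_square algebra_simps)
    finally show ?thesis using zero_le_power2[of "sqrt (B v v) - C"] by linarith
  qed
  define I where "I = Inf (E ` H)"
  have bb: "bdd_below (E ` H)" using low by (auto intro: bdd_belowI[of _ "- (C\<^sup>2)"])
  have I: "I \<le> E v" if "v \<in> H" for v
    unfolding I_def using bb that by (intro cInf_lower) auto
  have "\<exists>v. v \<in> H \<and> E v < I + inverse (real (Suc n))" for n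
    using cInf_lessD[of "E ` H" "I + inverse (real (Suc n))"] H_nonempty
    by (auto simp: I_def)
  then obtain V where V: "\<And>n. V n \<in> H" "\<And>n. E (V n) < I + inverse (real (Suc n))" by metis
  \<comment> \<open>The squared distance equals 2 E(V i) + 2 E(V j) - 4 E of the midpoint, and the
    last energy is at least the infimum.\<close>
  have par: "B (\<lambda>z. V i z - V j z) (\<lambda>z. V i z - V j z) < 2 * inverse (real (Suc i)) + 2 * inverse (real (Suc j))" for i j
  proof -
    let ?m = "\<lambda>z. (1/2) * V i z + (1/2) * V j z"
    have m: "?m \<in> H" by (intro H_comb V)
    have "E ?m = B (V i) (V i) / 4 + B (V i) (V j) / 2 + B (V j) (V j) / 4 - F (V i) - F (V j)"
      unfolding E_def by (simp only: B_square_comb[OF V(1) V(1)] Fc[OF V(1) V(1)]) (simp add: power2_eq_square)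
    then have "B (\<lambda>z. V i z - V j z) (\<lambda>z. V i z - V j z) = 2 * E (V i) + 2 * E (V j) - 4 * E ?m"
      by (simp add: B_square_diff[OF V(1) V(1)] E_def)
    then show ?thesis using I[OF m] V(2)[of i] V(2)[of j] by linarith
  qed
  have "\<exists>N. \<forall>i\<ge>N. \<forall>j\<ge>N. B (\<lambda>z. V i z - V j z) (\<lambda>z. V i z - V j z) < e" if "e > 0" for e
  proof -
    have "e / 4 > 0" using that by simp
    from reals_Archimedean[OF this] obtain N where N: "inverse (real (Suc N)) < e / 4" by blast
    have "inverse (real (Suc i)) < e / 4" if "i \<ge> N" for i
    proof -
      have "inverse (real (Suc i)) \<le> inverse (real (Suc N))" using that by (intro le_imp_inverse_le) auto
      then show ?thesis using N by linarith
    qed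
    then have "B (\<lambda>z. V i z - V j z) (\<lambda>z. V i z - V j z) < e" if "i \<ge> N" "j \<ge> N" for i j
      using par[of i j] \<open>\<And>i. i \<ge> N \<Longrightarrow> inverse (real (Suc i)) < e / 4\<close>[of i]
        \<open>\<And>i. i \<ge> N \<Longrightarrow> inverse (real (Suc i)) < e / 4\<close>[of j] that by linarith
    then show ?thesis by blast
  qed
  from B_complete[OF V(1) this] obtain u where u: "u \<in> H"
    and lim: "(\<lambda>n. B (\<lambda>z. V n z - u z) (\<lambda>z. V n z - u z)) \<longlonglongrightarrow> 0" by blast
  have "B u p = F p" if p: "p \<in> H" for p
  proof -
    \<comment> \<open>Comparing V n + t p with the infimum for every t gives a quadratic in t that
      is nonnegative up to the error 1/(n+1); its discriminant bounds the residual.\<close>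
    have "(B (V n) p - F p)\<^sup>2 \<le> B p p * inverse (real (Suc n))" for n
    proof (rule quadratic_nonneg_imp[OF _ B_nonneg[OF p]])
      fix t
      have "I \<le> E (\<lambda>z. 1 * V n z + t * p z)" by (intro I H_comb V p)
      also have "\<dots> = E (V n) + t\<^sup>2 * B p p + 2 * t * (B (V n) p - F p)"
        unfolding E_def by (simp only: B_square_comb[OF V(1) p] Fc[OF V(1) p]) (simp add: algebra_simps)
      finally show "0 \<le> t\<^sup>2 * B p p + 2 * t * (B (V n) p - F p) + inverse (real (Suc n))" using V(2)[of n] by linarith
    qed
    moreover have "(\<lambda>n. B p p * inverse (real (Suc n))) \<longlonglongrightarrow> 0"
      using tendsto_mult_right_zero[OF LIMSEQ_inverse_real_of_nat] by blast
    ultimately have 1: "(\<lambda>n. B (V n) p - F p) \<longlonglongrightarrow> 0" by (rule tendsto_zero_square_bound)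
    have "(B (V n) p - B u p)\<^sup>2 \<le> B (\<lambda>z. V n z - u z) (\<lambda>z. V n z - u z) * B p p" for n
      using B_CS[OF H_diff[OF V(1) u] p, of n] by (simp add: B_diff[OF V(1) u p])
    moreover have "(\<lambda>n. B (\<lambda>z. V n z - u z) (\<lambda>z. V n z - u z) * B p p) \<longlonglongrightarrow> 0"
      using tendsto_mult_left_zero[OF lim] by blast
    ultimately have 2: "(\<lambda>n. B (V n) p - B u p) \<longlonglongrightarrow> 0" by (rule tendsto_zero_square_bound)
    from tendsto_diff[OF 1 2] show ?thesis by (simp add: LIMSEQ_const_iff)
  qed
  with u that show ?thesis by blast
qed

text \<open>Completing the square gives E v = E u + B(v - u, v - u)/2, so u is the only minimizer
  and the definite description is meaningful.\<close>

lemma arg_min_eq: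
  assumes F: "linear_on F" and u: "u \<in> H" "\<And>v. v \<in> H \<Longrightarrow> B u v = F v"
    and E: "\<And>v. v \<in> H \<Longrightarrow> E v = B v v / 2 - F v"
  shows "(THE x. is_arg_min E (\<lambda>v. v \<in> H) x) = u"
proof (rule the_equality)
  have diff: "E v = E u + B (\<lambda>z. v z - u z) (\<lambda>z. v z - u z) / 2" if v: "v \<in> H" for v
  proof -
    have "B v u = F v" using u(2)[OF v] by (subst B_sym)
    then have "B (\<lambda>z. v z - u z) (\<lambda>z. v z - u z) = B v v - 2 * F v + F u"
      by (simp only: B_square_diff[OF v u(1)] u(2)[OF u(1)])
    then show ?thesis unfolding E[OF v] E[OF u(1)] u(2)[OF u(1)] by linarith
  qed
  have "E u \<le> E v" if v: "v \<in> H" for v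
    using diff[OF v] B_nonneg[OF H_diff[OF v u(1)]] by linarith
  then show "is_arg_min E (\<lambda>v. v \<in> H) u"
    unfolding is_arg_min_def using u(1) by (meson not_less)
  fix x assume "is_arg_min E (\<lambda>v. v \<in> H) x"
  then have x: "x \<in> H" "\<not> E u < E x" using u(1) by (auto simp: is_arg_min_def)
  then have "B (\<lambda>z. x z - u z) (\<lambda>z. x z - u z) = 0" using diff[OF x(1)] B_nonneg[OF H_diff[OF x(1) u(1)]] by linarith
  then have "(\<lambda>z. x z - u z) = (\<lambda>_. 0)" by (rule B_definite[OF H_diff[OF x(1) u(1)]])
  then show "x = u" by (metis (no_types) eq_iff_diff_eq_0 ext)
qed

end

sublocale weighted_plate \<subseteq> function_hilbert "H2star l" "wform l \<sigma> w"
proof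
  show "(\<lambda>z. r * u z + s * v z) \<in> H2star l" if "u \<in> H2star l" "v \<in> H2star l" for u v r s
    by (rule H2star_lincomb[OF l that])
  have "(\<lambda>_. 0) \<in> H2star l"
  proof -
    have "has_weak_deriv (Omega l) bs (\<lambda>_. 0) (\<lambda>_. 0)" for bs
      unfolding has_weak_deriv_def Lp_space_2 by (simp add: L2_def)
    then show ?thesis unfolding H2star_def H2_def Lp_space_2 by (auto simp: L2_def)
  qed
  then show "H2star l \<noteq> {}" by blast
  show "a (\<lambda>z. r * u z + s * u' z) v = r * a u v + s * a u' v"
    if "u \<in> H2star l" "u' \<in> H2star l" "v \<in> H2star l" for u u' v r s
    by (rule wform_lincomb[OF that])
  show "a u v = a v u" for u v by (rule wform_sym)
  show "0 \<le> a u u" if "u \<in> H2star l" for u by (rule wform_bounds(4)[OF that])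
  show "u = (\<lambda>_. 0)" if u: "u \<in> H2star l" "a u u = 0" for u
  proof -
    \<comment> \<open>Zero energy means zero \<open>hess\<close>, and the sup bound then forces u to
      vanish at every point.\<close>
    have "(1 - \<sigma>) * hess l u \<le> 0" using wform_bounds(1)[OF u(1)] u(2) by simp
    then have "hess l u = 0" using \<sigma> hess_nonneg[of l u] by (simp add: mult_le_0_iff)
    moreover obtain K where "\<And>z. \<bar>u z\<bar> \<le> K * sqrt (hess l u)" using sup_bound[OF l] u(1) by metis
    ultimately show ?thesis by auto
  qed
  fix U :: "nat \<Rightarrow> real \<times> real \<Rightarrow> real" assume U: "\<And>n. U n \<in> H2star l"
    and C: "\<And>e. e > 0 \<Longrightarrow> \<exists>N. \<forall>i\<ge>N. \<forall>j\<ge>N. a (\<lambda>z. U i z - U j z) (\<lambda>z. U i z - U j z) < e"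
  have cauchy: "\<exists>N. \<forall>i\<ge>N. \<forall>j\<ge>N. hess l (\<lambda>z. U i z - U j z) < e" if "e > 0" for e
  proof -
    have "(1 - \<sigma>) * e > 0" using that \<sigma> by simp
    from C[OF this] obtain N where N: "\<And>i j. i \<ge> N \<Longrightarrow> j \<ge> N \<Longrightarrow> a (\<lambda>z. U i z - U j z) (\<lambda>z. U i z - U j z) < (1 - \<sigma>) * e" by blast
    have "hess l (\<lambda>z. U i z - U j z) < e" if "i \<ge> N" "j \<ge> N" for i j
    proof -
      have "(1 - \<sigma>) * hess l (\<lambda>z. U i z - U j z) < (1 - \<sigma>) * e"
        using N[OF that] wform_bounds(1)[OF H2star_diff[OF l U[of i] U[of j]]] by linarith
      then show ?thesis using \<sigma> by simp
    qed
    then show ?thesis by blast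
  qed
  obtain u where u: "u \<in> H2star l" and lim: "(\<lambda>n. hess l (\<lambda>z. U n z - u z)) \<longlonglongrightarrow> 0"
    by (rule H2star_complete[OF l U cauchy])
  have "(\<lambda>n. a (\<lambda>z. U n z - u z) (\<lambda>z. U n z - u z)) \<longlonglongrightarrow> 0"
  proof (rule tendsto_sandwich[OF _ _ tendsto_const])
    show "(\<lambda>n. 2 * W * hess l (\<lambda>z. U n z - u z)) \<longlonglongrightarrow> 0" by (rule tendsto_mult_right_zero[OF lim])
  qed (use wform_bounds(2,4)[OF H2star_diff[OF l U u]] in auto)
  with u show "\<exists>u\<in>H2star l. (\<lambda>n. a (\<lambda>z. U n z - u z) (\<lambda>z. U n z - u z)) \<longlonglongrightarrow> 0" by blast
qed

subsection \<open>The energy space is nontrivial\<close>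

lemma test_slice_DERIV:
  assumes \<phi>: "\<phi> \<in> test_functions S"
  shows "((\<lambda>x. \<phi> (x, t)) has_real_derivative frechet_derivative \<phi> (at (x, t)) (1, 0)) (at x)"
    and "((\<lambda>t. \<phi> (x, t)) has_real_derivative frechet_derivative \<phi> (at (x, t)) (0, 1)) (at t)"
proof -
  have "Ck (Suc 0) \<phi>" using \<phi> unfolding test_functions_def by blast
  then have "\<phi> differentiable (at (x, t))" by (simp add: differentiable_on_def)
  then have D: "(\<phi> has_derivative frechet_derivative \<phi> (at (x, t))) (at (x, t))"
    by (simp add: frechet_derivative_works)
  have lin: "linear (frechet_derivative \<phi> (at (x, t)))" using D by (rule has_derivative_linear)
  have "((\<lambda>x. \<phi> (x, t)) has_derivative (\<lambda>h. frechet_derivative \<phi> (at (x, t)) (h, 0))) (at x)"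
    by (rule has_derivative_compose[of "\<lambda>x. (x, t)" "\<lambda>h. (h, 0)" x UNIV \<phi>, OF _ D]) (auto intro!: derivative_eq_intros)
  moreover have "(\<lambda>h. frechet_derivative \<phi> (at (x, t)) (h, 0)) = (*) (frechet_derivative \<phi> (at (x, t)) (1, 0))"
  proof
    fix h show "frechet_derivative \<phi> (at (x, t)) (h, 0) = frechet_derivative \<phi> (at (x, t)) (1, 0) * h"
      using linear_cmul[OF lin, of h "(1, 0)"] by (simp del: linear_cmul add: mult.commute)
  qed
  ultimately show "((\<lambda>x. \<phi> (x, t)) has_real_derivative frechet_derivative \<phi> (at (x, t)) (1, 0)) (at x)"
    by (simp add: has_field_derivative_def)
  have "((\<lambda>t. \<phi> (x, t)) has_derivative (\<lambda>h. frechet_derivative \<phi> (at (x, t)) (0, h))) (at t)"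
    by (rule has_derivative_compose[of "\<lambda>t. (x, t)" "\<lambda>h. (0, h)" t UNIV \<phi>, OF _ D]) (auto intro!: derivative_eq_intros)
  moreover have "(\<lambda>h. frechet_derivative \<phi> (at (x, t)) (0, h)) = (*) (frechet_derivative \<phi> (at (x, t)) (0, 1))"
  proof
    fix h show "frechet_derivative \<phi> (at (x, t)) (0, h) = frechet_derivative \<phi> (at (x, t)) (0, 1) * h"
      using linear_cmul[OF lin, of h "(0, 1)"] by (simp del: linear_cmul add: mult.commute)
  qed
  ultimately show "((\<lambda>t. \<phi> (x, t)) has_real_derivative frechet_derivative \<phi> (at (x, t)) (0, 1)) (at t)"
    by (simp add: has_field_derivative_def)
qed

lemma test_zero_outside: "\<phi> \<in> test_functions S \<Longrightarrow> z \<notin> S \<Longrightarrow> \<phi> z = 0"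
  unfolding test_functions_def using closure_subset[of "{z. \<phi> z \<noteq> 0}"] by blast

lemma integral_derivative_zero:
  fixes F :: "real \<Rightarrow> real"
  assumes "a \<le> b" "\<And>x. (F has_real_derivative f x) (at x)" "continuous_on UNIV f" "F a = 0" "F b = 0" "\<And>x. x \<notin> {a..b} \<Longrightarrow> f x = 0"
  shows "(LINT x|lborel. f x) = 0"
proof -
  have "(LINT x|lborel. f x * indicator {a..b} x) = F b - F a"
    using assms by (intro integral_FTC_Icc_real) (auto simp: continuous_on_eq_continuous_at)
  then show ?thesis using assms Icc_indicator_integral[of a b f] by simp
qed

lemma Omega_continuous_integrable:
  assumes "continuous_on UNIV W" "\<And>z. z \<notin> Omega l \<Longrightarrow> W z = (0::real)"
  shows "integrable (lborel \<Otimes>\<^sub>M lborel) W"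
proof -
  let ?K = "{0..pi} \<times> {-l..l}"
  have "integrable lborel (\<lambda>z. indicator ?K z *\<^sub>R W z)"
    by (intro borel_integrable_compact compact_Times compact_Icc continuous_on_subset[OF assms(1)]) auto
  moreover have "(\<lambda>z. indicator ?K z *\<^sub>R W z) = W"
  proof
    fix z show "indicator ?K z *\<^sub>R W z = W z"
      using assms(2)[of z] by (cases "z \<in> ?K") (auto simp: Omega_def mem_Times_iff)
  qed
  ultimately show ?thesis by (simp add: lborel_prod)
qed

text \<open>The classical derivative of a product is its weak one: by the product rule the integrand
  W is a partial derivative of \<open>tens f g\<close> times \<phi>, which vanishes at both ends of
  every line in that direction.\<close>

lemma tens_weak_deriv:
  assumes l: "l > 0" and f: "f \<in> tests 0 pi" "\<And>x. (f has_real_derivative f' x) (at x)"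
    and g: "g \<in> tests (-l) l" "\<And>x. (g has_real_derivative g' x) (at x)"
  shows "has_weak_deriv (Omega l) [(1, 0)] (tens f g) (tens f' g)"
    and "has_weak_deriv (Omega l) [(0, 1)] (tens f g) (tens f g')"
proof -
  let ?M = "lebesgue_on (Omega l)"
  have f': "f' \<in> tests 0 pi" and g': "g' \<in> tests (-l) l" using tests_deriv f g by blast+
  have L: "tens f g \<in> L2 ?M" "tens f' g \<in> L2 ?M" "tens f g' \<in> L2 ?M"
    using f g f' g' by (auto intro!: test_L2[OF Omega_lmeasurable] tens_test)
  have main: "(LINT z|?M. tens f g z * frechet_derivative \<phi> (at z) b) = - (LINT z|?M. T z * \<phi> z)"
    if \<phi>: "\<phi> \<in> test_functions (Omega l)" and b: "b = (1, 0) \<and> T = tens f' g \<or> b = (0, 1) \<and> T = tens f g'" for \<phi> b T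
  proof -
    let ?D = "\<lambda>z. frechet_derivative \<phi> (at z) b"
    have D: "?D \<in> test_functions (Omega l)" using b by (intro test_frechet[OF \<phi>]) (auto simp: Basis_real_prod)
    have TL: "T \<in> L2 ?M" using b L by auto
    \<comment> \<open>Continuity of W and its vanishing off the rectangle allow Fubini in either
      order; the line of integration follows the direction b.\<close>
    define W where "W z = T z * \<phi> z + tens f g z * ?D z" for z
    have cW: "continuous_on UNIV W"
      unfolding W_def using b
      by (auto intro!: continuous_on_add continuous_on_mult test_continuous[OF \<phi>] test_continuous[OF D] continuous_on_tens
          tests_continuous[OF f(1)] tests_continuous[OF f'] tests_continuous[OF g(1)] tests_continuous[OF g'])
    have W0: "W z = 0" if "z \<notin> Omega l" for z
      using test_zero_outside[OF \<phi> that] test_zero_outside[OF D that] by (simp add: W_def)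
    note Wi = Omega_continuous_integrable[OF cW W0]
    have "(LINT z|?M. W z) = (LINT z|(lborel \<Otimes>\<^sub>M lborel). W z)"
      by (rule Omega_integral(2)[OF borel_measurable_continuous_onI[OF cW] W0])
    also have "\<dots> = 0"
    proof -
      note sl = test_slice_DERIV[OF \<phi>]
      from b consider "b = (1, 0)" "T = tens f' g" | "b = (0, 1)" "T = tens f g'" by blast
      then show ?thesis
      proof cases
        case 1
        have "(LINT x|lborel. W (x, t)) = 0" for t
        proof (rule integral_derivative_zero[where F = "\<lambda>x. tens f g (x, t) * \<phi> (x, t)" and a = 0 and b = pi])
          show "((\<lambda>x. tens f g (x, t) * \<phi> (x, t)) has_real_derivative W (x, t)) (at x)" for x
            unfolding tens_def using f(2) sl(1)
            by (auto intro!: derivative_eq_intros simp: W_def tens_def 1)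
          show "continuous_on UNIV (\<lambda>x. W (x, t))"
            by (intro continuous_on_compose2[OF cW]) (auto intro!: continuous_intros)
          show "W (x, t) = 0" if "x \<notin> {0..pi}" for x using that by (intro W0) (auto simp: Omega_def)
        qed (use tests_zero[OF f(1)] in \<open>auto simp: tens_def\<close>)
        moreover have "(LINT t|lborel. LINT x|lborel. W (x, t)) = (LINT z|(lborel \<Otimes>\<^sub>M lborel). W z)"
          using lborel_pair.integral_snd[of "\<lambda>x t. W (x, t)"] Wi by (simp only: case_prod_eta)
        ultimately show ?thesis by simp
      next
        case 2
        have "(LINT t|lborel. W (x, t)) = 0" for x
        proof (rule integral_derivative_zero[where F = "\<lambda>t. tens f g (x, t) * \<phi> (x, t)" and a = "-l" and b = l])
          show "((\<lambda>t. tens f g (x, t) * \<phi> (x, t)) has_real_derivative W (x, t)) (at t)" for t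
            unfolding tens_def using g(2) sl(2)
            by (auto intro!: derivative_eq_intros simp: W_def tens_def 2)
          show "continuous_on UNIV (\<lambda>t. W (x, t))"
            by (intro continuous_on_compose2[OF cW]) (auto intro!: continuous_intros)
          show "W (x, t) = 0" if "t \<notin> {-l..l}" for t using that by (intro W0) (auto simp: Omega_def)
        qed (use tests_zero[OF g(1)] l in \<open>auto simp: tens_def\<close>)
        moreover have "(LINT x|lborel. LINT t|lborel. W (x, t)) = (LINT z|(lborel \<Otimes>\<^sub>M lborel). W z)"
          using lborel_pair.integral_fst'[OF Wi] by simp
        ultimately show ?thesis by simp
      qed
    qed
    finally have "(LINT z|?M. T z * \<phi> z + tens f g z * ?D z) = 0" by (simp add: W_def)
    then show ?thesis
      using L2_mult[OF TL test_L2[OF Omega_lmeasurable \<phi>]] L2_mult[OF L(1) test_L2[OF Omega_lmeasurable D]] by simp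
  qed
  show "has_weak_deriv (Omega l) [(1, 0)] (tens f g) (tens f' g)"
    unfolding has_weak_deriv_def Lp_space_2 using L main by (simp add: pderivs_def)
  show "has_weak_deriv (Omega l) [(0, 1)] (tens f g) (tens f g')"
    unfolding has_weak_deriv_def Lp_space_2 using L main by (simp add: pderivs_def)
qed

text \<open>\<open>pderivs [b1, b2]\<close> differentiates first along \<open>b2\<close>, so the
  derivative along \<open>b2\<close> is itself the test function for \<open>g\<close>; the two signs
  cancel.\<close>

lemma has_weak_deriv_compose:
  assumes g: "has_weak_deriv S [b1] u g" and h: "has_weak_deriv S [b2] g h" and b: "b2 \<in> Basis"
  shows "has_weak_deriv S [b1, b2] u h"
  unfolding has_weak_deriv_def Lp_space_2
proof (intro conjI ballI)
  show "u \<in> L2 (lebesgue_on S)" "h \<in> L2 (lebesgue_on S)" using has_weak_deriv_L2 g h by blast+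
  fix \<phi> assume \<phi>: "\<phi> \<in> test_functions S"
  have "pderivs [b1, b2] \<phi> = pderivs [b1] (pderivs [b2] \<phi>)" by (simp add: pderivs_def)
  moreover have "pderivs [b2] \<phi> \<in> test_functions S" using test_pderivs[OF \<phi>, of "[b2]"] b by simp
  ultimately show "(LINT z|lebesgue_on S. u z * pderivs [b1, b2] \<phi> z) = (- 1) ^ length [b1, b2] * (LINT z|lebesgue_on S. h z * \<phi> z)"
    using has_weak_deriv_test[OF g] has_weak_deriv_test[OF h \<phi>] by simp
qed

lemma tens_H2star:
  assumes l: "l > 0" and f: "f \<in> tests 0 pi" and g: "g \<in> tests (-l) l"
  shows "tens f g \<in> H2star l"
proof -
  let ?M = "lebesgue_on (Omega l)"
  have t: "\<exists>f' g'. f' \<in> tests 0 pi \<and> g' \<in> tests (-l) l \<and> has_weak_deriv (Omega l) [b] (tens f g) (tens f' g')"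
    if fg: "f \<in> tests 0 pi" "g \<in> tests (-l) l" "b \<in> Basis" for f g b
  proof -
    obtain f' where f': "\<And>x. (f has_real_derivative f' x) (at x)" "f' \<in> tests 0 pi" using tests_obtain_deriv[OF fg(1)] by blast
    obtain g' where g': "\<And>x. (g has_real_derivative g' x) (at x)" "g' \<in> tests (-l) l" using tests_obtain_deriv[OF fg(2)] by blast
    show ?thesis using tens_weak_deriv[OF l fg(1) f'(1) fg(2) g'(1)] fg f'(2) g'(2) unfolding Basis_real_prod by blast
  qed
  have L: "tens f g \<in> L2 ?M" by (intro test_L2[OF Omega_lmeasurable] tens_test f g)
  have "\<exists>h. has_weak_deriv (Omega l) bs (tens f g) h" if bs: "set bs \<subseteq> Basis" "length bs \<le> 2" for bs
  proof -
    consider "bs = []" | b where "bs = [b]" "b \<in> Basis" | a b where "bs = [a, b]" "a \<in> Basis" "b \<in> Basis"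
      using bs by (cases bs; cases "tl bs"; auto simp: length_Suc_conv)
    then show ?thesis
    proof cases
      case 1
      have "has_weak_deriv (Omega l) [] (tens f g) (tens f g)"
        using L unfolding has_weak_deriv_def Lp_space_2 by (simp add: pderivs_def)
      then show ?thesis using 1 by blast
    next
      case 2
      then show ?thesis using t[OF f g] by blast
    next
      case 3
      obtain f' g' where 1: "f' \<in> tests 0 pi" "g' \<in> tests (-l) l" "has_weak_deriv (Omega l) [a] (tens f g) (tens f' g')"
        using t[OF f g 3(2)] by blast
      obtain h where "has_weak_deriv (Omega l) [b] (tens f' g') h" using t[OF 1(1,2) 3(3)] by blast
      from has_weak_deriv_compose[OF 1(3) this 3(3)] show ?thesis using 3(1) by blast
    qed
  qed
  moreover have "tens f g z = 0" if "z \<notin> Omega l" for z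
    using tens_test[OF f g] that by (rule test_zero_outside)
  moreover have "continuous_on (closure (Omega l)) (tens f g)"
    by (rule continuous_on_tens[OF tests_continuous[OF f] tests_continuous[OF g]])
  moreover have "z \<notin> Omega l" if "z \<notin> closure (Omega l) \<or> z \<in> {0, pi} \<times> {-l<..<l}" for z
    using that closure_subset[of "Omega l"] by (auto simp: Omega_def)
  ultimately show ?thesis
    using L unfolding H2star_def H2_def Lp_space_2 by simp
qed

text \<open>Guarantees a functional of dual norm 1 at points where the gap functional vanishes
  identically; a product of two bumps is a nonzero element.\<close>

lemma (in weighted_plate) nontrivial: obtains u where "u \<in> H2star l" "a u u > 0"
proof -
  have ll: "-l < l" using l by simp
  let ?f = "dlt 0 pi 0 0" and ?g = "dlt (-l) l 0 0"
  have "\<exists>x. ?f x \<noteq> 0"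
  proof (rule ccontr)
    assume "\<nexists>x. ?f x \<noteq> 0"
    then have "(LINT s|lborel. ?f s) = 0" by simp
    then show False using dlt_integral(2)[of 0 pi 0 0] by simp
  qed
  then obtain x where x: "?f x \<noteq> 0" by blast
  have "\<exists>x. ?g x \<noteq> 0"
  proof (rule ccontr)
    assume "\<nexists>x. ?g x \<noteq> 0"
    then have "(LINT s|lborel. ?g s) = 0" by simp
    then show False using dlt_integral(2)[OF ll, of 0 0] by simp
  qed
  then obtain y where y: "?g y \<noteq> 0" by blast
  have H: "tens ?f ?g \<in> H2star l" by (rule tens_H2star[OF l dlt_tests dlt_tests]) (use ll in auto)
  have "tens ?f ?g (x, y) \<noteq> 0" using x y by (simp add: tens_def)
  then have "a (tens ?f ?g) (tens ?f ?g) \<noteq> 0" using B_definite[OF H] by metis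
  then show ?thesis using that[OF H] B_nonneg[OF H] by linarith
qed

subsection \<open>Duality in Lebesgue spaces\<close>

abbreviation Lp_sphere :: "'a measure \<Rightarrow> ereal \<Rightarrow> ('a \<Rightarrow> real) set" where
  "Lp_sphere M p \<equiv> {f \<in> Lp_space M p. Lp_norm M p f = 1}"

lemma Lp_sphere_finite:
  assumes r: "r > 1"
  shows "f \<in> Lp_sphere M (ereal r) \<longleftrightarrow>
    f \<in> borel_measurable M \<and> integrable M (\<lambda>z. \<bar>f z\<bar> powr r) \<and> (LINT z|M. \<bar>f z\<bar> powr r) = 1"
proof -
  have "(LINT z|M. \<bar>f z\<bar> powr r) powr (1 / r) = 1 \<longleftrightarrow> (LINT z|M. \<bar>f z\<bar> powr r) = 1" (is "?I powr _ = 1 \<longleftrightarrow> _")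
  proof
    assume *: "?I powr (1 / r) = 1"
    have "?I \<ge> 0" by simp
    then have "?I = (?I powr (1 / r)) powr r" using r by (simp add: powr_powr)
    then show "?I = 1" using * by simp
  qed simp
  then show ?thesis by (auto simp: Lp_space_def Lp_norm_def)
qed

lemma Lp_sphere_infinity:
  assumes "f \<in> Lp_sphere M \<infinity>"
  shows "f \<in> borel_measurable M" "AE z in M. \<bar>f z\<bar> \<le> 1"
proof -
  show "f \<in> borel_measurable M" using assms by (simp add: Lp_space_def)
  have e: "real_of_ereal (esssup M (\<lambda>z. ereal \<bar>f z\<bar>)) = 1" using assms by (simp add: Lp_norm_def)
  \<comment> \<open>\<open>real_of_ereal\<close> maps both infinities to 0, so the real value 1
    identifies the essential supremum.\<close>
  then have "esssup M (\<lambda>z. ereal \<bar>f z\<bar>) = ereal 1"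
    by (cases "esssup M (\<lambda>z. ereal \<bar>f z\<bar>)") auto
  then show "AE z in M. \<bar>f z\<bar> \<le> 1" using esssup_AE[of "\<lambda>z. ereal \<bar>f z\<bar>" M] by simp
qed

lemma (in finite_measure) Lp_sphere_integrable:
  assumes p: "1 < p" and f: "f \<in> Lp_sphere M p"
  shows "integrable M f"
proof (cases p)
  case (real r)
  then have r: "r > 1" using p by (simp add: one_ereal_def)
  have f': "f \<in> borel_measurable M" "integrable M (\<lambda>z. \<bar>f z\<bar> powr r)"
    using f real Lp_sphere_finite[OF r] by auto
  show ?thesis
  proof (rule Bochner_Integration.integrable_bound)
    show "integrable M (\<lambda>z. 1 + \<bar>f z\<bar> powr r)" using f' by simp
    have "\<bar>x\<bar> \<le> 1 + \<bar>x\<bar> powr r" for x :: real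
    proof (cases "\<bar>x\<bar> \<le> 1")
      case False
      then have "\<bar>x\<bar> powr 1 \<le> \<bar>x\<bar> powr r" using r by (intro powr_mono) auto
      then show ?thesis using False by simp
    qed (simp add: add_increasing2)
    then show "AE z in M. norm (f z) \<le> norm (1 + \<bar>f z\<bar> powr r)" by simp
  qed (use f' in simp)
next
  case PInf
  then have f': "f \<in> borel_measurable M" "AE z in M. \<bar>f z\<bar> \<le> 1" using Lp_sphere_infinity f by auto
  show ?thesis
    by (rule integrable_const_bound[of _ 1]) (use f' in auto)
qed (use p in auto)

lemma Lp_sphere_abs: "f \<in> Lp_sphere M p \<Longrightarrow> (\<lambda>z. \<bar>f z\<bar>) \<in> Lp_sphere M p"
  by (auto simp: Lp_space_def Lp_norm_def)

text \<open>The extremal is the sign of h, set to 1 where h vanishes so that its modulus is 1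
  everywhere and its norm is exactly 1 on a space of nonzero measure.\<close>

lemma (in finite_measure) Lp_dual_attained_infinity:
  fixes h :: "'a \<Rightarrow> real"
  assumes nz: "emeasure M (space M) \<noteq> 0" and h[measurable]: "h \<in> borel_measurable M" and i: "integrable M h"
  shows "\<exists>f\<in>Lp_sphere M \<infinity>. \<forall>g\<in>Lp_sphere M \<infinity>. \<bar>LINT z|M. g z * h z\<bar> \<le> \<bar>LINT z|M. f z * h z\<bar>"
proof
  define f where "f z = (if h z \<ge> 0 then 1 else - 1 :: real)" for z
  have [measurable]: "f \<in> borel_measurable M" unfolding f_def by measurable
  have "\<bar>f z\<bar> = 1" for z by (simp add: f_def)
  then have "esssup M (\<lambda>z. ereal \<bar>f z\<bar>) = 1" using esssup_const[OF nz, of "1::ereal"] by (simp add: one_ereal_def)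
  then show "f \<in> Lp_sphere M \<infinity>" by (simp add: Lp_space_def Lp_norm_def)
  have fh: "f z * h z = \<bar>h z\<bar>" for z by (simp add: f_def)
  show "\<forall>g\<in>Lp_sphere M \<infinity>. \<bar>LINT z|M. g z * h z\<bar> \<le> \<bar>LINT z|M. f z * h z\<bar>"
  proof
    fix g assume g: "g \<in> Lp_sphere M \<infinity>"
    note [measurable] = Lp_sphere_infinity(1)[OF g]
    have b: "AE z in M. \<bar>g z * h z\<bar> \<le> \<bar>h z\<bar>"
      using Lp_sphere_infinity(2)[OF g] by eventually_elim (simp add: abs_mult mult_left_le_one_le)
    have gi: "integrable M (\<lambda>z. g z * h z)"
      by (rule Bochner_Integration.integrable_bound[OF i]) (use b in auto)
    have "\<bar>LINT z|M. g z * h z\<bar> \<le> (LINT z|M. \<bar>g z * h z\<bar>)" by (rule integral_abs_bound)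
    also have "\<dots> \<le> (LINT z|M. \<bar>h z\<bar>)"
      by (rule integral_mono_AE) (use gi i b in auto)
    finally show "\<bar>LINT z|M. g z * h z\<bar> \<le> \<bar>LINT z|M. f z * h z\<bar>" by (simp add: fh)
  qed
qed

text \<open>The equality case of Hoelder's inequality: f is proportional to sgn(h) times the power q
  - 1 of |h|. If h vanishes almost everywhere all integrals are 0 and any element of the sphere will
  do.\<close>

lemma (in finite_measure) Lp_dual_attained_finite:
  fixes h :: "'a \<Rightarrow> real"
  assumes nz: "emeasure M (space M) \<noteq> 0" and r: "r > 1"
    and h[measurable]: "h \<in> borel_measurable M" and hC: "\<And>z. z \<in> space M \<Longrightarrow> \<bar>h z\<bar> \<le> C"
  shows "\<exists>f\<in>Lp_sphere M (ereal r). \<forall>g\<in>Lp_sphere M (ereal r). \<bar>LINT z|M. g z * h z\<bar> \<le> \<bar>LINT z|M. f z * h z\<bar>"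
proof -
  \<comment> \<open>The conjugate exponent; (q - 1) r = q makes the r-th power of |f| proportional
    to the q-th power of |h|.\<close>
  define q where "q = r / (r - 1)"
  have q: "q > 1" "1 / r + 1 / q = 1" "(q - 1) * r = q" using r by (auto simp: q_def field_simps)
  define N where "N = (LINT z|M. \<bar>h z\<bar> powr q)"
  have hq: "integrable M (\<lambda>z. \<bar>h z\<bar> powr q)"
  proof (rule integrable_const_bound)
    show "AE z in M. norm (\<bar>h z\<bar> powr q) \<le> C powr q"
      using hC q(1) by (intro AE_I2) (auto intro!: powr_mono2)
  qed simp
  have N: "N \<ge> 0" by (simp add: N_def)
  show ?thesis
  proof (cases "N = 0")
    case True
    then have "AE z in M. \<bar>h z\<bar> powr q = 0"
      using integral_nonneg_eq_0_iff_AE[OF hq] by (simp add: N_def)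
    then have h0: "AE z in M. h z = 0" by eventually_elim simp
    have z: "(LINT z|M. g z * h z) = 0" if [measurable]: "g \<in> borel_measurable M" for g
    proof -
      have "(LINT z|M. g z * h z) = (LINT z|M. 0)" by (rule integral_cong_AE) (use h0 in auto)
      then show ?thesis by simp
    qed
    \<comment> \<open>The constant function of norm 1.\<close>
    define c where "c = measure M (space M) powr (- (1 / r))"
    have "measure M (space M) \<noteq> 0" using nz by (simp add: emeasure_eq_measure)
    then have m: "measure M (space M) > 0" by (simp add: zero_less_measure_iff)
    have "c powr r = measure M (space M) powr (- 1)" using r by (simp add: c_def powr_powr)
    then have "c powr r = 1 / measure M (space M)" using m by (simp add: powr_minus_divide)
    then have "(\<lambda>_. c) \<in> Lp_sphere M (ereal r)"
      unfolding Lp_sphere_finite[OF r] using m by (simp add: c_def)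
    moreover have "g \<in> borel_measurable M" if "g \<in> Lp_sphere M (ereal r)" for g
      using that Lp_sphere_finite[OF r] by blast
    ultimately show ?thesis using z by (intro bexI[of _ "\<lambda>_. c"]) auto
  next
    case False
    then have Np: "N > 0" using N by simp
    define f where "f z = sgn (h z) * \<bar>h z\<bar> powr (q - 1) / N powr (1 / r)" for z
    have [measurable]: "f \<in> borel_measurable M" unfolding f_def by measurable
    have fr: "\<bar>f z\<bar> powr r = \<bar>h z\<bar> powr q / N" for z
    proof -
      have "\<bar>f z\<bar> = \<bar>h z\<bar> powr (q - 1) / N powr (1 / r)"
        using q(1) by (cases "h z = 0") (auto simp: f_def abs_mult abs_sgn_eq)
      then show ?thesis using r Np q(3) by (simp add: powr_divide powr_powr)
    qed
    have f: "f \<in> Lp_sphere M (ereal r)"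
      unfolding Lp_sphere_finite[OF r] fr using hq Np by (simp add: N_def)
    have fh: "f z * h z = \<bar>h z\<bar> powr q / N powr (1 / r)" for z
    proof -
      have "sgn (h z) * h z = \<bar>h z\<bar>" by (simp add: abs_sgn mult.commute)
      then have "f z * h z = \<bar>h z\<bar> * \<bar>h z\<bar> powr (q - 1) / N powr (1 / r)"
        unfolding f_def by (metis (no_types, opaque_lifting) mult.assoc mult.commute times_divide_eq_left)
      also have "\<bar>h z\<bar> * \<bar>h z\<bar> powr (q - 1) = \<bar>h z\<bar> powr q"
        by (cases "h z = 0") (auto simp: powr_mult_base)
      finally show ?thesis .
    qed
    have Nq: "N / N powr (1 / r) = N powr (1 / q)"
    proof -
      have "N / N powr (1 / r) = N powr (1 - 1 / r)" using Np by (simp add: powr_diff)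
      also have "1 - 1 / r = 1 / q" using q(2) by linarith
      finally show ?thesis .
    qed
    have fint: "(LINT z|M. f z * h z) = N powr (1 / q)"
      unfolding fh using Nq by (simp add: N_def)
    have "\<bar>LINT z|M. g z * h z\<bar> \<le> \<bar>LINT z|M. f z * h z\<bar>" if g: "g \<in> Lp_sphere M (ereal r)" for g
    proof -
      have [measurable]: "g \<in> borel_measurable M" and gr: "integrable M (\<lambda>z. \<bar>g z\<bar> powr r)" "(LINT z|M. \<bar>g z\<bar> powr r) = 1"
        using g Lp_sphere_finite[OF r] by auto
      \<comment> \<open>A is the L^q norm of h. Young's inequality is applied to g and h/A, both of
        norm 1, so the bound integrates to A (1/r + 1/q) = A.\<close>
      define A where "A = N powr (1 / q)"
      have A: "A > 0" using Np by (simp add: A_def)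
      have Aq: "A powr q = N" using q(1) Np by (simp add: A_def powr_powr)
      have young: "\<bar>g z * h z\<bar> \<le> A * (\<bar>g z\<bar> powr r / r + \<bar>h z\<bar> powr q / N / q)" for z
      proof -
        have "\<bar>g z\<bar> * (\<bar>h z\<bar> / A) \<le> \<bar>g z\<bar> powr r / r + (\<bar>h z\<bar> / A) powr q / q"
          using A by (intro Youngs_inequality r q) auto
        also have "(\<bar>h z\<bar> / A) powr q = \<bar>h z\<bar> powr q / N" using A by (simp add: powr_divide Aq)
        finally have "A * (\<bar>g z\<bar> * (\<bar>h z\<bar> / A)) \<le> A * (\<bar>g z\<bar> powr r / r + \<bar>h z\<bar> powr q / N / q)"
          using A by (intro mult_left_mono) auto
        then show ?thesis using A by (simp add: abs_mult)
      qed
      have bi: "integrable M (\<lambda>z. A * (\<bar>g z\<bar> powr r / r + \<bar>h z\<bar> powr q / N / q))" using gr(1) hq by simp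
      have "integrable M (\<lambda>z. g z * h z)"
        by (rule Bochner_Integration.integrable_bound[OF bi]) (use young in \<open>auto intro: order_trans[OF _ abs_ge_self]\<close>)
      then have "\<bar>LINT z|M. g z * h z\<bar> \<le> (LINT z|M. A * (\<bar>g z\<bar> powr r / r + \<bar>h z\<bar> powr q / N / q))"
        by (intro order_trans[OF integral_abs_bound integral_mono[OF integrable_abs bi young]])
      also have "\<dots> = A * (1 / r + N / N / q)" using gr hq by (simp add: N_def)
      also have "\<dots> = A" using q(2) Np by simp
      finally show ?thesis by (simp add: fint A_def)
    qed
    with f show ?thesis by blast
  qed
qed

lemma (in finite_measure) Lp_dual_attained:
  fixes h :: "'a \<Rightarrow> real"
  assumes nz: "emeasure M (space M) \<noteq> 0" and p: "1 < p"
    and h: "h \<in> borel_measurable M" and hC: "\<And>z. z \<in> space M \<Longrightarrow> \<bar>h z\<bar> \<le> C"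
  shows "\<exists>f\<in>Lp_sphere M p. \<forall>g\<in>Lp_sphere M p. \<bar>LINT z|M. g z * h z\<bar> \<le> \<bar>LINT z|M. f z * h z\<bar>"
proof (cases p)
  case (real r)
  then show ?thesis using Lp_dual_attained_finite[OF nz _ h hC, of r] p by (simp add: one_ereal_def)
next
  case PInf
  have "integrable M h" by (rule integrable_const_bound[of _ C]) (use h hC in auto)
  then show ?thesis using Lp_dual_attained_infinity[OF nz h] PInf by simp
qed (use p in auto)

text \<open>Duality with the constant function 1: the maximal integral is attained, hence finite,
  and it bounds the integral of |g| because |g| lies on the sphere too.\<close>

lemma (in finite_measure) Lp_sphere_L1_bound:
  assumes nz: "emeasure M (space M) \<noteq> 0" and p: "1 < p"
  obtains L where "\<And>g. g \<in> Lp_sphere M p \<Longrightarrow> (LINT z|M. \<bar>g z\<bar>) \<le> L"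
proof -
  obtain f where "\<forall>g\<in>Lp_sphere M p. \<bar>LINT z|M. g z * 1\<bar> \<le> \<bar>LINT z|M. f z * 1\<bar>"
    using Lp_dual_attained[OF nz p, of "\<lambda>_. 1" 1] by auto
  then have "(LINT z|M. \<bar>g z\<bar>) \<le> \<bar>LINT z|M. f z\<bar>" if "g \<in> Lp_sphere M p" for g
    using Lp_sphere_abs[OF that] by fastforce
  then show ?thesis by (rule that)
qed

subsection \<open>Attainment of the maximal gap\<close>

text \<open>Exchanging the two suprema: it suffices that for each \<open>x\<close> the gap at \<open>x\<close> is maximized by some force,
  because the pointwise maxima depend continuously on \<open>x\<close>.\<close>

lemma max_gap_attained:
  fixes sol :: "'f \<Rightarrow> real \<times> real \<Rightarrow> real"
  assumes l: "l > 0" and sol: "\<And>f. f \<in> G \<Longrightarrow> sol f \<in> H2star l" "\<And>f. f \<in> G \<Longrightarrow> hess l (sol f) \<le> C"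
    and attained: "\<And>x. x \<in> {0..pi} \<Longrightarrow> \<exists>f\<in>G. \<forall>g\<in>G. \<bar>gap l (sol g) x\<bar> \<le> \<bar>gap l (sol f) x\<bar>"
  shows "\<exists>f\<in>G. \<forall>g\<in>G. max_gap l (sol g) \<le> max_gap l (sol f)"
proof -
  obtain F where F: "\<And>x. x \<in> {0..pi} \<Longrightarrow> F x \<in> G"
      "\<And>x g. x \<in> {0..pi} \<Longrightarrow> g \<in> G \<Longrightarrow> \<bar>gap l (sol g) x\<bar> \<le> \<bar>gap l (sol (F x)) x\<bar>"
    using attained by metis
  define m where "m x = \<bar>gap l (sol (F x)) x\<bar>" for x
  have C: "C \<ge> 0" using sol(2)[OF F(1)[of 0]] hess_nonneg[of l "sol (F 0)"] by simp
  have holder: "\<bar>gap l (sol f) x - gap l (sol f) x'\<bar> \<le> sqrt (2 * l * C) * sqrt \<bar>x - x'\<bar>"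
    if "f \<in> G" "x \<in> {0..pi}" "x' \<in> {0..pi}" for f x x'
  proof -
    have "\<bar>gap l (sol f) x - gap l (sol f) x'\<bar> \<le> sqrt (2 * l * \<bar>x - x'\<bar>) * sqrt (hess l (sol f))"
      by (rule gap_holder[OF l sol(1)[OF that(1)] that(2,3)])
    also have "\<dots> \<le> sqrt (2 * l * \<bar>x - x'\<bar>) * sqrt C"
      using l by (intro mult_left_mono real_sqrt_le_mono sol(2) that) auto
    finally show ?thesis by (simp add: real_sqrt_mult mult_ac)
  qed
  \<comment> \<open>The force chosen for x is a competitor at x', so the common Hoelder modulus of
    all admissible gaps passes to their pointwise maximum; exchanging x and x' gives the other
    direction.\<close>
  have mle: "m x - m x' \<le> sqrt (2 * l * C) * sqrt \<bar>x - x'\<bar>" if "x \<in> {0..pi}" "x' \<in> {0..pi}" for x x'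
    using holder[OF F(1)[OF that(1)] that] F(2)[OF that(2) F(1)[OF that(1)]] unfolding m_def by linarith
  have "continuous_on {0..pi} m"
    unfolding continuous_on_def
  proof
    fix x assume x: "x \<in> {0..pi}"
    have "((\<lambda>y. m y - m x) \<longlongrightarrow> 0) (at x within {0..pi})"
    proof (rule Lim_null_comparison)
      show "\<forall>\<^sub>F y in at x within {0..pi}. norm (m y - m x) \<le> sqrt (2 * l * C) * sqrt \<bar>y - x\<bar>"
        unfolding eventually_at_filter
      proof (intro always_eventually allI impI)
        fix y assume y: "y \<in> {0..pi}"
        show "norm (m y - m x) \<le> sqrt (2 * l * C) * sqrt \<bar>y - x\<bar>"
          using mle[OF y x] mle[OF x y] by (simp add: abs_le_iff abs_minus_commute)
      qed
      have "((\<lambda>y. sqrt (2 * l * C) * sqrt \<bar>y - x\<bar>) \<longlongrightarrow> sqrt (2 * l * C) * sqrt \<bar>x - x\<bar>) (at x within {0..pi})"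
        by (intro tendsto_intros)
      then show "((\<lambda>y. sqrt (2 * l * C) * sqrt \<bar>y - x\<bar>) \<longlongrightarrow> 0) (at x within {0..pi})" by simp
    qed
    then show "(m \<longlongrightarrow> m x) (at x within {0..pi})" by (simp add: LIM_zero_iff)
  qed
  then obtain x where x: "x \<in> {0..pi}" "\<And>y. y \<in> {0..pi} \<Longrightarrow> m y \<le> m x"
    using continuous_attains_sup[of "{0..pi}" m] by auto
  have le: "\<bar>gap l (sol g) y\<bar> \<le> m x" if "g \<in> G" "y \<in> {0..pi}" for g y
    using F(2)[OF that(2,1)] x(2)[OF that(2)] by (simp add: m_def)
  show ?thesis
  proof (intro bexI[of _ "F x"] ballI F(1) x(1))
    fix g assume g: "g \<in> G"
    have "max_gap l (sol g) \<le> m x" unfolding max_gap_def by (rule cSUP_least) (use le[OF g] in auto)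
    \<comment> \<open>A supremum of reals dominates its members only when bounded above;
      \<open>le\<close> supplies the bound m x.\<close>
    also have "m x \<le> max_gap l (sol (F x))"
      unfolding max_gap_def m_def using le[OF F(1)[OF x(1)]] by (intro cSUP_upper x(1) bdd_aboveI2)
    finally show "max_gap l (sol g) \<le> max_gap l (sol (F x))" .
  qed
qed

section \<open>Representers, minimizers and the maximization over unit forces\<close>

context weighted_plate
begin

lemma plain: "weighted_plate l \<sigma> 1 (\<lambda>_. 1)"
  by unfold_locales (auto intro: l \<sigma>)

text \<open>Riesz for a difference of two point values, bounded by the sup estimate. The representer
  is taken for the weighted form, so in the first energy it depends on D.\<close>

lemma gap_representer:
  obtains rep where "\<And>x. rep x \<in> H2star l" "\<And>x v. v \<in> H2star l \<Longrightarrow> a (rep x) v = gap l v x"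
proof -
  obtain K where K: "K > 0" "\<And>u z. u \<in> H2star l \<Longrightarrow> \<bar>u z\<bar> \<le> K * sqrt (hess l u)" using sup_bound[OF l] by blast
  have "\<exists>u. u \<in> H2star l \<and> (\<forall>v\<in>H2star l. a u v = gap l v x)" for x
  proof -
    have lin: "linear_on (\<lambda>v. gap l v x)" by (simp add: linear_on_def gap_def algebra_simps)
    have "\<bar>gap l v x\<bar> \<le> (2 * K / sqrt (1 - \<sigma>)) * sqrt (a v v)" if v: "v \<in> H2star l" for v
    proof -
      have "\<bar>gap l v x\<bar> \<le> 2 * K * sqrt (hess l v)"
        using K(2)[OF v, of "(x, l)"] K(2)[OF v, of "(x, -l)"] by (simp add: gap_def)
      moreover have "sqrt (1 - \<sigma>) * sqrt (hess l v) \<le> sqrt (a v v)"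
        using real_sqrt_le_mono[OF wform_bounds(1)[OF v]] by (simp add: real_sqrt_mult)
      then have "2 * K * sqrt (hess l v) \<le> 2 * K * (sqrt (a v v) / sqrt (1 - \<sigma>))"
        using K(1) \<sigma> by (intro mult_left_mono) (auto simp: field_simps)
      ultimately show ?thesis by simp
    qed
    from riesz[OF lin this] show ?thesis by metis
  qed
  then show ?thesis using that by metis
qed

text \<open>The bound on F is in the plain norm, as for a dual norm, and passes to the weighted
  form. Symmetry then gives the gap as a(rep x, u) = a(u, rep x) = F(rep x).\<close>

lemma minimizer_properties:
  assumes rep: "\<And>x. rep x \<in> H2star l" "\<And>x v. v \<in> H2star l \<Longrightarrow> a (rep x) v = gap l v x"
    and F: "linear_on F" "\<And>v. v \<in> H2star l \<Longrightarrow> \<bar>F v\<bar> \<le> C * sqrt (wform l \<sigma> (\<lambda>_. 1) v v)"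
    and C: "C \<ge> 0"
    and E: "\<And>v. v \<in> H2star l \<Longrightarrow> E v = a v v / 2 - F v"
    and u: "u = (THE v. is_arg_min E (\<lambda>v. v \<in> H2star l) v)"
  shows "u \<in> H2star l" "hess l u \<le> C\<^sup>2 / (1 - \<sigma>)" "gap l u x = F (rep x)"
proof -
  have b: "\<bar>F v\<bar> \<le> C * sqrt (a v v)" if v: "v \<in> H2star l" for v
    using order_trans[OF F(2)[OF v] mult_left_mono[OF real_sqrt_le_mono[OF wform_bounds(3)[OF v]] C]] .
  obtain y where y: "y \<in> H2star l" "\<And>v. v \<in> H2star l \<Longrightarrow> a y v = F v" using riesz[OF F(1) b] by blast
  have uy: "u = y" unfolding u by (rule arg_min_eq[OF F(1) y E])
  show "u \<in> H2star l" using y uy by simp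
  show "gap l u x = F (rep x)"
    using rep(2)[OF y(1), of x] y(2)[OF rep(1), of x] wform_sym[of "rep x" y] uy by simp
  \<comment> \<open>Testing the Euler equation with the minimizer itself bounds its energy uniformly
    over all admissible forces.\<close>
  have "a y y \<le> C * sqrt (a y y)" using b[OF y(1)] y(2)[OF y(1)] by simp
  then have "sqrt (a y y) * sqrt (a y y) \<le> C * sqrt (a y y)" using wform_bounds(4)[OF y(1)] by simp
  then have "sqrt (a y y) \<le> C" if "a y y > 0"
    by (rule mult_right_le_imp_le) (use that in simp)
  then have "sqrt (a y y) \<le> C"
    using C wform_bounds(4)[OF y(1)] by (cases "a y y = 0") auto
  then have "(sqrt (a y y))\<^sup>2 \<le> C\<^sup>2" using wform_bounds(4)[OF y(1)] by (intro power_mono) auto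
  then have "a y y \<le> C\<^sup>2" using wform_bounds(4)[OF y(1)] by simp
  then have "(1 - \<sigma>) * hess l y \<le> C\<^sup>2" using wform_bounds(1)[OF y(1)] by linarith
  then show "hess l u \<le> C\<^sup>2 / (1 - \<sigma>)" using \<sigma> uy by (simp add: field_simps)
qed

lemma H2star_norm_eq: "H2star_norm l \<sigma> v = sqrt (wform l \<sigma> (\<lambda>_. 1) v v)"
  by (simp add: H2star_norm_def plate_form_Omega)

lemma Hm2star_linear: "F \<in> Hm2star l \<sigma> \<Longrightarrow> linear_on F"
  unfolding linear_on_def Hm2star_def by (auto simp: H2star_cmult[OF l])

text \<open>The dual norm is a supremum of F without absolute value; since the unit sphere is
  symmetric, scaling v by 1/n and by -1/n controls both signs.\<close>

lemma Hm2star_unit_bound: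
  assumes F: "F \<in> Hm2star l \<sigma>" "Hm2star_norm l \<sigma> F = 1" and v: "v \<in> H2star l"
  shows "\<bar>F v\<bar> \<le> H2star_norm l \<sigma> v"
proof -
  interpret P: weighted_plate l \<sigma> 1 "\<lambda>_. 1" by (rule plain)
  obtain C where C: "\<And>v. v \<in> H2star l \<Longrightarrow> \<bar>F v\<bar> \<le> C * H2star_norm l \<sigma> v"
    using F(1) unfolding Hm2star_def by blast
  have cF: "F (\<lambda>z. c * v z) = c * F v" for c using F(1) v by (simp add: Hm2star_def)
  have le1: "F x \<le> 1" if "x \<in> H2star l" "H2star_norm l \<sigma> x = 1" for x
  proof -
    have "bdd_above (F ` {v \<in> H2star l. H2star_norm l \<sigma> v = 1})"
    proof (rule bdd_aboveI2)
      fix y assume "y \<in> {v \<in> H2star l. H2star_norm l \<sigma> v = 1}"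
      then show "F y \<le> C" using C[of y] by simp
    qed
    then have "F x \<le> Hm2star_norm l \<sigma> F" unfolding Hm2star_norm_def using that by (intro cSUP_upper) auto
    then show ?thesis using F(2) by simp
  qed
  define n where "n = H2star_norm l \<sigma> v"
  have n0: "n \<ge> 0" by (simp add: n_def H2star_norm_eq P.wform_bounds(4)[OF v])
  have "F v \<le> n" "- F v \<le> n"
  proof -
    have "c * F v \<le> 1" if c: "\<bar>c\<bar> = 1 / n" "n > 0" for c
    proof -
      have "wform l \<sigma> (\<lambda>_. 1) (\<lambda>z. c * v z) (\<lambda>z. c * v z) = c\<^sup>2 * wform l \<sigma> (\<lambda>_. 1) v v"
        using P.B_square_comb[OF v v, of c 0] by simp
      then have "H2star_norm l \<sigma> (\<lambda>z. c * v z) = \<bar>c\<bar> * n" by (simp add: H2star_norm_eq real_sqrt_mult n_def)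
      then have "H2star_norm l \<sigma> (\<lambda>z. c * v z) = 1" using c by simp
      from le1[OF H2star_cmult[OF l v] this] show ?thesis by (simp add: cF)
    qed
    from this[of "1 / n"] this[of "- (1 / n)"] have "F v \<le> n \<and> - F v \<le> n" if "n > 0"
      using that by (simp add: field_simps)
    \<comment> \<open>A vector of norm zero cannot be normalized; here the continuity constant C
      forces F v = 0.\<close>
    moreover have "F v = 0" if "n = 0" using C[OF v] that by (simp add: n_def)
    ultimately show "F v \<le> n" "- F v \<le> n" using n0 by (auto simp: order_le_less)
  qed
  then show ?thesis by (simp add: n_def abs_le_iff)
qed

text \<open>The extremal of the duality: the inner product with v, divided by its norm, has dual
  norm 1 by Cauchy-Schwarz and attains the norm of v at v.\<close>

lemma normalized_functional:
  assumes v: "v \<in> H2star l" and pos: "H2star_norm l \<sigma> v > 0"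
  defines "F \<equiv> \<lambda>x. wform l \<sigma> (\<lambda>_. 1) v x / H2star_norm l \<sigma> v"
  shows "F \<in> Hm2star l \<sigma>" "Hm2star_norm l \<sigma> F = 1" "F v = H2star_norm l \<sigma> v"
proof -
  interpret P: weighted_plate l \<sigma> 1 "\<lambda>_. 1" by (rule plain)
  let ?B = "wform l \<sigma> (\<lambda>_. 1)"
  define n where "n = H2star_norm l \<sigma> v"
  have n: "n > 0" using pos by (simp add: n_def)
  have n2: "?B v v = n * n" using P.wform_bounds(4)[OF v] by (simp add: n_def H2star_norm_eq)
  have lin: "?B v (\<lambda>z. r * x z + s * y z) = r * ?B v x + s * ?B v y" if "x \<in> H2star l" "y \<in> H2star l" for x y r s
    using P.B_comb[OF that v, of r s] by (simp add: P.wform_sym)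
  have bnd: "\<bar>?B v x\<bar> \<le> n * H2star_norm l \<sigma> x" if "x \<in> H2star l" for x
    using P.B_CS_sqrt[OF v that] by (simp add: n_def H2star_norm_eq)
  have F: "F x = ?B v x / n" for x by (simp add: F_def n_def)
  show Fv: "F v = H2star_norm l \<sigma> v" using n by (simp add: F n2 n_def[symmetric])
  have Fb: "\<bar>F x\<bar> \<le> 1 * H2star_norm l \<sigma> x" if "x \<in> H2star l" for x
    using bnd[OF that] n by (simp add: F abs_div field_simps)
  show "F \<in> Hm2star l \<sigma>"
    unfolding Hm2star_def
  proof (intro CollectI conjI ballI allI exI[of _ 1] Fb)
    fix x y assume "x \<in> H2star l" "y \<in> H2star l"
    then show "F (\<lambda>z. x z + y z) = F x + F y" using lin[of x y 1 1] by (simp add: F add_divide_distrib)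
  next
    fix c x assume "x \<in> H2star l"
    then show "F (\<lambda>z. c * x z) = c * F x" using lin[of x x c 0] by (simp add: F)
  qed
  have cv: "(\<lambda>z. 1 / n * v z) \<in> H2star l" by (rule H2star_cmult[OF l v])
  have "?B (\<lambda>z. 1 / n * v z) (\<lambda>z. 1 / n * v z) = 1"
    using P.B_square_comb[OF v v, of "1 / n" 0] n by (simp add: n2 power2_eq_square)
  then have c1: "H2star_norm l \<sigma> (\<lambda>z. 1 / n * v z) = 1" by (simp add: H2star_norm_eq)
  have Fc: "F (\<lambda>z. 1 / n * v z) = 1" using lin[OF v v, of "1 / n" 0] n by (simp add: F n2)
  show "Hm2star_norm l \<sigma> F = 1"
    unfolding Hm2star_norm_def
  proof (rule cSup_eq_maximum)
    show "1 \<in> F ` {v \<in> H2star l. H2star_norm l \<sigma> v = 1}" using cv c1 Fc by (intro image_eqI[of _ _ "\<lambda>z. 1 / n * v z"]) auto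
    fix y assume "y \<in> F ` {v \<in> H2star l. H2star_norm l \<sigma> v = 1}"
    then show "y \<le> 1" using Fb by fastforce
  qed
qed

text \<open>By \<open>minimizer_properties\<close> the gap at x is F(rep x). Over unit functionals
  its largest modulus is the plain norm of rep x, although rep x represents the gap in the weighted
  form.\<close>

lemma max_gap_dual_attained:
  assumes sol: "\<And>F. sol F = (THE v. is_arg_min (E F) (\<lambda>v. v \<in> H2star l) v)"
    and E: "\<And>F v. v \<in> H2star l \<Longrightarrow> E F v = a v v / 2 - F v"
  defines "G \<equiv> {F \<in> Hm2star l \<sigma>. Hm2star_norm l \<sigma> F = 1}"
  shows "\<exists>F\<in>G. \<forall>F'\<in>G. max_gap l (sol F') \<le> max_gap l (sol F)"
proof -
  interpret P: weighted_plate l \<sigma> 1 "\<lambda>_. 1" by (rule plain)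
  obtain rep where rep: "\<And>x. rep x \<in> H2star l" "\<And>x v. v \<in> H2star l \<Longrightarrow> a (rep x) v = gap l v x"
    using gap_representer by blast
  have b: "\<bar>F v\<bar> \<le> 1 * sqrt (wform l \<sigma> (\<lambda>_. 1) v v)" if "F \<in> G" "v \<in> H2star l" for F v
    using Hm2star_unit_bound[of F v] that by (simp add: G_def H2star_norm_eq)
  have lin: "linear_on F" if "F \<in> G" for F using that Hm2star_linear by (simp add: G_def)
  have mp: "sol F \<in> H2star l" "hess l (sol F) \<le> 1\<^sup>2 / (1 - \<sigma>)" "gap l (sol F) x = F (rep x)" if F: "F \<in> G" for F x
    using minimizer_properties[OF rep lin[OF F] b[OF F] zero_le_one E sol] by blast+
  show ?thesis
  proof (rule max_gap_attained[OF l])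
    show "sol F \<in> H2star l" if "F \<in> G" for F using mp(1)[OF that] .
    show "hess l (sol F) \<le> 1\<^sup>2 / (1 - \<sigma>)" if "F \<in> G" for F using mp(2)[OF that] .
    fix x
    have gapF: "gap l (sol F) x = F (rep x)" if "F \<in> G" for F using mp(3)[OF that] .
    have bd: "\<bar>F (rep x)\<bar> \<le> H2star_norm l \<sigma> (rep x)" if "F \<in> G" for F
      using b[OF that rep(1)] by (simp add: H2star_norm_eq)
    obtain F where F: "F \<in> G" "\<bar>F (rep x)\<bar> = H2star_norm l \<sigma> (rep x)"
    proof (cases "H2star_norm l \<sigma> (rep x) > 0")
      case True
      note nf = normalized_functional[OF rep(1) True]
      have "(\<lambda>y. wform l \<sigma> (\<lambda>_. 1) (rep x) y / H2star_norm l \<sigma> (rep x)) \<in> G" using nf by (simp add: G_def)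
      moreover have "\<bar>wform l \<sigma> (\<lambda>_. 1) (rep x) (rep x) / H2star_norm l \<sigma> (rep x)\<bar> = H2star_norm l \<sigma> (rep x)"
        unfolding nf(3) using True by simp
      ultimately show ?thesis by (rule that)
    next
      case False
      \<comment> \<open>When rep x has norm zero, every admissible functional vanishes there, so any
        functional of norm 1 is maximal.\<close>
      obtain u where u: "u \<in> H2star l" "wform l \<sigma> (\<lambda>_. 1) u u > 0" using P.nontrivial by blast
      then have up: "H2star_norm l \<sigma> u > 0" by (simp add: H2star_norm_eq)
      note nf = normalized_functional[OF u(1) up]
      have FG: "(\<lambda>x. wform l \<sigma> (\<lambda>_. 1) u x / H2star_norm l \<sigma> u) \<in> G" using nf by (simp add: G_def)
      show ?thesis using bd[OF FG] False FG by (intro that[OF FG]) linarith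
    qed
    show "\<exists>F\<in>G. \<forall>F'\<in>G. \<bar>gap l (sol F') x\<bar> \<le> \<bar>gap l (sol F) x\<bar>"
      using F bd gapF by (intro bexI[of _ F]) auto
  qed
qed

lemma emeasure_Omega_nonzero: "emeasure M (space M) \<noteq> 0"
proof
  assume "emeasure M (space M) = 0"
  then have "emeasure lebesgue (Omega l) = 0" by (simp add: emeasure_restrict_space Omega_sets)
  then have "Omega l \<in> null_sets lebesgue" using Omega_sets by (simp add: null_setsI)
  then have "negligible (Omega l)" by (simp add: negligible_iff_null_sets)
  moreover have "(pi / 2, 0) \<in> Omega l" using l by (simp add: Omega_def)
  ultimately show False using open_not_negligible[OF Omega_open[of l]] by blast
qed

text \<open>The factor \<omega> carries the reduction of the force: 1 for the first energy, 1/(1 + d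
  chi_D) for the second. The gap at x is then the pairing of f with the bounded function \<omega>
  times rep x. Integrability premises appear in \<open>E\<close> because an energy given by a single
  integral must be split.\<close>

lemma max_gap_Lp_attained:
  assumes p: "1 < p"
    and \<omega>: "\<omega> \<in> borel_measurable M" "\<And>z. \<bar>\<omega> z\<bar> \<le> 1"
    and sol: "\<And>f. sol f = (THE v. is_arg_min (E f) (\<lambda>v. v \<in> H2star l) v)"
    and E: "\<And>f v. integrable M f \<Longrightarrow> v \<in> H2star l \<Longrightarrow> integrable M (\<lambda>z. f z * (\<omega> z * v z)) \<Longrightarrow>
      E f v = a v v / 2 - (LINT z|M. f z * (\<omega> z * v z))"
  shows "\<exists>f\<in>Lp_sphere M p. \<forall>g\<in>Lp_sphere M p. max_gap l (sol g) \<le> max_gap l (sol f)"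
proof -
  interpret P: weighted_plate l \<sigma> 1 "\<lambda>_. 1" by (rule plain)
  obtain rep where rep: "\<And>x. rep x \<in> H2star l" "\<And>x v. v \<in> H2star l \<Longrightarrow> a (rep x) v = gap l v x"
    using gap_representer by blast
  obtain K where K: "K > 0" "\<And>u z. u \<in> H2star l \<Longrightarrow> \<bar>u z\<bar> \<le> K * sqrt (hess l u)" using sup_bound[OF l] by blast
  obtain L where L: "\<And>g. g \<in> Lp_sphere M p \<Longrightarrow> (LINT z|M. \<bar>g z\<bar>) \<le> L"
    using Om.Lp_sphere_L1_bound[OF emeasure_Omega_nonzero p] by blast
  define F where "F f v = (LINT z|M. f z * (\<omega> z * v z))" for f v
  have vm: "v \<in> borel_measurable M" if "v \<in> H2star l" for v using L2_measurable[OF H2star_L2[OF that]] .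
  have b: "\<bar>\<omega> z * v z\<bar> \<le> K * sqrt (hess l v)" if "v \<in> H2star l" for v z
    using mult_mono[OF \<omega>(2)[of z] K(2)[OF that, of z]] by (simp add: abs_mult)
  have int: "integrable M (\<lambda>z. f z * (\<omega> z * v z))" if f: "integrable M f" and v: "v \<in> H2star l" for f v
  proof (rule Bochner_Integration.integrable_bound)
    show "integrable M (\<lambda>z. (K * sqrt (hess l v)) * \<bar>f z\<bar>)" using f by simp
    show "(\<lambda>z. f z * (\<omega> z * v z)) \<in> borel_measurable M" using borel_measurable_integrable[OF f] \<omega>(1) vm[OF v] by simp
    show "AE z in M. norm (f z * (\<omega> z * v z)) \<le> norm (K * sqrt (hess l v) * \<bar>f z\<bar>)"
    proof (rule AE_I2)
      fix z
      have "\<bar>f z\<bar> * \<bar>\<omega> z * v z\<bar> \<le> \<bar>f z\<bar> * (K * sqrt (hess l v))" by (rule mult_left_mono[OF b[OF v]]) simp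
      then show "norm (f z * (\<omega> z * v z)) \<le> norm (K * sqrt (hess l v) * \<bar>f z\<bar>)"
        using K(1) by (simp add: abs_mult hess_nonneg mult_ac)
    qed
  qed
  have fi: "integrable M f" if "f \<in> Lp_sphere M p" for f by (rule Om.Lp_sphere_integrable[OF p that])
  \<comment> \<open>L bounds the L^1 norms on the sphere, and K/sqrt(1 - \<sigma>) bounds sup |v| by
    the plain energy norm.\<close>
  define C where "C = \<bar>L\<bar> * K / sqrt (1 - \<sigma>)"
  have C: "C \<ge> 0" using K(1) \<sigma> by (simp add: C_def)
  have lin: "linear_on (F f)" if f: "f \<in> Lp_sphere M p" for f
    unfolding linear_on_def
  proof (intro ballI allI)
    fix u v r s assume uv: "u \<in> H2star l" "v \<in> H2star l"
    have "F f (\<lambda>z. r * u z + s * v z) = (LINT z|M. r * (f z * (\<omega> z * u z)) + s * (f z * (\<omega> z * v z)))"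
      by (simp add: F_def algebra_simps)
    also have "\<dots> = r * F f u + s * F f v" unfolding F_def using int[OF fi[OF f]] uv by simp
    finally show "F f (\<lambda>z. r * u z + s * v z) = r * F f u + s * F f v" .
  qed
  have Fb: "\<bar>F f v\<bar> \<le> C * sqrt (wform l \<sigma> (\<lambda>_. 1) v v)" if f: "f \<in> Lp_sphere M p" and v: "v \<in> H2star l" for f v
  proof -
    let ?k = "K * sqrt (hess l v)"
    have k0: "0 \<le> ?k" using K(1) by (simp add: hess_nonneg)
    have "\<bar>F f v\<bar> \<le> (LINT z|M. \<bar>f z * (\<omega> z * v z)\<bar>)" unfolding F_def by (rule integral_abs_bound)
    also have "\<dots> \<le> (LINT z|M. ?k * \<bar>f z\<bar>)"
    proof (rule integral_mono)
      show "integrable M (\<lambda>z. \<bar>f z * (\<omega> z * v z)\<bar>)" using int[OF fi[OF f] v] by simp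
      show "integrable M (\<lambda>z. ?k * \<bar>f z\<bar>)" using fi[OF f] by simp
      show "\<bar>f z * (\<omega> z * v z)\<bar> \<le> ?k * \<bar>f z\<bar>" for z
        using mult_right_mono[OF b[OF v], of "\<bar>f z\<bar>" z] by (simp add: abs_mult mult_ac)
    qed
    also have "\<dots> = ?k * (LINT z|M. \<bar>f z\<bar>)" by simp
    also have "\<dots> \<le> ?k * \<bar>L\<bar>" using L[OF f] by (intro mult_left_mono k0) linarith
    also have "\<dots> \<le> C * sqrt (wform l \<sigma> (\<lambda>_. 1) v v)"
    proof -
      have "sqrt (1 - \<sigma>) * sqrt (hess l v) \<le> sqrt (wform l \<sigma> (\<lambda>_. 1) v v)"
        using real_sqrt_le_mono[OF P.wform_bounds(1)[OF v]] by (simp add: real_sqrt_mult)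
      then have "sqrt (hess l v) \<le> sqrt (wform l \<sigma> (\<lambda>_. 1) v v) / sqrt (1 - \<sigma>)" using \<sigma> by (simp add: field_simps)
      then have "(\<bar>L\<bar> * K) * sqrt (hess l v) \<le> (\<bar>L\<bar> * K) * (sqrt (wform l \<sigma> (\<lambda>_. 1) v v) / sqrt (1 - \<sigma>))"
        using K(1) by (intro mult_left_mono) auto
      then show ?thesis by (simp add: C_def mult_ac)
    qed
    finally show ?thesis .
  qed
  have EF: "E f v = a v v / 2 - F f v" if "f \<in> Lp_sphere M p" "v \<in> H2star l" for f v
    unfolding F_def by (rule E[OF fi[OF that(1)] that(2) int[OF fi[OF that(1)] that(2)]])
  have mp: "sol f \<in> H2star l" "hess l (sol f) \<le> C\<^sup>2 / (1 - \<sigma>)" "gap l (sol f) x = F f (rep x)"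
    if f: "f \<in> Lp_sphere M p" for f x
    using minimizer_properties[OF rep lin[OF f] Fb[OF f] C EF[OF f] sol] by blast+
  show ?thesis
  proof (rule max_gap_attained[OF l])
    show "sol f \<in> H2star l" if "f \<in> Lp_sphere M p" for f using mp(1)[OF that] .
    show "hess l (sol f) \<le> C\<^sup>2 / (1 - \<sigma>)" if "f \<in> Lp_sphere M p" for f using mp(2)[OF that] .
    fix x
    have gapF: "gap l (sol f) x = (LINT z|M. f z * (\<omega> z * rep x z))" if "f \<in> Lp_sphere M p" for f
      using mp(3)[OF that] by (simp add: F_def)
    have "(\<lambda>z. \<omega> z * rep x z) \<in> borel_measurable M" using \<omega>(1) vm[OF rep(1)] by simp
    from Om.Lp_dual_attained[OF emeasure_Omega_nonzero p this b[OF rep(1)]]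
    obtain f where "f \<in> Lp_sphere M p"
      "\<forall>g\<in>Lp_sphere M p. \<bar>LINT z|M. g z * (\<omega> z * rep x z)\<bar> \<le> \<bar>LINT z|M. f z * (\<omega> z * rep x z)\<bar>" by blast
    then show "\<exists>f\<in>Lp_sphere M p. \<forall>g\<in>Lp_sphere M p. \<bar>gap l (sol g) x\<bar> \<le> \<bar>gap l (sol f) x\<bar>"
      using gapF by (intro bexI[of _ f] ballI) (simp_all only: gapF)
  qed
qed

end

theorem theorem3p1:
  fixes l \<sigma> d :: real and D :: "(real \<times> real) set" and p :: ereal
  assumes "l > 0" and "0 < \<sigma>" and "\<sigma> < 1" and "d > 0"
    and "open D" and "D \<subseteq> Omega l" and "1 < p"
  shows
    "(\<exists>F\<in>{F \<in> Hm2star l \<sigma>. Hm2star_norm l \<sigma> F = 1}.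
        \<forall>G\<in>{F \<in> Hm2star l \<sigma>. Hm2star_norm l \<sigma> F = 1}.
          max_gap l (minimizer1 l \<sigma> d D G) \<le> max_gap l (minimizer1 l \<sigma> d D F))
   \<and> (\<exists>f\<in>{f \<in> Lp_space (lebesgue_on (Omega l)) p. Lp_norm (lebesgue_on (Omega l)) p f = 1}.
        \<forall>g\<in>{f \<in> Lp_space (lebesgue_on (Omega l)) p. Lp_norm (lebesgue_on (Omega l)) p f = 1}.
          max_gap l (minimizer1 l \<sigma> d D (force_functional l g))
            \<le> max_gap l (minimizer1 l \<sigma> d D (force_functional l f)))
   \<and> (\<exists>f\<in>{f \<in> Lp_space (lebesgue_on (Omega l)) p. Lp_norm (lebesgue_on (Omega l)) p f = 1}.
        \<forall>g\<in>{f \<in> Lp_space (lebesgue_on (Omega l)) p. Lp_norm (lebesgue_on (Omega l)) p f = 1}.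
          max_gap l (minimizer2 l \<sigma> d D g) \<le> max_gap l (minimizer2 l \<sigma> d D f))"
proof -
  let ?M = "lebesgue_on (Omega l)"
  \<comment> \<open>Weight of the form in the first energy; its reciprocal multiplies the force in
    the second.\<close>
  define w where "w z = 1 + d * indicat_real D z" for z
  have wm: "w \<in> borel_measurable ?M"
    unfolding w_def using assms(5)
    by (intro borel_lebesgue_on borel_measurable_add borel_measurable_times borel_measurable_const borel_measurable_indicator) auto
  interpret W: weighted_plate l \<sigma> "1 + d" w
    by unfold_locales (use assms wm in \<open>auto simp: w_def indicator_def\<close>)
  \<comment> \<open>The second energy keeps the plain form, so its representers are those of weight
    1.\<close>
  interpret P: weighted_plate l \<sigma> 1 "\<lambda>_. 1" by (rule W.plain)
  \<comment> \<open>The energy density of both functionals is half the diagonal of the plate form's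
    density, which matches the pattern a(v, v)/2 - F(v) of \<open>arg_min_eq\<close>.\<close>
  have half: "(laplace l v z)\<^sup>2 / 2 + (1 - \<sigma>) * ((uxy l v z)\<^sup>2 - uxx l v z * uyy l v z) = plate_density l \<sigma> v v z / 2" for v z
    by (simp add: plate_density_def power2_eq_square field_simps)
  have E1: "energy1 l \<sigma> d D F v = wform l \<sigma> w v v / 2 - F v" for F v
    by (simp add: energy1_def half wform_def w_def)
  \<comment> \<open>The force term stands under the same integral as the density, so both parts have
    to be integrable before the integral splits.\<close>
  have E2: "energy2 l \<sigma> d D f v = wform l \<sigma> (\<lambda>_. 1) v v / 2 - (LINT z|?M. f z * (1 / w z * v z))"
    if "v \<in> H2star l" "integrable ?M (\<lambda>z. f z * (1 / w z * v z))" for f v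
  proof -
    have "energy2 l \<sigma> d D f v = (LINT z|?M. 1 * plate_density l \<sigma> v v z / 2 - f z * (1 / w z * v z))"
      by (simp add: energy2_def half w_def)
    also have "\<dots> = (LINT z|?M. 1 * plate_density l \<sigma> v v z / 2) - (LINT z|?M. f z * (1 / w z * v z))"
      using P.wform_integrable[OF that(1) that(1)] that(2) by (intro Bochner_Integration.integral_diff) auto
    also have "(LINT z|?M. 1 * plate_density l \<sigma> v v z / 2) = wform l \<sigma> (\<lambda>_. 1) v v / 2"
      by (simp add: wform_def)
    finally show ?thesis .
  qed
  have winv: "\<bar>1 / w z\<bar> \<le> 1" for z using W.w_ge[of z] by simp
  show ?thesis
  proof (intro conjI)
    show "\<exists>F\<in>{F \<in> Hm2star l \<sigma>. Hm2star_norm l \<sigma> F = 1}. \<forall>G\<in>{F \<in> Hm2star l \<sigma>. Hm2star_norm l \<sigma> F = 1}.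
          max_gap l (minimizer1 l \<sigma> d D G) \<le> max_gap l (minimizer1 l \<sigma> d D F)"
      by (rule W.max_gap_dual_attained[OF minimizer1_def E1])
    show "\<exists>f\<in>Lp_sphere ?M p. \<forall>g\<in>Lp_sphere ?M p. max_gap l (minimizer1 l \<sigma> d D (force_functional l g))
            \<le> max_gap l (minimizer1 l \<sigma> d D (force_functional l f))"
      by (rule W.max_gap_Lp_attained[where \<omega> = "\<lambda>_. 1" and E = "\<lambda>f. energy1 l \<sigma> d D (force_functional l f)"])
        (use assms(7) in \<open>auto simp: minimizer1_def E1 force_functional_def\<close>)
    show "\<exists>f\<in>Lp_sphere ?M p. \<forall>g\<in>Lp_sphere ?M p. max_gap l (minimizer2 l \<sigma> d D g) \<le> max_gap l (minimizer2 l \<sigma> d D f)"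
      by (rule P.max_gap_Lp_attained[where \<omega> = "\<lambda>z. 1 / w z" and E = "energy2 l \<sigma> d D"])
        (use assms(7) wm winv E2 in \<open>auto simp: minimizer2_def\<close>)
  qed
qed

end
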